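(* Suppose that the linear program $\min\{c^\top x : x \in \mathbb{R}^{m_2},\ Ax = b,\ x \ge \mathbf{0}\}$ is totally unimodular and has an optimal solution. Let $\beta \in (0,1)$ be a fixed constant, and run PDHG with adaptive restarts (as defined in the context) from $z^{0,0} = \mathbf{0}$ with a step size $\eta$ satisfying $\frac{1}{4 \|A\|_2} \le \eta \le \frac{1}{2\|A\|_2}$ and with $\tau^0 = 1$. Then, for a target accuracy $\epsilon > 0$, the algorithm requires at most $$O\left( H\, m_1^{2.5} \sqrt{\mathbf{nnz}(A)}\, \log\left( \frac{m_2 H}{\epsilon} \right) \right)$$ matrix-vector multiplications to obtain a point $z^{n,0}$ satisfying $\mathbf{dist}(z^{n,0}, Z^\star) \le \epsilon$. Here $\beta$ is treated as a constant in the $O(\cdot)$ notation.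
   Context: Setting. $m_1, m_2$ are positive integers with $m_2 \ge m_1$; $A \in \mathbb{R}^{m_1\times m_2}$ (nonzero, so that the step-size range makes sense), $b \in \mathbb{R}^{m_1}$, $c \in \mathbb{R}^{m_2}$. $H$ is a number with $|b_i| \le H$ for all $i$ and $|c_j| \le H$ for all $j$. $\mathbf{nnz}(A)$ is the number of nonzero entries of $A$. $\|\cdot\|_2$ is the Euclidean norm for vectors and the spectral norm for matrices. A matrix is totally unimodular if every square submatrix has determinant $0$, $1$ or $-1$. The linear program is totally unimodular if $A$ is totally unimodular and all entries of $b$ and $c$ are integers. The primal problem is $\min\{c^\top x : Ax=b,\ x\ge \mathbf 0\}$ with set of optimal solutions $X^\star$; the dual problem is $\max\{b^\top y : y \in \mathbb{R}^{m_1},\ A^\top y \le c\}$ with set of optimal solutions $Y^\star$. Set $Z^\star = X^\star\times Y^\star$, $Z = \{x\in\mathbb{R}^{m_2} : x \ge \mathbf 0\}\times\mathbb{R}^{m_1}$, and $\mathbf{dist}(z, Z^\star) = \min_{\hat z \in Z^\star}\|z-\hat z\|_2$. Lagrangian: $\mathcal{L}(x,y) = c^\top x + b^\top y - y^\top A x$ (minimized over $x \ge \mathbf 0$, maximized over $y$). Normalized duality gap: for $r\ge 0$ and $z\in Z$ let $W_r(z) = \{\hat z\in Z : \|z-\hat z\|_2\le r\}$. For $r>0$ and $z=(x,y)$, $$\rho_r(z) = \frac{1}{r}\max_{(\hat x,\hat y)\in W_r(z)} \left(\mathcal{L}(x,\hat y)-\mathcal{L}(\hat x,y)\right),$$ and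 $\rho_0(z) = \limsup_{r\to 0^+}\rho_r(z)$. One step of PDHG: given $z=(x,y)$ and $\eta$, OneStepOfPDHG$(z,\eta)$ returns $(x',y')$ with $x' = (x-\eta(c-A^\top y))^+$ (componentwise positive part, i.e. projection onto $\{x \ge \mathbf 0\}$) and $y' = y+\eta(b-A(2x'-x))$. PDHG with adaptive restarts, with inputs $z^{0,0}, \tau^0, \beta, \eta$: for $n=0,1,2,\dots$, set $t\gets 0$ and repeat the following: $z^{n,t+1}\gets$ OneStepOfPDHG$(z^{n,t},\eta)$; $\bar z^{n,t+1}\gets \frac{1}{t+1}\sum_{i=1}^{t+1}z^{n,i}$; $t\gets t+1$; until the restart condition holds. The restart condition is: for $n=0$, $t\ge\tau^0$; for $n\ge1$, $\rho_{\|\bar z^{n,t}-z^{n,0}\|_2}(\bar z^{n,t})\le\beta\,\rho_{\|z^{n,0}-z^{n-1,0}\|_2}(z^{n,0})$. When it holds, set $z^{n+1,0}\gets\bar z^{n,t}$ and continue with the next $n$. A matrix-vector multiplication means a product of $A$ or $A^\top$ with a vector. Each inner iteration counts as a constant number of matrix-vector multiplications, so up to a constant factor the count is the total number of inner iterations performed.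
   Formalization: The factor log(m₂H/ε) is replaced by log(m₂H/min(ε,1/2)), identical for ε ≤ 1/2; as stated for every ε > 0 the bound fails, e.g. A=b=c=H=1, ε=1, where it is 0 but dist(0,Z* )=√2 > ε. *)

theory Defs
  imports
    "Jordan_Normal_Form.Determinant"
    "Jordan_Normal_Form.DL_Submatrix"
    "HOL-Library.Extended_Real"
begin

text \<open>Vectors and matrices have their dimensions as values, not as types, so that the constant
  hidden in the asymptotic bound can be chosen uniformly in all dimensions. For an
  \<open>m\<^sub>1 \<times> m\<^sub>2\<close> matrix, primal vectors have dimension \<open>m\<^sub>2\<close> and dual ones \<open>m\<^sub>1\<close>.\<close>

type_synonym pd_point = "real vec \<times> real vec"

definition vec_norm2 :: "real vec \<Rightarrow> real" where
  "vec_norm2 v = sqrt (v \<bullet> v)"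

definition spectral_norm :: "real mat \<Rightarrow> real" where
  "spectral_norm A =
     (SUP v \<in> {v \<in> carrier_vec (dim_col A). vec_norm2 v \<le> 1}. vec_norm2 (A *\<^sub>v v))"

definition nnz :: "real mat \<Rightarrow> nat" where
  "nnz A = card {(i, j). i < dim_row A \<and> j < dim_col A \<and> A $$ (i, j) \<noteq> 0}"

definition pd_dist :: "pd_point \<Rightarrow> pd_point \<Rightarrow> real" where
  "pd_dist z w = sqrt ((vec_norm2 (fst z - fst w))\<^sup>2 + (vec_norm2 (snd z - snd w))\<^sup>2)"

definition totally_unimodular :: "real mat \<Rightarrow> bool" where
  "totally_unimodular A \<longleftrightarrow>
     (\<forall>I J. I \<subseteq> {..<dim_row A} \<and> J \<subseteq> {..<dim_col A} \<and> card I = card J \<longrightarrow>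
        det (submatrix A I J) \<in> {0, 1, -1})"

definition totally_unimodular_lp :: "real mat \<Rightarrow> real vec \<Rightarrow> real vec \<Rightarrow> bool" where
  "totally_unimodular_lp A b c \<longleftrightarrow>
     totally_unimodular A \<and> (\<forall>i<dim_vec b. b $ i \<in> \<int>) \<and> (\<forall>j<dim_vec c. c $ j \<in> \<int>)"

text \<open>The order on vectors is componentwise and includes equality of the dimensions.\<close>

definition primal_feasible :: "real mat \<Rightarrow> real vec \<Rightarrow> real vec set" where
  "primal_feasible A b =
     {x \<in> carrier_vec (dim_col A). A *\<^sub>v x = b \<and> 0\<^sub>v (dim_col A) \<le> x}"

definition dual_feasible :: "real mat \<Rightarrow> real vec \<Rightarrow> real vec set" where
  "dual_feasible A c = {y \<in> carrier_vec (dim_row A). A\<^sup>T *\<^sub>v y \<le> c}"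

definition primal_optimal :: "real mat \<Rightarrow> real vec \<Rightarrow> real vec \<Rightarrow> real vec set" where
  "primal_optimal A b c =
     {x \<in> primal_feasible A b. \<forall>x' \<in> primal_feasible A b. c \<bullet> x \<le> c \<bullet> x'}"

definition dual_optimal :: "real mat \<Rightarrow> real vec \<Rightarrow> real vec \<Rightarrow> real vec set" where
  "dual_optimal A b c =
     {y \<in> dual_feasible A c. \<forall>y' \<in> dual_feasible A c. b \<bullet> y' \<le> b \<bullet> y}"

definition pd_optimal :: "real mat \<Rightarrow> real vec \<Rightarrow> real vec \<Rightarrow> pd_point set" where
  "pd_optimal A b c = primal_optimal A b c \<times> dual_optimal A b c"

text \<open>Extended reals make the distance to an empty set infinite.\<close>

definition dist_to_set :: "pd_point \<Rightarrow> pd_point set \<Rightarrow> ereal" where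
  "dist_to_set z S = (INF w \<in> S. ereal (pd_dist z w))"

definition pd_domain :: "real mat \<Rightarrow> pd_point set" where
  "pd_domain A =
     {x \<in> carrier_vec (dim_col A). 0\<^sub>v (dim_col A) \<le> x} \<times> carrier_vec (dim_row A)"

definition lagrangian ::
  "real mat \<Rightarrow> real vec \<Rightarrow> real vec \<Rightarrow> real vec \<Rightarrow> real vec \<Rightarrow> real" where
  "lagrangian A b c x y = c \<bullet> x + b \<bullet> y - y \<bullet> (A *\<^sub>v x)"

definition gap_ball :: "real mat \<Rightarrow> real \<Rightarrow> pd_point \<Rightarrow> pd_point set" where
  "gap_ball A r z = {w \<in> pd_domain A. pd_dist z w \<le> r}"

text \<open>The maximum over the ball is written as a supremum; it is attained for points of the
  domain, as the ball is then compact and nonempty.\<close>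

definition gap_pos ::
  "real mat \<Rightarrow> real vec \<Rightarrow> real vec \<Rightarrow> real \<Rightarrow> pd_point \<Rightarrow> ereal" where
  "gap_pos A b c r z =
     ereal (1 / r) *
     (SUP w \<in> gap_ball A r z.
        ereal (lagrangian A b c (fst z) (snd w) - lagrangian A b c (fst w) (snd z)))"

definition normalized_gap ::
  "real mat \<Rightarrow> real vec \<Rightarrow> real vec \<Rightarrow> real \<Rightarrow> pd_point \<Rightarrow> ereal" where
  "normalized_gap A b c r z =
     (if r = 0 then Limsup (at_right 0) (\<lambda>s. gap_pos A b c s z) else gap_pos A b c r z)"

definition pdhg_step ::
  "real mat \<Rightarrow> real vec \<Rightarrow> real vec \<Rightarrow> real \<Rightarrow> pd_point \<Rightarrow> pd_point" where
  "pdhg_step A b c \<eta> z =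
     (let x = fst z; y = snd z;
          x' = map_vec (\<lambda>s. max s 0) (x - \<eta> \<cdot>\<^sub>v (c - A\<^sup>T *\<^sub>v y));
          y' = y + \<eta> \<cdot>\<^sub>v (b - A *\<^sub>v (2 \<cdot>\<^sub>v x' - x))
      in (x', y'))"

definition pdhg_iterate ::
  "real mat \<Rightarrow> real vec \<Rightarrow> real vec \<Rightarrow> real \<Rightarrow> pd_point \<Rightarrow> nat \<Rightarrow> pd_point" where
  "pdhg_iterate A b c \<eta> z t = (pdhg_step A b c \<eta> ^^ t) z"

definition pdhg_average ::
  "real mat \<Rightarrow> real vec \<Rightarrow> real vec \<Rightarrow> real \<Rightarrow> pd_point \<Rightarrow> nat \<Rightarrow> pd_point" where
  "pdhg_average A b c \<eta> z t =
     (vec (dim_col A) (\<lambda>j. (\<Sum>i = 1..t. fst (pdhg_iterate A b c \<eta> z i) $ j) / real t),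
      vec (dim_row A) (\<lambda>j. (\<Sum>i = 1..t. snd (pdhg_iterate A b c \<eta> z i) $ j) / real t))"

text \<open>In what follows, \<open>zs n\<close> is the starting point \<open>z\<^bsup>n,0\<^esup>\<close> of the \<open>n\<close>-th round and \<open>\<tau> n\<close> is
  the number of inner iterations performed in that round.\<close>

definition restart_condition ::
  "real mat \<Rightarrow> real vec \<Rightarrow> real vec \<Rightarrow> nat \<Rightarrow> real \<Rightarrow> real \<Rightarrow> (nat \<Rightarrow> pd_point) \<Rightarrow>
   nat \<Rightarrow> nat \<Rightarrow> bool" where
  "restart_condition A b c \<tau>0 \<beta> \<eta> zs n t \<longleftrightarrow>
     (if n = 0 then \<tau>0 \<le> t
      else (let zbar = pdhg_average A b c \<eta> (zs n) t in
              normalized_gap A b c (pd_dist zbar (zs n)) zbar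
              \<le> ereal \<beta> * normalized_gap A b c (pd_dist (zs n) (zs (n - 1))) (zs n)))"

text \<open>The inner loop of a round need not terminate a priori. The following predicate says that
  the rounds \<open>0, \<dots>, n - 1\<close> of the algorithm all terminate, with \<open>zs 0, \<dots>, zs n\<close> and
  \<open>\<tau> 0, \<dots>, \<tau> (n - 1)\<close> the values computed; these are determined uniquely by the inputs.
  Values at larger indices are irrelevant.\<close>

definition restarted_pdhg_run ::
  "real mat \<Rightarrow> real vec \<Rightarrow> real vec \<Rightarrow> pd_point \<Rightarrow> nat \<Rightarrow> real \<Rightarrow> real \<Rightarrow> nat \<Rightarrow>
   (nat \<Rightarrow> pd_point) \<Rightarrow> (nat \<Rightarrow> nat) \<Rightarrow> bool" where
  "restarted_pdhg_run A b c z0 \<tau>0 \<beta> \<eta> n zs \<tau> \<longleftrightarrow>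
     zs 0 = z0 \<and>
     (\<forall>k<n. 1 \<le> \<tau> k \<and> restart_condition A b c \<tau>0 \<beta> \<eta> zs k (\<tau> k) \<and>
        (\<forall>t. 1 \<le> t \<and> t < \<tau> k \<longrightarrow> \<not> restart_condition A b c \<tau>0 \<beta> \<eta> zs k t) \<and>
        zs (Suc k) = pdhg_average A b c \<eta> (zs k) (\<tau> k))"

end

theory Submission
  imports Defs "HOL-Analysis.Euclidean_Space"
begin

text \<open>Write \<open>\<rho>\<close> for the normalized duality gap, \<open>Z\<close> for the set of optimal primal-dual pairs and \<open>\<sigma>\<close> for
the spectral norm. Two facts about the gap are played against each other.

The gap of an average is small. One PDHG step decreases the distance to a point \<open>w\<close>, measured in a
quadratic form that is equivalent to the squared Euclidean norm because \<open>\<eta> \<sigma> \<le> 1 / 2\<close>, by at least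
\<open>2 \<eta>\<close> times the Lagrangian gap of the new point against \<open>w\<close> (\<open>step_gap\<close>). Summing over \<open>t\<close> steps
shows that the average of \<open>t\<close> iterates has \<open>\<rho> \<le> 3 r / (\<eta> t)\<close>, where \<open>r\<close> is its distance from the
starting point (\<open>normalized_gap_average_le\<close>), and that in the same form it is no further from any
optimal pair than the starting point was (\<open>average_closer_to_saddle\<close>); hence \<open>r\<close> is at most three
times the distance of the starting point from \<open>Z\<close>.

The gap is sharp: the distance from \<open>Z\<close> is at most \<open>\<kappa> \<rho>\<close> with \<open>\<kappa> = 32 m\<^sub>1\<^bsup>2.5\<^esup> H\<close> (\<open>sharpness\<close>). This
is where total unimodularity enters. By Cramer's rule the inverse of a basis has entries in \<open>{0,
1, -1}\<close>, and so has its product with the whole matrix (\<open>basis_inverse\<close>). Therefore there are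
integral optimal solutions \<open>x\<^sup>*\<close>, \<open>y\<^sup>*\<close> of norm at most \<open>R = m\<^sub>1\<^bsup>1.5\<^esup> H\<close>, found as basic solutions.
Moving a point of norm \<open>O(R)\<close> along the primal residual, along the dual residual, or towards the
origin shows that \<open>\<rho>\<close> bounds both residuals and, up to the factor \<open>8 R\<close>, the duality gap.
Complementary slackness with respect to \<open>x\<^sup>*\<close> and \<open>y\<^sup>*\<close> then bounds the violation of the equations
\<open>x\<^sub>j = 0\<close> and \<open>(c - A\<^sup>T y)\<^sub>j = 0\<close> that cut out the optimal faces: the positive slacks of \<open>y\<^sup>*\<close> and the
positive entries of \<open>x\<^sup>*\<close> are at least \<open>1\<close>, being integers. Finally the correction that restores
all violated constraints can be taken as a convex combination of basic solutions
(\<open>dominated_solution\<close>), each of which is at most \<open>m\<^sub>1\<close> times as large as the violation. This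
accounts for \<open>\<kappa> = O(m\<^sub>1 R)\<close>.

Combining the two facts, the restart condition holds as soon as \<open>t \<ge> 9 \<kappa> / (\<eta> \<beta>)\<close>
(\<open>restart_soon\<close>), which is \<open>O(\<kappa> \<sigma>)\<close> and so \<open>O(H m\<^sub>1\<^bsup>2.5\<^esup> \<surd>nnz)\<close>. Every restart multiplies the gap by
at most \<open>\<beta>\<close>, and the gap after the first round is polynomial in \<open>m\<^sub>2 H\<close>; so \<open>O(ln (m\<^sub>2 H / \<epsilon>))\<close>
rounds suffice. If \<open>H < 1\<close>, integrality forces \<open>b\<close> and \<open>c\<close> to vanish and the starting point is
optimal.\<close>

section \<open>Minors of totally unimodular matrices\<close>

text \<open>Rows and columns are selected by arbitrary maps instead of sets. Repeated or unordered selections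
only produce zero minors or sign changes, and replacing one column of a selection, as Cramer's
rule demands, is just a function update.\<close>

definition minor :: "('r \<Rightarrow> 'c \<Rightarrow> real) \<Rightarrow> nat \<Rightarrow> (nat \<Rightarrow> 'r) \<Rightarrow> (nat \<Rightarrow> 'c) \<Rightarrow> real" where
  "minor M k f g = det (mat k k (\<lambda>(i, j). M (f i) (g j)))"

definition tu_on :: "'r set \<Rightarrow> 'c set \<Rightarrow> ('r \<Rightarrow> 'c \<Rightarrow> real) \<Rightarrow> bool" where
  "tu_on R C M \<longleftrightarrow>
     (\<forall>k f g. f ` {..<k} \<subseteq> R \<and> g ` {..<k} \<subseteq> C \<longrightarrow> minor M k f g \<in> {0, 1, -1})"

lemma minor_transpose: "minor (\<lambda>j i. M i j) k g f = minor M k f g"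
proof -
  have "mat k k (\<lambda>(i, j). M (f j) (g i)) = transpose_mat (mat k k (\<lambda>(i, j). M (f i) (g j)))"
    by (rule eq_matI) auto
  then show ?thesis
    unfolding minor_def by (simp add: det_transpose[of _ k])
qed

lemma minor_permute_rows:
  assumes "p permutes {0..<k}"
  shows "minor M k (f \<circ> p) g = signof p * minor M k f g"
proof -
  let ?A = "mat k k (\<lambda>(i, j). M (f i) (g j))"
  have "mat k k (\<lambda>(i, j). M ((f \<circ> p) i) (g j)) = mat k k (\<lambda>(i, j). ?A $$ (p i, j))"
    using permutes_in_image[OF assms] by (intro eq_matI) auto
  then show ?thesis
    unfolding minor_def using det_permute_rows[of ?A k p] assms by simp
qed

lemma minor_cong:
  assumes "\<And>i. i < k \<Longrightarrow> f i = f' i" "\<And>j. j < k \<Longrightarrow> g j = g' j"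
  shows "minor M k f g = minor M k f' g'"
proof -
  have "mat k k (\<lambda>(i, j). M (f i) (g j)) = mat k k (\<lambda>(i, j). M (f' i) (g' j))"
    using assms by (intro eq_matI) auto
  then show ?thesis unfolding minor_def by simp
qed

lemma minor_repeated_row:
  assumes "\<not> inj_on f {..<k}"
  shows "minor M k f g = 0"
proof -
  obtain i j where ij: "i < k" "j < k" "i \<noteq> j" "f i = f j"
    using assms by (auto simp: inj_on_def)
  let ?A = "mat k k (\<lambda>(i, j). M (f i) (g j))"
  have "row ?A i = row ?A j"
    using ij by (intro eq_vecI) auto
  then show ?thesis
    unfolding minor_def using det_identical_rows[of ?A k i j] ij by simp
qed

lemma reindex_permutes:
  assumes "inj_on f {..<k}" "bij_betw h {..<k} (f ` {..<k::nat})"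
  shows "\<exists>p. p permutes {0..<k} \<and> (\<forall>i<k. h (p i) = f i)"
proof -
  define p where "p i = (if i < k then inv_into {..<k} h (f i) else i)" for i
  have "bij_betw (inv_into {..<k} h \<circ> f) {..<k} {..<k}"
    using assms by (intro bij_betw_trans[of f "{..<k}" "f ` {..<k}"])
      (auto simp: bij_betw_inv_into inj_on_imp_bij_betw)
  then have "bij_betw p {..<k} {..<k}"
    by (rule bij_betw_cong[THEN iffD1, rotated]) (auto simp: p_def)
  then have "p permutes {0..<k}"
    unfolding atLeast0LessThan by (rule bij_imp_permutes) (auto simp: p_def)
  moreover have "h (p i) = f i" if "i < k" for i
    using assms(2) that by (auto simp: p_def bij_betw_def intro!: f_inv_into_f)
  ultimately show ?thesis by blast
qed

lemma bij_betw_pick: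
  assumes "finite I"
  shows "bij_betw (pick I) {..<card I} I"
proof -
  have "inj_on (pick I) {..<card I}"
    by (rule inj_on_inverseI[where g = "\<lambda>a. card {x \<in> I. x < a}"]) (simp add: card_pick_le)
  moreover have "pick I ` {..<card I} \<subseteq> I"
    using pick_in_set_le by auto
  ultimately show ?thesis
    using assms by (simp add: bij_betw_def card_image card_subset_eq)
qed

text \<open>A selection with repetitions has two equal rows or columns; any other one differs from the
increasing enumeration of its image by a permutation.\<close>

lemma totally_unimodular_imp_tu_on:
  assumes "totally_unimodular A"
  shows "tu_on {..<dim_row A} {..<dim_col A} (\<lambda>i j. A $$ (i, j))"
  unfolding tu_on_def
proof (intro allI impI)
  fix k :: nat and f g :: "nat \<Rightarrow> nat"
  let ?M = "\<lambda>i j. A $$ (i, j)"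
  assume fg: "f ` {..<k} \<subseteq> {..<dim_row A} \<and> g ` {..<k} \<subseteq> {..<dim_col A}"
  show "minor ?M k f g \<in> {0, 1, - 1}"
  proof (cases "inj_on f {..<k} \<and> inj_on g {..<k}")
    case False
    then have "minor ?M k f g = 0"
      using minor_repeated_row[of f k ?M g] minor_repeated_row[of g k "\<lambda>j i. ?M i j" f]
      by (auto simp: minor_transpose[of ?M])
    then show ?thesis by simp
  next
    case True
    define I J where "I = f ` {..<k}" and "J = g ` {..<k}"
    have cd: "card I = k" "card J = k" "finite I" "finite J"
      using True by (auto simp: I_def J_def card_image)
    have "bij_betw (pick I) {..<k} (f ` {..<k})"
      using bij_betw_pick[OF cd(3)] unfolding cd(1) by (simp only: I_def[symmetric])
    from reindex_permutes[OF conjunct1[OF True] this]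
    obtain p where p: "p permutes {0..<k}" "\<forall>i<k. pick I (p i) = f i"
      by blast
    have "bij_betw (pick J) {..<k} (g ` {..<k})"
      using bij_betw_pick[OF cd(4)] unfolding cd(2) by (simp only: J_def[symmetric])
    from reindex_permutes[OF conjunct2[OF True] this]
    obtain q where q: "q permutes {0..<k}" "\<forall>i<k. pick J (q i) = g i"
      by blast
    have IJ: "{i. i < dim_row A \<and> i \<in> I} = I" "{j. j < dim_col A \<and> j \<in> J} = J"
      using fg by (auto simp: I_def J_def)
    have "minor ?M k f g = minor ?M k (pick I \<circ> p) (pick J \<circ> q)"
      using p q by (intro minor_cong) auto
    also have "\<dots> = signof p * minor ?M k (pick I) (pick J \<circ> q)"
      using p by (simp add: minor_permute_rows)
    also have "minor ?M k (pick I) (pick J \<circ> q) = signof q * minor ?M k (pick I) (pick J)"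
      using minor_permute_rows[OF q(1), of "\<lambda>j i. ?M i j" "pick J" "pick I"]
      by (simp only: minor_transpose[of ?M])
    also have "minor ?M k (pick I) (pick J) = det (submatrix A I J)"
      unfolding minor_def submatrix_def IJ cd ..
    finally have *: "minor ?M k f g = signof p * (signof q * det (submatrix A I J))" .
    have "det (submatrix A I J) \<in> {0, 1, -1}"
      using assms[unfolded totally_unimodular_def, rule_format, of I J] fg cd
      by (auto simp: I_def J_def)
    moreover have "(signof p :: real) \<in> {1, -1}" "(signof q :: real) \<in> {1, -1}"
      by (auto simp: sign_def)
    ultimately show ?thesis unfolding * by auto
  qed
qed

lemma tu_onD:
  assumes "tu_on R C M" "f ` {..<k} \<subseteq> R" "g ` {..<k} \<subseteq> C"
  shows "minor M k f g \<in> {0, 1, -1}"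
  using assms unfolding tu_on_def by simp

lemma tu_on_transpose:
  assumes "tu_on R C M"
  shows "tu_on C R (\<lambda>j i. M i j)"
  unfolding tu_on_def minor_transpose[of M] using tu_onD[OF assms] by simp

lemma tu_on_subset:
  assumes "tu_on R C M" "R' \<subseteq> R" "C' \<subseteq> C"
  shows "tu_on R' C' M"
  unfolding tu_on_def using tu_onD[OF assms(1)] assms(2,3) by (meson subset_trans)

lemma tu_on_entry:
  assumes "tu_on R C M" "i \<in> R" "j \<in> C"
  shows "M i j \<in> {0, 1, -1}"
proof -
  have "minor M 1 (\<lambda>_. i) (\<lambda>_. j) = M i j"
    unfolding minor_def by (subst det_single) auto
  moreover have "minor M 1 (\<lambda>_. i) (\<lambda>_. j) \<in> {0, 1, -1}"
    using assms by (auto simp: tu_on_def image_subset_iff)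
  ultimately show ?thesis by simp
qed

section \<open>Inverses of bases\<close>

lemma minor_expand_column:
  assumes "j < Suc k"
  shows "minor M (Suc k) f g = (\<Sum>i<Suc k. M (f i) (g j) *
    ((-1) ^ (i + j) * minor M k (f \<circ> insert_index i) (g \<circ> insert_index j)))"
proof -
  let ?B = "mat (Suc k) (Suc k) (\<lambda>(i, j). M (f i) (g j))"
  have "cofactor ?B i j = (-1) ^ (i + j) * minor M k (f \<circ> insert_index i) (g \<circ> insert_index j)"
    if "i < Suc k" for i
  proof -
    have "mat_delete ?B i j =
        mat k k (\<lambda>(i', j'). M ((f \<circ> insert_index i) i') ((g \<circ> insert_index j) j'))"
      using that assms by (intro eq_matI) (auto simp: mat_delete_def insert_index_def)
    then show ?thesis unfolding cofactor_def minor_def by simp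
  qed
  then show ?thesis
    using laplace_expansion_column[of ?B "Suc k" j] assms unfolding minor_def by simp
qed

lemma minor_expand_last_row:
  "minor M (Suc k) f g = (\<Sum>j<Suc k. M (f k) (g j) *
    ((-1) ^ (k + j) * minor M k f (g \<circ> insert_index j)))"
proof -
  have "minor M (Suc k) f g = minor (\<lambda>j i. M i j) (Suc k) g f"
    by (simp add: minor_transpose[of M])
  also have "\<dots> = (\<Sum>j<Suc k. M (f k) (g j) *
      ((-1) ^ (j + k) * minor M k (f \<circ> insert_index k) (g \<circ> insert_index j)))"
    by (subst minor_expand_column[of k]) (simp_all add: minor_transpose[of M])
  also have "\<dots> = (\<Sum>j<Suc k. M (f k) (g j) *
      ((-1) ^ (k + j) * minor M k f (g \<circ> insert_index j)))"
    by (intro sum.cong refl arg_cong2[where f = "(*)"] minor_cong) (simp_all add: add.commute)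
  finally show ?thesis .
qed

definition indep_cols :: "'r set \<Rightarrow> 'c set \<Rightarrow> ('r \<Rightarrow> 'c \<Rightarrow> real) \<Rightarrow> bool" where
  "indep_cols R C M \<longleftrightarrow>
     (\<forall>u. (\<forall>r\<in>R. (\<Sum>c\<in>C. M r c * u c) = 0) \<longrightarrow> (\<forall>c\<in>C. u c = 0))"

text \<open>Induction on the number of columns. Expand the minor bordered by a further row \<open>r\<close> along that row:
the cofactors do not depend on \<open>r\<close>, and the last of them is the nonzero minor at hand. If all the
bordered minors vanished, the cofactors would be a nontrivial linear dependency of the columns.\<close>

lemma exists_nonzero_minor:
  assumes "\<And>u :: nat \<Rightarrow> real. (\<forall>r\<in>R. (\<Sum>j<k. M r (g j) * u j) = 0) \<Longrightarrow> (\<forall>j<k. u j = 0)"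
  shows "\<exists>f. f ` {..<k} \<subseteq> R \<and> minor M k f g \<noteq> 0"
  using assms
proof (induction k)
  case 0
  then show ?case by (simp add: minor_def)
next
  case (Suc k)
  have "\<forall>j<k. u j = 0" if u: "\<forall>r\<in>R. (\<Sum>j<k. M r (g j) * u j) = 0" for u :: "nat \<Rightarrow> real"
  proof -
    have "\<forall>j<Suc k. (u(k := 0)) j = 0"
      by (rule Suc.prems) (use u in simp)
    then show ?thesis by (auto simp: less_Suc_eq)
  qed
  from Suc.IH[OF this] obtain f where f: "f ` {..<k} \<subseteq> R" "minor M k f g \<noteq> 0"
    by blast
  define w where "w j = (-1) ^ (k + j) * minor M k f (g \<circ> insert_index j)" for j
  have "minor M k f (g \<circ> insert_index k) = minor M k f g"
    by (rule minor_cong) auto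
  then have "w k \<noteq> 0" using f(2) by (simp add: w_def)
  then obtain r where r: "r \<in> R" "(\<Sum>j<Suc k. M r (g j) * w j) \<noteq> 0"
    using Suc.prems[of w] by blast
  have "minor M k (f(k := r)) (g \<circ> insert_index j) = minor M k f (g \<circ> insert_index j)" for j
    by (rule minor_cong) auto
  then have "minor M (Suc k) (f(k := r)) g \<noteq> 0"
    using r(2) unfolding minor_expand_last_row[of M k "f(k := r)" g] by (simp add: w_def)
  moreover have "(f(k := r)) ` {..<Suc k} \<subseteq> R"
    using f(1) r(1) by (auto simp: less_Suc_eq)
  ultimately show ?case by blast
qed

text \<open>The matrix \<open>lam\<close> is the inverse of a nonsingular square submatrix on the independent columns \<open>C\<close>
and some rows \<open>I\<close>. Its entries are cofactors divided by the determinant. The entries of its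
product with a column \<open>d\<close> are, by Cramer's rule, determinants of the submatrix with one column
replaced by \<open>d\<close>. So all of them are quotients of minors.\<close>

lemma basis_inverse:
  assumes tu: "tu_on R D M" and CD: "C \<subseteq> D" and fin: "finite C" and ind: "indep_cols R C M"
  shows "\<exists>I lam. I \<subseteq> R \<and> finite I \<and> card I = card C \<and>
    (\<forall>c\<in>C. (\<forall>i\<in>I. lam c i \<in> {0, 1, - 1 :: real}) \<and>
            (\<forall>u. u c = (\<Sum>i\<in>I. lam c i * (\<Sum>d\<in>C. M i d * u d))) \<and>
            (\<forall>d\<in>D. \<bar>\<Sum>i\<in>I. lam c i * M i d\<bar> \<le> 1))"
proof (cases "card C")
  case 0
  then show ?thesis using fin by (intro exI[of _ "{}"]) auto
next
  case (Suc l)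
  define k where "k = Suc l"
  have kC: "k = card C" using Suc by (simp add: k_def)
  obtain g where g: "bij_betw g {..<k} C"
    using ex_bij_betw_nat_finite[OF fin] by (auto simp: kC atLeast0LessThan)
  then have gi: "inj_on g {..<k}" and gC: "g ` {..<k} = C" by (auto simp: bij_betw_def)
  have sumg: "sum h C = (\<Sum>j<k. h (g j))" for h :: "_ \<Rightarrow> real"
    using sum.reindex_bij_betw[OF g, of h] by simp
  have "\<forall>j<k. u j = 0" if u: "\<forall>r\<in>R. (\<Sum>j<k. M r (g j) * u j) = 0" for u :: "nat \<Rightarrow> real"
  proof -
    define v where "v c = u (inv_into {..<k} g c)" for c
    have v: "v (g j) = u j" if "j < k" for j
      using gi that by (simp add: v_def)
    have "\<forall>r\<in>R. (\<Sum>c\<in>C. M r c * v c) = 0"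
      using u by (simp add: sumg v)
    then have "\<forall>c\<in>C. v c = 0" using ind unfolding indep_cols_def by blast
    then show ?thesis using v gC by force
  qed
  from exists_nonzero_minor[where R = R and k = k and M = M and g = g, OF this]
  obtain f where f: "f ` {..<k} \<subseteq> R" "minor M k f g \<noteq> 0" by blast
  then have fi: "inj_on f {..<k}" using minor_repeated_row by blast
  define \<delta> where "\<delta> = minor M k f g"
  have \<delta>: "\<delta> * \<delta> = 1" "\<bar>\<delta>\<bar> = 1"
    using tu_onD[OF tu f(1), of g] f(2) gC CD by (auto simp: \<delta>_def)
  define cof where
    "cof i j = (-1) ^ (i + j) * minor M l (f \<circ> insert_index i) (g \<circ> insert_index j)" for i j
  have replace: "(\<Sum>i<k. M (f i) d * cof i j) = minor M k f (g(j := d))" if j: "j < k" for d j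
  proof -
    have "(g(j := d)) \<circ> insert_index j = g \<circ> insert_index j"
      by (auto simp: insert_index_def)
    then show ?thesis
      using minor_expand_column[of j l M f "g(j := d)"] j by (simp add: k_def cof_def)
  qed
  have bound: "\<bar>minor M k f (g(j := d))\<bar> \<le> 1" if "j < k" "d \<in> D" for d j
    using tu_onD[OF tu f(1), of "g(j := d)"] that gC CD by fastforce
  have cof01: "\<delta> * cof i j \<in> {0, 1, -1}" if "i < k" "j < k" for i j
  proof -
    have "insert_index a b < k" if "b < l" for a b
      using that by (auto simp: insert_index_def k_def)
    then have "(f \<circ> insert_index i) ` {..<l} \<subseteq> R" "(g \<circ> insert_index j) ` {..<l} \<subseteq> D"
      using f(1) gC CD by fastforce+
    from tu_onD[OF tu this] show ?thesis
      using \<delta>(2) by (cases "even (i + j)") (auto simp: cof_def abs_if split: if_splits)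
  qed
  have delta: "(\<Sum>i<k. \<delta> * cof i j * M (f i) (g j')) = (if j' = j then 1 else 0)"
    if "j < k" "j' < k" for j j'
  proof (cases "j' = j")
    case True
    then show ?thesis
      using replace[OF that(1), of "g j'"] \<delta>(1)
      by (simp add: mult.assoc mult.commute[of "cof _ _"] flip: sum_distrib_left \<delta>_def)
  next
    case False
    have "\<not> inj_on (g(j := g j')) {..<k}"
    proof
      assume "inj_on (g(j := g j')) {..<k}"
      from inj_onD[OF this, of j j'] show False using False that by simp
    qed
    then have "minor M k f (g(j := g j')) = 0"
      using minor_repeated_row[of "g(j := g j')" k "\<lambda>j i. M i j" f] by (simp add: minor_transpose[of M])
    then show ?thesis
      using replace[OF that(1), of "g j'"] False
      by (simp add: mult.assoc mult.commute[of "cof _ _"] flip: sum_distrib_left)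
  qed
  define lam where "lam c i = \<delta> * cof (inv_into {..<k} f i) (inv_into {..<k} g c)" for c i
  have lam: "lam (g j) (f i) = \<delta> * cof i j" if "i < k" "j < k" for i j
    using that fi gi by (simp add: lam_def)
  define I where "I = f ` {..<k}"
  have sumI: "sum h I = (\<Sum>i<k. h (f i))" for h :: "_ \<Rightarrow> real"
    unfolding I_def by (simp add: sum.reindex[OF fi])
  have "(\<forall>i\<in>I. lam c i \<in> {0, 1, - 1}) \<and>
        (\<forall>u. u c = (\<Sum>i\<in>I. lam c i * (\<Sum>d\<in>C. M i d * u d))) \<and>
        (\<forall>d\<in>D. \<bar>\<Sum>i\<in>I. lam c i * M i d\<bar> \<le> 1)" if "c \<in> C" for c
  proof (intro conjI ballI allI)
    obtain j where j: "j < k" "c = g j" using \<open>c \<in> C\<close> gC by auto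
    show "lam c i \<in> {0, 1, - 1}" if "i \<in> I" for i
    proof -
      from that obtain x where "x < k" "i = f x" by (auto simp: I_def)
      then show ?thesis using cof01[of x j] lam[of x j] j by simp
    qed
    show "u c = (\<Sum>i\<in>I. lam c i * (\<Sum>d\<in>C. M i d * u d))" for u
    proof -
      have "(\<Sum>i\<in>I. lam c i * (\<Sum>d\<in>C. M i d * u d))
          = (\<Sum>i<k. \<Sum>j'<k. \<delta> * cof i j * M (f i) (g j') * u (g j'))"
        using j by (simp add: sumI sumg lam sum_distrib_left mult.assoc)
      also have "\<dots> = (\<Sum>j'<k. (\<Sum>i<k. \<delta> * cof i j * M (f i) (g j')) * u (g j'))"
        by (subst sum.swap) (simp add: sum_distrib_right)
      also have "\<dots> = (\<Sum>j'<k. (if j' = j then u (g j') else 0))"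
        using j by (intro sum.cong refl) (simp add: delta)
      also have "\<dots> = u c" using j by simp
      finally show ?thesis ..
    qed
    show "\<bar>\<Sum>i\<in>I. lam c i * M i d\<bar> \<le> 1" if "d \<in> D" for d
    proof -
      have "(\<Sum>i\<in>I. lam c i * M i d) = \<delta> * minor M k f (g(j := d))"
        using j by (simp add: sumI lam replace[symmetric] sum_distrib_left mult_ac)
      then show ?thesis using \<delta>(2) bound[OF j(1) that] by (simp add: abs_mult)
    qed
  qed
  moreover have "I \<subseteq> R" "finite I" "card I = card C"
    using f(1) fi by (auto simp: I_def kC card_image)
  ultimately show ?thesis by blast
qed

section \<open>Basic solutions and the Farkas lemma\<close>

text \<open>The sign is normalised so that moving against the kernel vector decreases some coordinate.\<close>

lemma kernel_vector_on_support:
  fixes d :: "'c \<Rightarrow> real"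
  assumes "finite C" and dep: "\<not> indep_cols R {c \<in> C. d c \<noteq> 0} M"
  shows "\<exists>k. (\<forall>c. d c = 0 \<longrightarrow> k c = 0) \<and> (\<forall>r\<in>R. (\<Sum>c\<in>C. M r c * k c) = 0) \<and> (\<exists>c\<in>C. 0 < k c)"
proof -
  let ?S = "{c \<in> C. d c \<noteq> 0}"
  obtain u c0 where u: "\<forall>r\<in>R. (\<Sum>c\<in>?S. M r c * u c) = 0" and c0: "c0 \<in> ?S" "u c0 \<noteq> 0"
    using dep unfolding indep_cols_def by blast
  define s :: real where "s = (if 0 < u c0 then 1 else - 1)"
  define k where "k c = (if c \<in> ?S then s * u c else 0)" for c
  have "(\<Sum>c\<in>C. M r c * k c) = s * (\<Sum>c\<in>?S. M r c * u c)" for r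
    using assms(1)
    by (auto simp: k_def sum_distrib_left sum.inter_filter intro!: sum.mono_neutral_cong_right)
  then have "(\<Sum>c\<in>C. M r c * k c) = 0" if "r \<in> R" for r using u that by simp
  moreover have "0 < k c0" using c0 by (auto simp: k_def s_def)
  moreover have "k c = 0" if "d c = 0" for c using that by (simp add: k_def)
  ultimately show ?thesis using c0 by blast
qed

text \<open>Move against \<open>k\<close> until the first coordinate vanishes.\<close>

lemma shrink_support:
  fixes d k :: "'c \<Rightarrow> real"
  assumes fin: "finite C" and d: "\<And>c. c \<in> C \<Longrightarrow> 0 \<le> d c"
    and k0: "\<And>c. d c = 0 \<Longrightarrow> k c = 0" and pos: "\<exists>c\<in>C. 0 < k c"
  shows "\<exists>t>0. (\<forall>c\<in>C. 0 \<le> d c - t * k c) \<and>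
    card {c \<in> C. d c - t * k c \<noteq> 0} < card {c \<in> C. d c \<noteq> 0}"
proof -
  let ?P = "{c \<in> C. 0 < k c}"
  define t where "t = Min ((\<lambda>c. d c / k c) ` ?P)"
  have ne: "?P \<noteq> {}" and fP: "finite ?P" using pos fin by auto
  have "t \<in> (\<lambda>c. d c / k c) ` ?P"
    unfolding t_def using ne fP by (intro Min_in) auto
  then obtain c0 where c0: "c0 \<in> C" "0 < k c0" "t = d c0 / k c0" by auto
  then have dc0: "d c0 \<noteq> 0" "0 < t" using k0[of c0] d[of c0]
    by (auto simp: less_le)
  have le: "t \<le> d c / k c" if "c \<in> ?P" for c
    unfolding t_def using that fP by (intro Min_le) auto
  have nonneg: "0 \<le> d c - t * k c" if "c \<in> C" for c
  proof (cases "0 < k c")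
    case True
    then show ?thesis using le[of c] that by (simp add: field_simps)
  next
    case False
    then have "t * k c \<le> 0" using dc0 by (simp add: mult_nonneg_nonpos)
    then show ?thesis using d[OF that] by linarith
  qed
  have "{c \<in> C. d c - t * k c \<noteq> 0} \<subseteq> {c \<in> C. d c \<noteq> 0} - {c0}"
    using k0 c0 by (auto simp: field_simps)
  also have "\<dots> \<subset> {c \<in> C. d c \<noteq> 0}" using c0 dc0 by auto
  finally have "card {c \<in> C. d c - t * k c \<noteq> 0} < card {c \<in> C. d c \<noteq> 0}"
    using fin by (intro psubset_card_mono) auto
  then show ?thesis using dc0(2) nonneg by blast
qed

lemma kernel_shift:
  assumes "(\<Sum>c\<in>C. M r c * k c) = 0"
  shows "(\<Sum>c\<in>C. M r c * (d c - t * k c)) = (\<Sum>c\<in>C. M r c * d c :: real)"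
  using assms by (simp add: algebra_simps sum_subtractf flip: sum_distrib_left)

lemma basic_solution_exists:
  fixes d :: "'c \<Rightarrow> real"
  assumes "finite C" "\<And>c. c \<in> C \<Longrightarrow> 0 \<le> d c"
  shows "\<exists>v. (\<forall>c\<in>C. 0 \<le> v c) \<and> (\<forall>r\<in>R. (\<Sum>c\<in>C. M r c * v c) = (\<Sum>c\<in>C. M r c * d c)) \<and>
    (\<forall>c. d c = 0 \<longrightarrow> v c = 0) \<and> indep_cols R {c \<in> C. v c \<noteq> 0} M"
  using assms
proof (induction "card {c \<in> C. d c \<noteq> 0}" arbitrary: d rule: less_induct)
  case less
  show ?case
  proof (cases "indep_cols R {c \<in> C. d c \<noteq> 0} M")
    case True
    then show ?thesis using less.prems by (intro exI[of _ d]) auto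
  next
    case False
    then obtain k where k: "\<And>c. d c = 0 \<Longrightarrow> k c = 0"
        "\<And>r. r \<in> R \<Longrightarrow> (\<Sum>c\<in>C. M r c * k c) = 0" "\<exists>c\<in>C. 0 < k c"
      using kernel_vector_on_support[OF less.prems(1)] by blast
    obtain t where t: "0 < t" "\<And>c. c \<in> C \<Longrightarrow> 0 \<le> d c - t * k c"
        "card {c \<in> C. d c - t * k c \<noteq> 0} < card {c \<in> C. d c \<noteq> 0}"
      using shrink_support[where d = d and k = k, OF less.prems k(1,3)] by blast
    have "\<forall>r\<in>R. (\<Sum>c\<in>C. M r c * (d c - t * k c)) = (\<Sum>c\<in>C. M r c * d c)"
      using k(2) by (auto intro: kernel_shift)
    moreover have "\<forall>c. d c = 0 \<longrightarrow> d c - t * k c = 0" using k(1) by simp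
    moreover obtain v where "\<forall>c\<in>C. 0 \<le> v c"
        "\<forall>r\<in>R. (\<Sum>c\<in>C. M r c * v c) = (\<Sum>c\<in>C. M r c * (d c - t * k c))"
        "\<forall>c. d c - t * k c = 0 \<longrightarrow> v c = 0" "indep_cols R {c \<in> C. v c \<noteq> 0} M"
      using less.hyps[OF t(3) less.prems(1) t(2)] by blast
    ultimately show ?thesis by (intro exI[of _ v]) simp
  qed
qed

text \<open>As long as the support of \<open>d\<close> carries a kernel vector, \<open>d\<close> can be moved in both directions until
the support shrinks, so that \<open>d\<close> is a convex combination of two solutions with smaller support; if
one of the directions is unbounded, the motion in the other one only decreases coordinates. Hence
\<open>d\<close> dominates a convex combination of basic solutions. A bound that is linear, such as the sum
over \<open>B\<close>, passes from basic solutions to convex combinations. The domination is what keeps a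
corrected point feasible when \<open>d\<close> is the absolute value of a difference of two points.\<close>

lemma dominated_solution:
  fixes d :: "'c \<Rightarrow> real"
  assumes "finite C" "B \<subseteq> C" "\<And>c. c \<in> C \<Longrightarrow> 0 \<le> d c"
    and basic: "\<And>v. \<lbrakk>\<And>c. c \<in> C \<Longrightarrow> 0 \<le> v c; \<And>c. d c = 0 \<Longrightarrow> v c = 0;
        \<And>r. r \<in> R \<Longrightarrow> (\<Sum>c\<in>C. M r c * v c) = (\<Sum>c\<in>C. M r c * d c);
        indep_cols R {c \<in> C. v c \<noteq> 0} M\<rbrakk> \<Longrightarrow> (\<Sum>c\<in>B. v c) \<le> \<kappa>"
  shows "\<exists>v. (\<forall>c\<in>C. 0 \<le> v c \<and> v c \<le> d c) \<and>
    (\<forall>r\<in>R. (\<Sum>c\<in>C. M r c * v c) = (\<Sum>c\<in>C. M r c * d c)) \<and> (\<Sum>c\<in>B. v c) \<le> \<kappa>"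
  using assms(1,3) basic
proof (induction "card {c \<in> C. d c \<noteq> 0}" arbitrary: d rule: less_induct)
  case less
  note d0 = less.prems(2)
  show ?case
  proof (cases "indep_cols R {c \<in> C. d c \<noteq> 0} M")
    case True
    then show ?thesis using less.prems by (intro exI[of _ d]) auto
  next
    case False
    then obtain k where k: "\<And>c. d c = 0 \<Longrightarrow> k c = 0"
        "\<And>r. r \<in> R \<Longrightarrow> (\<Sum>c\<in>C. M r c * k c) = 0" "\<exists>c\<in>C. 0 < k c"
      using kernel_vector_on_support[OF less.prems(1)] by blast
    have move: "\<exists>t>0. \<exists>v. (\<forall>c\<in>C. 0 \<le> v c \<and> v c \<le> d c - t * h c) \<and>
        (\<forall>r\<in>R. (\<Sum>c\<in>C. M r c * v c) = (\<Sum>c\<in>C. M r c * d c)) \<and> (\<Sum>c\<in>B. v c) \<le> \<kappa>"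
      if h: "\<And>c. d c = 0 \<Longrightarrow> h c = 0" "\<And>r. r \<in> R \<Longrightarrow> (\<Sum>c\<in>C. M r c * h c) = 0"
        "\<exists>c\<in>C. 0 < h c" for h
    proof -
      obtain t where t: "0 < t" "\<And>c. c \<in> C \<Longrightarrow> 0 \<le> d c - t * h c"
          "card {c \<in> C. d c - t * h c \<noteq> 0} < card {c \<in> C. d c \<noteq> 0}"
        using shrink_support[where d = d and k = h, OF less.prems(1) d0 h(1,3)] by blast
      have eq: "(\<Sum>c\<in>C. M r c * (d c - t * h c)) = (\<Sum>c\<in>C. M r c * d c)" if "r \<in> R" for r
        using h(2)[OF that] by (rule kernel_shift)
      have "\<exists>v. (\<forall>c\<in>C. 0 \<le> v c \<and> v c \<le> d c - t * h c) \<and>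
        (\<forall>r\<in>R. (\<Sum>c\<in>C. M r c * v c) = (\<Sum>c\<in>C. M r c * (d c - t * h c))) \<and> (\<Sum>c\<in>B. v c) \<le> \<kappa>"
        by (rule less.hyps[OF t(3) less.prems(1) t(2)])
          (simp, rule less.prems(3), simp_all add: h(1) eq)
      then show ?thesis using t(1) eq by auto
    qed
    obtain t v where t: "0 < t" and v: "\<forall>c\<in>C. 0 \<le> v c \<and> v c \<le> d c - t * k c"
        "\<forall>r\<in>R. (\<Sum>c\<in>C. M r c * v c) = (\<Sum>c\<in>C. M r c * d c)" "(\<Sum>c\<in>B. v c) \<le> \<kappa>"
      using move[OF k] by blast
    show ?thesis
    proof (cases "\<exists>c\<in>C. k c < 0")
      case False
      then have "v c \<le> d c" if "c \<in> C" for c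
      proof -
        have "0 \<le> t * k c" using False that t by (simp add: not_less)
        then show ?thesis using v(1) that by fastforce
      qed
      then show ?thesis using v by blast
    next
      case True
      then obtain t' v' where t': "0 < t'" and v': "\<forall>c\<in>C. 0 \<le> v' c \<and> v' c \<le> d c + t' * k c"
          "\<forall>r\<in>R. (\<Sum>c\<in>C. M r c * v' c) = (\<Sum>c\<in>C. M r c * d c)" "(\<Sum>c\<in>B. v' c) \<le> \<kappa>"
        using move[of "\<lambda>c. - k c"] k by (auto simp: sum_negf)
      define p q where "p = t' / (t + t')" and "q = t / (t + t')"
      have pq: "0 \<le> p" "0 \<le> q" "p + q = 1" "p * t = q * t'"
        using t t' by (simp_all add: p_def q_def mult.commute flip: add_divide_distrib)
      define w where "w c = p * v c + q * v' c" for c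
      have "0 \<le> w c \<and> w c \<le> d c" if "c \<in> C" for c
      proof
        show "0 \<le> w c" unfolding w_def using v(1) v'(1) pq that by auto
        have "w c \<le> p * (d c - t * k c) + q * (d c + t' * k c)"
          unfolding w_def using v(1) v'(1) pq that by (intro add_mono mult_left_mono) auto
        also have "\<dots> = (p + q) * d c + (q * t' - p * t) * k c" by (simp add: algebra_simps)
        finally show "w c \<le> d c" using pq by simp
      qed
      moreover have "(\<Sum>c\<in>C. M r c * w c) = (\<Sum>c\<in>C. M r c * d c)" if "r \<in> R" for r
      proof -
        have "(\<Sum>c\<in>C. M r c * w c) = p * (\<Sum>c\<in>C. M r c * v c) + q * (\<Sum>c\<in>C. M r c * v' c)"
          by (simp add: w_def algebra_simps sum.distrib sum_distrib_left)
        also have "\<dots> = (p + q) * (\<Sum>c\<in>C. M r c * d c)"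
          using v(2) v'(2) that by (simp add: algebra_simps)
        finally show ?thesis using pq by simp
      qed
      moreover have "(\<Sum>c\<in>B. w c) \<le> \<kappa>"
      proof -
        have "(\<Sum>c\<in>B. w c) = p * (\<Sum>c\<in>B. v c) + q * (\<Sum>c\<in>B. v' c)"
          by (simp add: w_def sum.distrib sum_distrib_left)
        also have "\<dots> \<le> p * \<kappa> + q * \<kappa>"
          using v(3) v'(3) pq by (intro add_mono mult_left_mono) auto
        finally show ?thesis using pq by (simp flip: distrib_right)
      qed
      ultimately show ?thesis by blast
    qed
  qed
qed

text \<open>Bartl's induction on the number of constraints. If the last constraint is needed, some \<open>w\<close>
satisfies the others but has \<open>g\<close> and the last functional positive. Projecting along \<open>w\<close> onto the
kernel of the last functional reduces the claim to the remaining constraints, and the multiplier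
of the last one is recovered from the value at \<open>w\<close>.\<close>

lemma farkas:
  fixes a :: "'i \<Rightarrow> 'c \<Rightarrow> real" and g :: "'c \<Rightarrow> real"
  assumes "finite I" and fC: "finite C"
    and "\<And>v. (\<forall>i\<in>I. (\<Sum>c\<in>C. a i c * v c) \<le> 0) \<Longrightarrow> (\<Sum>c\<in>C. g c * v c) \<le> 0"
  shows "\<exists>u. (\<forall>i\<in>I. 0 \<le> u i) \<and> (\<forall>c\<in>C. g c = (\<Sum>i\<in>I. u i * a i c))"
  using assms(1,3)
proof (induction I arbitrary: a g rule: finite_induct)
  case empty
  have "(\<Sum>c\<in>C. g c * g c) \<le> 0" using empty[of g] by simp
  moreover have "0 \<le> (\<Sum>c\<in>C. g c * g c)" by (simp add: sum_nonneg)
  ultimately have "(\<Sum>c\<in>C. g c * g c) = 0" by linarith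
  then show ?case using fC by (simp add: sum_nonneg_eq_0_iff)
next
  case (insert m I)
  note mI = insert.hyps
  show ?case
  proof (cases "\<forall>v. (\<forall>i\<in>I. (\<Sum>c\<in>C. a i c * v c) \<le> 0) \<longrightarrow> (\<Sum>c\<in>C. g c * v c) \<le> 0")
    case True
    then obtain u where u: "\<forall>i\<in>I. 0 \<le> u i" "\<forall>c\<in>C. g c = (\<Sum>i\<in>I. u i * a i c)"
      using insert.IH[of a g] by blast
    have "(\<Sum>i\<in>I. (u(m := 0)) i * a i c) = (\<Sum>i\<in>I. u i * a i c)" for c
      using mI by (intro sum.cong) auto
    then have "(\<forall>i\<in>insert m I. 0 \<le> (u(m := 0)) i) \<and> (\<forall>c\<in>C. g c = (\<Sum>i\<in>insert m I. (u(m := 0)) i * a i c))"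
      using u mI by auto
    then show ?thesis by blast
  next
    case False
    then obtain w where w: "\<forall>i\<in>I. (\<Sum>c\<in>C. a i c * w c) \<le> 0" "0 < (\<Sum>c\<in>C. g c * w c)"
      by (auto simp: not_le)
    define \<alpha> where "\<alpha> = (\<Sum>c\<in>C. a m c * w c)"
    have \<alpha>: "0 < \<alpha>"
      using insert.prems[of w] w by (fastforce simp: \<alpha>_def not_le)
    \<comment> \<open>the multiple of the last functional that has the same value at \<open>w\<close> as \<open>h\<close>\<close>
    define p where "p h = (\<Sum>c\<in>C. h c * w c) / \<alpha>" for h :: "'c \<Rightarrow> real"
    have proj: "(\<Sum>c\<in>C. (h c - p h * a m c) * v c)
        = (\<Sum>c\<in>C. h c * (v c - (\<Sum>c\<in>C. a m c * v c) / \<alpha> * w c))" for h v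
    proof -
      have "(\<Sum>c\<in>C. (h c - p h * a m c) * v c) = (\<Sum>c\<in>C. h c * v c) - p h * (\<Sum>c\<in>C. a m c * v c)"
        by (simp add: left_diff_distrib sum_subtractf sum_distrib_left mult.assoc)
      also have "\<dots> = (\<Sum>c\<in>C. h c * v c) - (\<Sum>c\<in>C. a m c * v c) / \<alpha> * (\<Sum>c\<in>C. h c * w c)"
        by (simp add: p_def)
      also have "\<dots> = (\<Sum>c\<in>C. h c * (v c - (\<Sum>c\<in>C. a m c * v c) / \<alpha> * w c))"
        unfolding right_diff_distrib sum_subtractf sum_distrib_left[of _ _ C]
        by (simp add: mult.left_commute)
      finally show ?thesis .
    qed
    have "(\<Sum>c\<in>C. (g c - p g * a m c) * v c) \<le> 0"
      if "\<forall>i\<in>I. (\<Sum>c\<in>C. (a i c - p (a i) * a m c) * v c) \<le> 0" for v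
    proof -
      let ?v = "\<lambda>c. v c - (\<Sum>c\<in>C. a m c * v c) / \<alpha> * w c"
      have "(\<Sum>c\<in>C. a m c * ?v c) = 0"
        using \<alpha> proj[of "a m" v, symmetric] by (simp add: p_def flip: \<alpha>_def)
      then have "\<forall>i\<in>insert m I. (\<Sum>c\<in>C. a i c * ?v c) \<le> 0"
        using that by (auto simp: proj)
      then show ?thesis unfolding proj by (rule insert.prems)
    qed
    from insert.IH[of "\<lambda>i c. a i c - p (a i) * a m c" "\<lambda>c. g c - p g * a m c", OF this]
    obtain u where u: "\<forall>i\<in>I. 0 \<le> u i"
        "\<forall>c\<in>C. g c - p g * a m c = (\<Sum>i\<in>I. u i * (a i c - p (a i) * a m c))"
      by blast
    define u' where "u' = u(m := p g - (\<Sum>i\<in>I. u i * p (a i)))"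
    have "(\<Sum>i\<in>I. u i * p (a i)) \<le> 0"
      using u w(1) \<alpha> by (intro sum_nonpos) (auto simp: p_def intro!: mult_nonneg_nonpos divide_nonpos_pos)
    moreover have "0 \<le> p g" using w(2) \<alpha> by (simp add: p_def)
    ultimately have "\<forall>i\<in>insert m I. 0 \<le> u' i" using u(1) by (auto simp: u'_def)
    moreover have "g c = (\<Sum>i\<in>insert m I. u' i * a i c)" if "c \<in> C" for c
    proof -
      have "(\<Sum>i\<in>I. u' i * a i c) = (\<Sum>i\<in>I. u i * a i c)"
        using mI by (intro sum.cong) (auto simp: u'_def)
      then show ?thesis using u(2)[rule_format, OF that]
        by (simp add: mI u'_def algebra_simps sum_subtractf sum_distrib_left)
    qed
    ultimately show ?thesis by blast
  qed
qed

section \<open>Integral optimal solutions\<close>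

lemma indep_cols_scale:
  assumes "indep_cols R C (\<lambda>r c. \<sigma> c * M r c)" and "\<And>c. c \<in> C \<Longrightarrow> \<sigma> c \<noteq> 0"
  shows "indep_cols R C M"
  unfolding indep_cols_def
proof (intro allI impI)
  fix u assume u: "\<forall>r\<in>R. (\<Sum>c\<in>C. M r c * u c) = 0"
  have "(\<Sum>c\<in>C. \<sigma> c * M r c * (u c / \<sigma> c)) = (\<Sum>c\<in>C. M r c * u c)" for r
    using assms(2) by (intro sum.cong) auto
  then have "\<forall>r\<in>R. (\<Sum>c\<in>C. \<sigma> c * M r c * (u c / \<sigma> c)) = 0"
    using u by simp
  then have "\<forall>c\<in>C. u c / \<sigma> c = 0"
    using assms(1)[unfolded indep_cols_def, THEN spec, of "\<lambda>c. u c / \<sigma> c"] by simp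
  then show "\<forall>c\<in>C. u c = 0" using assms(2) by auto
qed

lemma Ints_sum_sign_combination:
  assumes "\<And>i. i \<in> I \<Longrightarrow> l i \<in> {0, 1, - 1 :: real}" "\<And>i. i \<in> I \<Longrightarrow> e i \<in> \<int>"
  shows "(\<Sum>i\<in>I. l i * e i) \<in> \<int>"
proof (intro Ints_sum Ints_mult)
  show "l i \<in> \<int>" if "i \<in> I" for i using assms(1)[OF that] by auto
qed (use assms(2) in auto)

lemma abs_sum_sign_combination:
  assumes "\<And>i. i \<in> I \<Longrightarrow> l i \<in> {0, 1, - 1 :: real}"
  shows "\<bar>\<Sum>i\<in>I. l i * e i\<bar> \<le> (\<Sum>i\<in>I. \<bar>e i\<bar>)"
proof -
  have "\<bar>l i\<bar> \<le> 1" if "i \<in> I" for i using assms[OF that] by auto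
  then have "\<bar>l i * e i\<bar> \<le> \<bar>e i\<bar>" if "i \<in> I" for i
    using that mult_right_mono[of "\<bar>l i\<bar>" 1 "\<bar>e i\<bar>"] by (simp add: abs_mult)
  then show ?thesis by (intro order_trans[OF sum_abs] sum_mono)
qed

text \<open>Vectors and matrices are functions here, of which only the values at indices below \<open>m1\<close> and \<open>m2\<close>
count; the combinatorial arguments add and restrict them freely, which the dimensions of genuine
vectors would only obstruct.\<close>

locale tu_system =
  fixes m1 m2 :: nat and A :: "nat \<Rightarrow> nat \<Rightarrow> real" and b c :: "nat \<Rightarrow> real"
  assumes tu: "tu_on {..<m1} {..<m2} A"
begin

definition primal_sol :: "(nat \<Rightarrow> real) \<Rightarrow> bool" where
  "primal_sol x \<longleftrightarrow> (\<forall>j<m2. 0 \<le> x j) \<and> (\<forall>i<m1. (\<Sum>j<m2. A i j * x j) = b i)"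

definition slack :: "(nat \<Rightarrow> real) \<Rightarrow> nat \<Rightarrow> real" where
  "slack y j = c j - (\<Sum>i<m1. A i j * y i)"

definition dual_sol :: "(nat \<Rightarrow> real) \<Rightarrow> bool" where
  "dual_sol y \<longleftrightarrow> (\<forall>j<m2. 0 \<le> slack y j)"

definition complementary :: "(nat \<Rightarrow> real) \<Rightarrow> (nat \<Rightarrow> real) \<Rightarrow> bool" where
  "complementary x y \<longleftrightarrow> (\<forall>j<m2. x j = 0 \<or> slack y j = 0)"

lemma lagrange_identity:
  "(\<Sum>j<m2. c j * x j) - (\<Sum>i<m1. b i * y i)
    = (\<Sum>j<m2. slack y j * x j) - (\<Sum>i<m1. y i * (b i - (\<Sum>j<m2. A i j * x j)))"
proof -
  have "(\<Sum>j<m2. (\<Sum>i<m1. A i j * y i) * x j) = (\<Sum>i<m1. y i * (\<Sum>j<m2. A i j * x j))"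
    unfolding sum_distrib_left sum_distrib_right by (subst sum.swap) (simp add: mult_ac)
  then show ?thesis
    by (simp add: slack_def left_diff_distrib right_diff_distrib sum_subtractf mult.commute)
qed

text \<open>At an optimal \<open>x\<close> no direction that keeps the equations and does not decrease the zero coordinates
of \<open>x\<close> improves the objective, as a short step in it stays feasible. The Farkas multipliers for
this cone are the dual solution, and its slack is supported on the zeros of \<open>x\<close>.\<close>

lemma dual_certificate:
  assumes x: "primal_sol x"
    and opt: "\<And>x'. primal_sol x' \<Longrightarrow> (\<Sum>j<m2. c j * x j) \<le> (\<Sum>j<m2. c j * x' j)"
  shows "\<exists>y. dual_sol y \<and> complementary x y"
proof -
  define a :: "(nat + nat) + nat \<Rightarrow> nat \<Rightarrow> real" where
    "a = case_sum (case_sum A (\<lambda>i j. - A i j)) (\<lambda>k j. if j = k \<and> x k = 0 then - 1 else 0)"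
  let ?I = "({..<m1} <+> {..<m1}) <+> {..<m2}"
  have cone: "(\<Sum>j<m2. - c j * v j) \<le> 0" if v: "\<forall>i\<in>?I. (\<Sum>j<m2. a i j * v j) \<le> 0" for v
  proof -
    have "(\<Sum>j<m2. A i j * v j) \<le> 0" "(\<Sum>j<m2. - A i j * v j) \<le> 0" if "i < m1" for i
      using v[rule_format, of "Inl (Inl i)"] v[rule_format, of "Inl (Inr i)"] that
      by (auto simp: a_def)
    then have Av: "(\<Sum>j<m2. A i j * v j) = 0" if "i < m1" for i
      using that by (auto simp: sum_negf intro: antisym)
    have v0: "0 \<le> v j" if "j < m2" "x j = 0" for j
    proof -
      have "(\<Sum>k<m2. a (Inr j) k * v k) = (\<Sum>k<m2. if k = j then - v j else 0)"
        using that by (intro sum.cong) (auto simp: a_def)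
      then show ?thesis using v[rule_format, of "Inr j"] that by auto
    qed
    have "\<exists>t>0. x j + t * v j \<ge> 0 \<and> (\<forall>t'. 0 < t' \<and> t' \<le> t \<longrightarrow> x j + t' * v j \<ge> 0)" if "j < m2" for j
    proof (cases "0 \<le> v j")
      case True
      then show ?thesis using x that by (intro exI[of _ 1]) (auto simp: primal_sol_def)
    next
      case False
      then have "0 < x j" using v0[OF that] x that by (auto simp: primal_sol_def less_le)
      then show ?thesis using False
        by (intro exI[of _ "x j / - v j"]) (auto simp: field_simps)
    qed
    then obtain t where t: "\<And>j. j < m2 \<Longrightarrow> 0 < t j"
        "\<And>j t'. j < m2 \<Longrightarrow> 0 < t' \<Longrightarrow> t' \<le> t j \<Longrightarrow> 0 \<le> x j + t' * v j" by metis
    define T where "T = Min (insert 1 (t ` {..<m2}))"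
    have T: "0 < T" "\<And>j. j < m2 \<Longrightarrow> T \<le> t j"
      using t(1) by (auto simp: T_def)
    have "primal_sol (\<lambda>j. x j + T * v j)"
      using x t(2) T Av by (auto simp: primal_sol_def distrib_left sum.distrib mult.left_commute[of _ T]
        simp flip: sum_distrib_left)
    from opt[OF this] have "0 \<le> T * (\<Sum>j<m2. c j * v j)"
      by (simp add: distrib_left sum.distrib mult.left_commute[of _ T] flip: sum_distrib_left)
    then have "0 \<le> (\<Sum>j<m2. c j * v j)" using T(1) by (simp add: zero_le_mult_iff)
    then show ?thesis by (simp add: sum_negf)
  qed
  have "\<exists>u. (\<forall>i\<in>?I. 0 \<le> u i) \<and> (\<forall>j\<in>{..<m2}. - c j = (\<Sum>i\<in>?I. u i * a i j))"
    by (rule farkas) (use cone in auto)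
  then obtain u where u: "\<forall>i\<in>?I. 0 \<le> u i" "\<forall>j<m2. - c j = (\<Sum>i\<in>?I. u i * a i j)" by auto
  define y where "y i = u (Inl (Inr i)) - u (Inl (Inl i))" for i
  have s: "slack y j = (if x j = 0 then u (Inr j) else 0)" if j: "j < m2" for j
  proof -
    have "(\<Sum>k<m2. u (Inr k) * a (Inr k) j) = (\<Sum>k<m2. if k = j then (if x j = 0 then - u (Inr j) else 0) else 0)"
      by (intro sum.cong) (auto simp: a_def)
    then have "(\<Sum>i\<in>?I. u i * a i j)
        = - (\<Sum>i<m1. A i j * y i) - (if x j = 0 then u (Inr j) else 0)"
      using j by (simp add: sum.Plus) (simp add: a_def y_def sum_negf algebra_simps sum_subtractf)
    then show ?thesis using u(2) j unfolding slack_def by force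
  qed
  have "dual_sol y" "complementary x y"
    using u(1) by (auto simp: dual_sol_def complementary_def s)
  then show ?thesis by blast
qed

lemma integral_primal_sol:
  assumes x: "primal_sol x" and b: "\<And>i. i < m1 \<Longrightarrow> b i \<in> \<int>"
  shows "\<exists>v. primal_sol v \<and> (\<forall>j. x j = 0 \<longrightarrow> v j = 0) \<and>
    (\<forall>j<m2. v j \<in> \<int> \<and> \<bar>v j\<bar> \<le> (\<Sum>i<m1. \<bar>b i\<bar>)) \<and> card {j \<in> {..<m2}. v j \<noteq> 0} \<le> m1"
proof -
  obtain v where v: "\<forall>j\<in>{..<m2}. 0 \<le> v j" "\<forall>j. x j = 0 \<longrightarrow> v j = 0"
      "\<forall>i\<in>{..<m1}. (\<Sum>j<m2. A i j * v j) = (\<Sum>j<m2. A i j * x j)"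
      "indep_cols {..<m1} {j \<in> {..<m2}. v j \<noteq> 0} A"
    using basic_solution_exists[of "{..<m2}" x "{..<m1}" A] x by (auto simp: primal_sol_def)
  let ?S = "{j \<in> {..<m2}. v j \<noteq> 0}"
  have S: "?S \<subseteq> {..<m2}" "finite ?S" by auto
  obtain I lam where I: "I \<subseteq> {..<m1}" "finite I" "card I = card ?S"
    and lam: "\<And>j i. j \<in> ?S \<Longrightarrow> i \<in> I \<Longrightarrow> lam j i \<in> {0, 1, - 1 :: real}"
      "\<And>j u. j \<in> ?S \<Longrightarrow> u j = (\<Sum>i\<in>I. lam j i * (\<Sum>d\<in>?S. A i d * u d))"
    using basis_inverse[OF tu S v(4)] by blast
  have "(\<Sum>d\<in>?S. A i d * v d) = (\<Sum>d<m2. A i d * v d)" for i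
    by (intro sum.mono_neutral_left) auto
  then have rhs: "(\<Sum>d\<in>?S. A i d * v d) = b i" if "i \<in> I" for i
    using v(3) x I(1) that by (auto simp: primal_sol_def)
  have vj: "v j = (\<Sum>i\<in>I. lam j i * b i)" if "j \<in> ?S" for j
    using lam(2)[OF that, of v] rhs by simp
  have "v j \<in> \<int> \<and> \<bar>v j\<bar> \<le> (\<Sum>i<m1. \<bar>b i\<bar>)" if "j < m2" for j
  proof (cases "v j = 0")
    case True
    then show ?thesis by (simp add: sum_nonneg)
  next
    case False
    then have j: "j \<in> ?S" using that by simp
    have "\<bar>v j\<bar> \<le> (\<Sum>i\<in>I. \<bar>b i\<bar>)"
      unfolding vj[OF j] by (intro abs_sum_sign_combination lam(1)[OF j])
    also have "\<dots> \<le> (\<Sum>i<m1. \<bar>b i\<bar>)" using I(1) by (intro sum_mono2) auto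
    finally have "\<bar>v j\<bar> \<le> (\<Sum>i<m1. \<bar>b i\<bar>)" .
    moreover have "v j \<in> \<int>"
      unfolding vj[OF j] using I(1) b by (intro Ints_sum_sign_combination lam(1)[OF j]) auto
    ultimately show ?thesis by blast
  qed
  moreover have "card ?S \<le> m1"
    using card_mono[OF _ I(1)] I(3) by simp
  moreover have "primal_sol v" using v x by (auto simp: primal_sol_def)
  ultimately show ?thesis using v(2) by blast
qed

text \<open>The matrix \<open>[A\<^sup>T I]\<close> of the dual constraints in slack form \<open>A\<^sup>T y + s = c\<close>. The signs \<open>\<sigma>\<close> make the
coordinates of the free variable \<open>y\<close> nonnegative, as required by the lemmas on basic solutions.\<close>

definition dual_matrix :: "(nat \<Rightarrow> real) \<Rightarrow> nat \<Rightarrow> nat + nat \<Rightarrow> real" where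
  "dual_matrix \<sigma> j = case_sum (\<lambda>i. \<sigma> i * A i j) (\<lambda>k. if k = j then 1 else 0)"

abbreviation "dual_cols \<equiv> {..<m1} <+> {..<m2}"

lemma dual_matrix_mult:
  assumes "j < m2"
  shows "(\<Sum>d\<in>dual_cols. dual_matrix \<sigma> j d * v d) = (\<Sum>i<m1. A i j * (\<sigma> i * v (Inl i))) + v (Inr j)"
proof -
  have "(\<Sum>k<m2. dual_matrix \<sigma> j (Inr k) * v (Inr k)) = (\<Sum>k<m2. if k = j then v (Inr j) else 0)"
    by (intro sum.cong) (auto simp: dual_matrix_def)
  then show ?thesis
    using assms by (simp add: sum.Plus) (simp add: dual_matrix_def mult_ac)
qed

text \<open>The rows whose slack variable is zero already determine \<open>y\<close>, and only as many of them as \<open>y\<close> has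
nonzero coordinates are needed. Passing to these rows first keeps the number of equations used
below \<open>m1\<close>; inverting a basis of \<open>[A\<^sup>T I]\<close> could involve all \<open>m2\<close> of them.\<close>

lemma dual_basic_solution:
  assumes \<sigma>: "\<And>i. \<sigma> i \<noteq> 0"
    and ind: "indep_cols {..<m2} {d \<in> dual_cols. v d \<noteq> 0} (dual_matrix \<sigma>)"
  shows "\<exists>J lam. J \<subseteq> {..<m2} \<and> card J \<le> m1 \<and> (\<forall>i<m1. (\<forall>j\<in>J. lam i j \<in> {0, 1, - 1 :: real}) \<and>
    \<sigma> i * v (Inl i) = (\<Sum>j\<in>J. lam i j * (\<Sum>d\<in>dual_cols. dual_matrix \<sigma> j d * v d)))"
proof -
  define S where "S = {i \<in> {..<m1}. v (Inl i) \<noteq> 0}"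
  define R where "R = {j \<in> {..<m2}. v (Inr j) = 0}"
  let ?D = "{d \<in> dual_cols. v d \<noteq> 0}"
  have "indep_cols R S (\<lambda>j i. \<sigma> i * A i j)"
    unfolding indep_cols_def
  proof (intro allI impI)
    fix u assume u: "\<forall>r\<in>R. (\<Sum>i\<in>S. \<sigma> i * A i r * u i) = 0"
    define w where "w = case_sum (\<lambda>i. if i \<in> S then u i else 0)
        (\<lambda>j. if j \<in> R then 0 else - (\<Sum>i\<in>S. \<sigma> i * A i j * u i))"
    have "(\<Sum>d\<in>?D. dual_matrix \<sigma> j d * w d) = 0" if j: "j < m2" for j
    proof -
      have "(\<Sum>d\<in>?D. dual_matrix \<sigma> j d * w d) = (\<Sum>d\<in>dual_cols. dual_matrix \<sigma> j d * w d)"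
        by (intro sum.mono_neutral_left) (auto simp: w_def S_def R_def)
      also have "\<dots> = (\<Sum>i<m1. A i j * (\<sigma> i * w (Inl i))) + w (Inr j)"
        using j by (rule dual_matrix_mult)
      also have "(\<Sum>i<m1. A i j * (\<sigma> i * w (Inl i))) = (\<Sum>i\<in>S. \<sigma> i * A i j * u i)"
        by (intro sum.mono_neutral_cong_right) (auto simp: w_def S_def)
      also have "\<dots> + w (Inr j) = 0" using u by (simp add: w_def)
      finally show ?thesis .
    qed
    then have "\<forall>d\<in>?D. w d = 0" using ind unfolding indep_cols_def by blast
    then show "\<forall>i\<in>S. u i = 0" by (force simp: w_def S_def)
  qed
  then have ind': "indep_cols R S (\<lambda>j i. A i j)"
    by (rule indep_cols_scale) (rule \<sigma>)
  have tu': "tu_on R {..<m1} (\<lambda>j i. A i j)"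
    by (rule tu_on_subset[OF tu_on_transpose[OF tu]]) (auto simp: R_def)
  have S: "S \<subseteq> {..<m1}" by (auto simp: S_def)
  then have fS: "finite S" by (rule finite_subset) simp
  obtain J lam where J: "J \<subseteq> R" "finite J" "card J = card S"
    and lam: "\<And>i j. i \<in> S \<Longrightarrow> j \<in> J \<Longrightarrow> lam i j \<in> {0, 1, - 1 :: real}"
      "\<And>i u. i \<in> S \<Longrightarrow> u i = (\<Sum>j\<in>J. lam i j * (\<Sum>d\<in>S. A d j * u d))"
    using basis_inverse[OF tu' S fS ind'] by blast
  define lam' where "lam' i j = (if i \<in> S then lam i j else 0)" for i j
  have "(\<Sum>i\<in>S. A i j * (\<sigma> i * v (Inl i))) = (\<Sum>d\<in>dual_cols. dual_matrix \<sigma> j d * v d)"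
    if "j \<in> J" for j
  proof -
    have "(\<Sum>i\<in>S. A i j * (\<sigma> i * v (Inl i))) = (\<Sum>i<m1. A i j * (\<sigma> i * v (Inl i)))"
      by (intro sum.mono_neutral_left) (auto simp: S_def)
    then show ?thesis using J(1) that by (subst dual_matrix_mult) (auto simp: R_def)
  qed
  then have "\<sigma> i * v (Inl i) = (\<Sum>j\<in>J. lam' i j * (\<Sum>d\<in>dual_cols. dual_matrix \<sigma> j d * v d))"
    if "i < m1" for i
    using lam(2)[of i "\<lambda>i. \<sigma> i * v (Inl i)"] that by (cases "i \<in> S") (auto simp: lam'_def S_def)
  moreover have "lam' i j \<in> {0, 1, - 1}" if "j \<in> J" for i j
    using lam(1) that by (auto simp: lam'_def)
  moreover have "card J \<le> m1" using card_mono[OF _ S] J(3) by simp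
  moreover have "J \<subseteq> {..<m2}" using J(1) by (auto simp: R_def)
  ultimately show ?thesis by blast
qed

lemma integral_dual_sol:
  assumes y: "dual_sol y" and c: "\<And>j. j < m2 \<Longrightarrow> c j \<in> \<int>" "\<And>j. j < m2 \<Longrightarrow> \<bar>c j\<bar> \<le> H"
    and H: "0 \<le> H"
  shows "\<exists>w. dual_sol w \<and> (\<forall>j<m2. slack y j = 0 \<longrightarrow> slack w j = 0) \<and>
    (\<forall>i<m1. w i \<in> \<int> \<and> \<bar>w i\<bar> \<le> real m1 * H)"
proof -
  define \<sigma> :: "nat \<Rightarrow> real" where "\<sigma> i = (if 0 \<le> y i then 1 else - 1)" for i
  define d where "d = case_sum (\<lambda>i. \<sigma> i * y i) (slack y)"
  have \<sigma>0: "\<sigma> i \<noteq> 0" for i by (simp add: \<sigma>_def)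
  have rhs: "(\<Sum>k\<in>dual_cols. dual_matrix \<sigma> j k * d k) = c j" if "j < m2" for j
  proof -
    have "(\<Sum>i<m1. A i j * (\<sigma> i * (\<sigma> i * y i))) = (\<Sum>i<m1. A i j * y i)"
      by (intro sum.cong) (auto simp: \<sigma>_def)
    then show ?thesis using that by (simp add: dual_matrix_mult d_def slack_def)
  qed
  have d0: "0 \<le> d k" if "k \<in> dual_cols" for k
    using that y by (auto simp: d_def \<sigma>_def dual_sol_def)
  obtain v where v: "\<forall>k\<in>dual_cols. 0 \<le> v k" "\<forall>k. d k = 0 \<longrightarrow> v k = 0"
      "\<forall>j\<in>{..<m2}. (\<Sum>k\<in>dual_cols. dual_matrix \<sigma> j k * v k) = (\<Sum>k\<in>dual_cols. dual_matrix \<sigma> j k * d k)"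
      "indep_cols {..<m2} {k \<in> dual_cols. v k \<noteq> 0} (dual_matrix \<sigma>)"
    using basic_solution_exists[of dual_cols d "{..<m2}" "dual_matrix \<sigma>"] d0 by auto
  define w where "w i = \<sigma> i * v (Inl i)" for i
  have sw: "slack w j = v (Inr j)" if "j < m2" for j
    using v(3)[rule_format, of j] rhs[OF that] that
    by (simp add: dual_matrix_mult slack_def w_def)
  obtain J lam where J: "J \<subseteq> {..<m2}" "card J \<le> m1"
    and lam: "\<And>i j. i < m1 \<Longrightarrow> j \<in> J \<Longrightarrow> lam i j \<in> {0, 1, - 1 :: real}"
      "\<And>i. i < m1 \<Longrightarrow> w i = (\<Sum>j\<in>J. lam i j * (\<Sum>d\<in>dual_cols. dual_matrix \<sigma> j d * v d))"
    using dual_basic_solution[OF \<sigma>0 v(4)] unfolding w_def by blast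
  have wi: "w i = (\<Sum>j\<in>J. lam i j * c j)" if "i < m1" for i
    unfolding lam(2)[OF that] using J(1) v(3) rhs by (intro sum.cong) auto
  have "w i \<in> \<int> \<and> \<bar>w i\<bar> \<le> real m1 * H" if "i < m1" for i
  proof
    show "w i \<in> \<int>"
      unfolding wi[OF that] using J(1) c lam(1)[OF that] by (intro Ints_sum_sign_combination) auto
    have "\<bar>w i\<bar> \<le> (\<Sum>j\<in>J. \<bar>c j\<bar>)"
      unfolding wi[OF that] by (intro abs_sum_sign_combination lam(1)[OF that])
    also have "\<dots> \<le> (\<Sum>j\<in>J. H)" using J(1) c(2) by (intro sum_mono) auto
    also have "\<dots> \<le> real m1 * H" using J(2) H by (simp add: mult_right_mono)
    finally show "\<bar>w i\<bar> \<le> real m1 * H" .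
  qed
  moreover have "dual_sol w" using v(1) by (auto simp: dual_sol_def sw)
  moreover have "slack w j = 0" if "j < m2" "slack y j = 0" for j
    using v(2) that by (simp add: sw d_def)
  ultimately show ?thesis by blast
qed
end

section \<open>Error bounds\<close>

lemma sum_abs_le_sqrt_card_L2_set:
  "(\<Sum>i\<in>J. \<bar>f i\<bar>) \<le> sqrt (real (card J)) * L2_set f J"
  using L2_set_mult_ineq[of "\<lambda>_. 1" f J] by (simp add: L2_set_def)

context tu_system
begin

text \<open>First set the coordinates in \<open>N\<close> to zero and then correct the residual of the equations, moving
towards \<open>xs\<close> within the box spanned by the two points. The part of the residual that stems from
the deleted coordinates is a combination of columns of \<open>A\<close>, on which the basis inverse has entries
of absolute value at most \<open>1\<close>; this saves a factor \<open>m1\<close> over the plain bound by the size of the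
residual.\<close>

lemma primal_error_bound:
  assumes xs: "primal_sol xs" and x: "\<And>j. j < m2 \<Longrightarrow> 0 \<le> x j"
    and N: "N \<subseteq> {..<m2}" "\<And>j. j \<in> N \<Longrightarrow> xs j = 0"
  shows "\<exists>v. primal_sol v \<and> (\<forall>j\<in>N. v j = 0) \<and> (\<Sum>j<m2. \<bar>x j - v j\<bar>) \<le> (\<Sum>j\<in>N. x j) +
    real m1 * ((\<Sum>i<m1. \<bar>b i - (\<Sum>j<m2. A i j * x j)\<bar>) + (\<Sum>j\<in>N. x j))"
proof -
  define E where "E = (\<Sum>i<m1. \<bar>b i - (\<Sum>j<m2. A i j * x j)\<bar>) + (\<Sum>j\<in>N. x j)"
  have E: "0 \<le> E" unfolding E_def using x N(1) by (intro add_nonneg_nonneg sum_nonneg) auto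
  define xt where "xt j = (if j \<in> N then 0 else x j)" for j
  define \<sigma> :: "nat \<Rightarrow> real" where "\<sigma> j = (if xt j \<le> xs j then 1 else - 1)" for j
  define d where "d j = \<bar>xs j - xt j\<bar>" for j
  have \<sigma>d: "\<sigma> j * d j = xs j - xt j" for j by (simp add: \<sigma>_def d_def)
  have \<sigma>0: "\<sigma> j \<noteq> 0" "\<bar>\<sigma> j\<bar> = 1" for j by (auto simp: \<sigma>_def)
  have Axt: "b i - (\<Sum>j<m2. A i j * xt j) = (b i - (\<Sum>j<m2. A i j * x j)) + (\<Sum>k\<in>N. A i k * x k)" for i
  proof -
    have "(\<Sum>j<m2. A i j * x j) - (\<Sum>j<m2. A i j * xt j) = (\<Sum>j<m2. if j \<in> N then A i j * x j else 0)"
      unfolding sum_subtractf[symmetric] by (intro sum.cong) (auto simp: xt_def)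
    also have "\<dots> = (\<Sum>k\<in>N. A i k * x k)"
      using N(1) by (simp add: sum.inter_restrict[symmetric] Int_absorb1)
    finally show ?thesis by simp
  qed
  have Ad: "(\<Sum>j<m2. \<sigma> j * A i j * d j) = b i - (\<Sum>j<m2. A i j * xt j)" if "i < m1" for i
  proof -
    have "(\<Sum>j<m2. \<sigma> j * A i j * d j) = (\<Sum>j<m2. A i j * xs j - A i j * xt j)"
    proof (intro sum.cong refl)
      show "\<sigma> j * A i j * d j = A i j * xs j - A i j * xt j" for j
        using arg_cong[OF \<sigma>d[of j], of "\<lambda>t. A i j * t"] by (simp add: algebra_simps)
    qed
    then show ?thesis using xs that by (simp add: sum_subtractf primal_sol_def)
  qed
  have basic: "(\<Sum>j<m2. v j) \<le> real m1 * E"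
    if v: "\<And>j. j \<in> {..<m2} \<Longrightarrow> 0 \<le> v j"
      "\<And>i. i \<in> {..<m1} \<Longrightarrow> (\<Sum>j<m2. \<sigma> j * A i j * v j) = (\<Sum>j<m2. \<sigma> j * A i j * d j)"
      "indep_cols {..<m1} {j \<in> {..<m2}. v j \<noteq> 0} (\<lambda>i j. \<sigma> j * A i j)" for v
  proof -
    let ?S = "{j \<in> {..<m2}. v j \<noteq> 0}"
    have S: "?S \<subseteq> {..<m2}" "finite ?S" by auto
    have ind: "indep_cols {..<m1} ?S A"
      using v(3) by (rule indep_cols_scale) (rule \<sigma>0)
    obtain I lam where I: "I \<subseteq> {..<m1}" "finite I" "card I = card ?S"
      and lam: "\<And>j i. j \<in> ?S \<Longrightarrow> i \<in> I \<Longrightarrow> lam j i \<in> {0, 1, - 1 :: real}"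
        "\<And>j u. j \<in> ?S \<Longrightarrow> u j = (\<Sum>i\<in>I. lam j i * (\<Sum>d\<in>?S. A i d * u d))"
        "\<And>j k. j \<in> ?S \<Longrightarrow> k \<in> {..<m2} \<Longrightarrow> \<bar>\<Sum>i\<in>I. lam j i * A i k\<bar> \<le> 1"
      using basis_inverse[OF tu S ind] by blast
    have Sv: "(\<Sum>k\<in>?S. A i k * (\<sigma> k * v k)) = b i - (\<Sum>j<m2. A i j * xt j)" if "i \<in> I" for i
    proof -
      have "(\<Sum>k\<in>?S. A i k * (\<sigma> k * v k)) = (\<Sum>k<m2. \<sigma> k * A i k * v k)"
        by (intro sum.mono_neutral_cong_left) auto
      then show ?thesis using v(2)[of i] Ad[of i] I(1) that by auto
    qed
    have vj: "v j \<le> E" if j: "j \<in> ?S" for j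
    proof -
      have "\<sigma> j * v j = (\<Sum>i\<in>I. lam j i * (\<Sum>k\<in>?S. A i k * (\<sigma> k * v k)))"
        using lam(2)[OF j, of "\<lambda>k. \<sigma> k * v k"] .
      also have "\<dots> = (\<Sum>i\<in>I. lam j i * (b i - (\<Sum>j<m2. A i j * x j)))
          + (\<Sum>i\<in>I. lam j i * (\<Sum>k\<in>N. A i k * x k))"
        using Sv Axt by (simp add: distrib_left sum.distrib)
      also have "(\<Sum>i\<in>I. lam j i * (\<Sum>k\<in>N. A i k * x k)) = (\<Sum>k\<in>N. (\<Sum>i\<in>I. lam j i * A i k) * x k)"
        unfolding sum_distrib_left sum_distrib_right by (subst sum.swap) (simp add: mult.assoc)
      finally have eq: "\<sigma> j * v j = (\<Sum>i\<in>I. lam j i * (b i - (\<Sum>j<m2. A i j * x j)))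
          + (\<Sum>k\<in>N. (\<Sum>i\<in>I. lam j i * A i k) * x k)" .
      have "\<bar>\<Sum>i\<in>I. lam j i * (b i - (\<Sum>j<m2. A i j * x j))\<bar> \<le> (\<Sum>i\<in>I. \<bar>b i - (\<Sum>j<m2. A i j * x j)\<bar>)"
        by (intro abs_sum_sign_combination lam(1)[OF j])
      also have "\<dots> \<le> (\<Sum>i<m1. \<bar>b i - (\<Sum>j<m2. A i j * x j)\<bar>)"
        using I(1) by (intro sum_mono2) auto
      finally have 1: "\<bar>\<Sum>i\<in>I. lam j i * (b i - (\<Sum>j<m2. A i j * x j))\<bar> \<le> \<dots>" .
      have "\<bar>(\<Sum>i\<in>I. lam j i * A i k) * x k\<bar> \<le> x k" if "k \<in> N" for k
        using lam(3)[OF j, of k] x[of k] N(1) that mult_right_mono[of "\<bar>\<Sum>i\<in>I. lam j i * A i k\<bar>" 1 "x k"]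
        by (auto simp: abs_mult)
      then have 2: "\<bar>\<Sum>k\<in>N. (\<Sum>i\<in>I. lam j i * A i k) * x k\<bar> \<le> (\<Sum>k\<in>N. x k)"
        by (intro order_trans[OF sum_abs] sum_mono)
      have "v j = \<bar>\<sigma> j * v j\<bar>" using v(1)[of j] j by (simp add: abs_mult \<sigma>0)
      also have "\<dots> \<le> E" unfolding eq E_def using 1 2 by linarith
      finally show ?thesis .
    qed
    have "(\<Sum>j<m2. v j) = (\<Sum>j\<in>?S. v j)" by (intro sum.mono_neutral_right) auto
    also have "\<dots> \<le> real (card ?S) * E" using sum_bounded_above[of ?S v E] vj by blast
    also have "\<dots> \<le> real m1 * E"
      using card_mono[OF _ I(1)] I(3) E by (intro mult_right_mono) auto
    finally show ?thesis .
  qed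
  obtain v where v: "\<forall>j\<in>{..<m2}. 0 \<le> v j \<and> v j \<le> d j"
      "\<forall>i\<in>{..<m1}. (\<Sum>j<m2. \<sigma> j * A i j * v j) = (\<Sum>j<m2. \<sigma> j * A i j * d j)"
      "(\<Sum>j<m2. v j) \<le> real m1 * E"
    using dominated_solution[of "{..<m2}" "{..<m2}" d "{..<m1}" "\<lambda>i j. \<sigma> j * A i j" "real m1 * E"]
      basic by (auto simp: d_def)
  define w where "w j = xt j + \<sigma> j * v j" for j
  have "0 \<le> w j" if "j < m2" for j
    using v(1) that xs x[OF that] unfolding w_def \<sigma>_def d_def xt_def primal_sol_def
    by (fastforce split: if_splits)
  moreover have "(\<Sum>j<m2. A i j * w j) = b i" if "i < m1" for i
    using v(2) Ad[OF that] that by (simp add: w_def distrib_left sum.distrib mult_ac)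
  moreover have "w j = 0" if "j \<in> N" for j
    using v(1) that N by (force simp: w_def d_def xt_def)
  moreover have "(\<Sum>j<m2. \<bar>x j - w j\<bar>) \<le> (\<Sum>j\<in>N. x j) + real m1 * E"
  proof -
    have "(\<Sum>j<m2. \<bar>x j - w j\<bar>) \<le> (\<Sum>j<m2. (if j \<in> N then x j else 0) + v j)"
    proof (intro sum_mono)
      fix j assume "j \<in> {..<m2}"
      then have "\<bar>\<sigma> j * v j\<bar> = v j" "0 \<le> x j" using v(1) x by (auto simp: abs_mult \<sigma>0)
      then show "\<bar>x j - w j\<bar> \<le> (if j \<in> N then x j else 0) + v j"
        by (auto simp: w_def xt_def abs_le_iff)
    qed
    also have "\<dots> = (\<Sum>j\<in>N. x j) + (\<Sum>j<m2. v j)"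
      using N(1) by (simp add: sum.distrib sum.inter_restrict[symmetric] Int_absorb1)
    finally show ?thesis using v(3) by simp
  qed
  ultimately show ?thesis unfolding E_def by (intro exI[of _ w]) (simp add: primal_sol_def)
qed

text \<open>The same correction for the system \<open>A\<^sup>T y + s = c\<close>, with the slack first projected to its intended
value: zero on \<open>B\<close> and the positive part elsewhere. The hypothesis on \<open>\<kappa>\<close> ranges over all sets of
at most \<open>m1\<close> rows since a basis sees only so many of them.\<close>

lemma dual_error_bound:
  assumes ys: "dual_sol ys" and B: "\<And>j. j \<in> B \<Longrightarrow> slack ys j = 0"
    and J: "\<And>J. J \<subseteq> {..<m2} \<Longrightarrow> card J \<le> m1 \<Longrightarrow>
      (\<Sum>j\<in>J. if j \<in> B then \<bar>slack y j\<bar> else max 0 (- slack y j)) \<le> \<kappa>"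
  shows "\<exists>w. dual_sol w \<and> (\<forall>j<m2. j \<in> B \<longrightarrow> slack w j = 0) \<and> (\<Sum>i<m1. \<bar>y i - w i\<bar>) \<le> real m1 * \<kappa>"
proof -
  define st where "st j = (if j \<in> B then 0 else max 0 (slack y j))" for j
  have st: "\<bar>slack y j - st j\<bar> = (if j \<in> B then \<bar>slack y j\<bar> else max 0 (- slack y j))" for j
    by (auto simp: st_def max_def)
  define \<sigma> :: "nat \<Rightarrow> real" where "\<sigma> i = (if y i \<le> ys i then 1 else - 1)" for i
  define \<tau> :: "nat \<Rightarrow> real" where "\<tau> j = (if st j \<le> slack ys j then 1 else - 1)" for j
  define d where "d = case_sum (\<lambda>i. \<bar>ys i - y i\<bar>) (\<lambda>j. \<bar>slack ys j - st j\<bar>)"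
  define s where "s = case_sum \<sigma> \<tau>"
  have s0: "s k \<noteq> 0" "\<bar>s k\<bar> = 1" for k by (cases k; auto simp: s_def \<sigma>_def \<tau>_def)+
  have sd: "s (Inl i) * d (Inl i) = ys i - y i" "s (Inr j) * d (Inr j) = slack ys j - st j" for i j
    by (auto simp: s_def d_def \<sigma>_def \<tau>_def)
  define M where "M j k = s k * dual_matrix (\<lambda>_. 1) j k" for j k
  have M: "(\<Sum>k\<in>dual_cols. M j k * v k) = (\<Sum>k\<in>dual_cols. dual_matrix (\<lambda>_. 1) j k * (s k * v k))" for j v
    by (simp add: M_def mult_ac)
  have Md: "(\<Sum>k\<in>dual_cols. M j k * d k) = slack y j - st j" if "j < m2" for j
    unfolding M dual_matrix_mult[OF that] sd
    by (simp add: slack_def right_diff_distrib sum_subtractf)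
  let ?B = "Inl ` {..<m1} :: (nat + nat) set"
  have sumB: "(\<Sum>k\<in>?B. h k) = (\<Sum>i<m1. h (Inl i))" for h :: "nat + nat \<Rightarrow> real"
    by (simp add: sum.reindex)
  \<comment> \<open>a basic correction changes each coordinate of \<open>y\<close> by at most \<open>\<kappa>\<close>\<close>
  have basic: "(\<Sum>k\<in>?B. v k) \<le> real m1 * \<kappa>"
    if v: "\<And>k. k \<in> dual_cols \<Longrightarrow> 0 \<le> v k"
      "\<And>j. j \<in> {..<m2} \<Longrightarrow> (\<Sum>k\<in>dual_cols. M j k * v k) = (\<Sum>k\<in>dual_cols. M j k * d k)"
      "indep_cols {..<m2} {k \<in> dual_cols. v k \<noteq> 0} M" for v
  proof -
    let ?v = "\<lambda>k. s k * v k"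
    have "indep_cols {..<m2} {k \<in> dual_cols. v k \<noteq> 0} (dual_matrix (\<lambda>_. 1))"
      using v(3)[unfolded M_def] by (rule indep_cols_scale) (rule s0)
    moreover have "{k \<in> dual_cols. ?v k \<noteq> 0} = {k \<in> dual_cols. v k \<noteq> 0}" using s0 by auto
    ultimately have "indep_cols {..<m2} {k \<in> dual_cols. ?v k \<noteq> 0} (dual_matrix (\<lambda>_. 1))" by simp
    from dual_basic_solution[where \<sigma> = "\<lambda>_. 1", OF one_neq_zero this, unfolded mult_1] obtain I lam where I: "I \<subseteq> {..<m2}" "card I \<le> m1"
      and lam: "\<And>i j. i < m1 \<Longrightarrow> j \<in> I \<Longrightarrow> lam i j \<in> {0, 1, - 1 :: real}"
        "\<And>i. i < m1 \<Longrightarrow> ?v (Inl i) = (\<Sum>j\<in>I. lam i j * (\<Sum>k\<in>dual_cols. dual_matrix (\<lambda>_. 1) j k * ?v k))"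
      by blast
    have "v (Inl i) \<le> \<kappa>" if i: "i < m1" for i
    proof -
      have "0 \<le> v (Inl i)" using i by (intro v(1)) auto
      then have "v (Inl i) = \<bar>?v (Inl i)\<bar>" by (simp add: abs_mult s0)
      also have "?v (Inl i) = (\<Sum>j\<in>I. lam i j * (slack y j - st j))"
        unfolding lam(2)[OF i] using v(2) Md I(1) by (intro sum.cong) (auto simp flip: M)
      also have "\<bar>\<dots>\<bar> \<le> (\<Sum>j\<in>I. \<bar>slack y j - st j\<bar>)"
        by (intro abs_sum_sign_combination lam(1)[OF i])
      also have "\<dots> \<le> \<kappa>" unfolding st by (rule J[OF I])
      finally show ?thesis .
    qed
    then show ?thesis unfolding sumB using sum_bounded_above[of "{..<m1}" "\<lambda>i. v (Inl i)" \<kappa>] by simp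
  qed
  have d0: "0 \<le> d k" for k by (cases k) (auto simp: d_def)
  obtain v where v: "\<forall>k\<in>dual_cols. 0 \<le> v k \<and> v k \<le> d k"
      "\<forall>j\<in>{..<m2}. (\<Sum>k\<in>dual_cols. M j k * v k) = (\<Sum>k\<in>dual_cols. M j k * d k)"
      "(\<Sum>k\<in>?B. v k) \<le> real m1 * \<kappa>"
    using dominated_solution[of dual_cols ?B d "{..<m2}" M "real m1 * \<kappa>"] basic d0 by (auto simp: Plus_def)
  define w where "w i = y i + s (Inl i) * v (Inl i)" for i
  have sw: "slack w j = st j + s (Inr j) * v (Inr j)" if "j < m2" for j
  proof -
    have "(\<Sum>i<m1. A i j * (s (Inl i) * v (Inl i))) + s (Inr j) * v (Inr j) = slack y j - st j"
      using v(2)[rule_format, of j] that unfolding Md[OF that] unfolding M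
      by (simp add: dual_matrix_mult)
    then show ?thesis by (simp add: slack_def w_def distrib_left sum.distrib)
  qed
  have vr: "0 \<le> v (Inr j)" "v (Inr j) \<le> \<bar>slack ys j - st j\<bar>" if "j < m2" for j
    using bspec[OF v(1), of "Inr j"] that by (auto simp: d_def)
  have "0 \<le> slack w j" if "j < m2" for j
  proof -
    have "0 \<le> st j" "0 \<le> slack ys j" using ys that by (auto simp: st_def dual_sol_def)
    then show ?thesis using vr[OF that] unfolding sw[OF that] by (auto simp: s_def \<tau>_def)
  qed
  moreover have "slack w j = 0" if "j < m2" "j \<in> B" for j
    using vr[OF that(1)] B[OF that(2)] that(2) unfolding sw[OF that(1)] by (simp add: st_def)
  moreover have "(\<Sum>i<m1. \<bar>y i - w i\<bar>) = (\<Sum>i<m1. v (Inl i))"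
  proof (intro sum.cong refl)
    show "\<bar>y i - w i\<bar> = v (Inl i)" if "i \<in> {..<m1}" for i
      using bspec[OF v(1) InlI[OF that]] by (auto simp: w_def abs_mult s0)
  qed
  ultimately show ?thesis using v(3) unfolding sumB by (intro exI[of _ w]) (simp add: dual_sol_def)
qed

text \<open>The optimal faces are \<open>{x feasible. x j = 0 where slack ys j \<noteq> 0}\<close> and \<open>{y feasible. slack y j = 0
where xs j \<noteq> 0}\<close>. The duality gap equals \<open>T1 + T2\<close> up to inner products of \<open>xs\<close> and \<open>ys\<close> with the
residuals, where \<open>T1\<close> pairs \<open>x\<close> with the slack of \<open>ys\<close> and \<open>T2\<close> pairs \<open>xs\<close> with the positive slack
of \<open>y\<close>. By integrality the weights are at least \<open>1\<close>, so \<open>T1 + T2\<close> bounds the entries of \<open>x\<close> and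
the positive slacks of \<open>y\<close> that vanish on the optimal faces.\<close>

lemma kkt_error_bound:
  assumes xs: "primal_sol xs" "\<And>j. j < m2 \<Longrightarrow> xs j \<in> \<int>"
    and ys: "dual_sol ys" "\<And>i. i < m1 \<Longrightarrow> ys i \<in> \<int>" and compl: "complementary xs ys"
    and c: "\<And>j. j < m2 \<Longrightarrow> c j \<in> \<int>"
    and R: "L2_set xs {..<m2} \<le> R" "L2_set ys {..<m1} \<le> R" "sqrt (real m1) \<le> R" and m1: "0 < m1"
    and x: "\<And>j. j < m2 \<Longrightarrow> 0 \<le> x j"
    and res: "L2_set (\<lambda>i. b i - (\<Sum>j<m2. A i j * x j)) {..<m1} \<le> g"
      "L2_set (\<lambda>j. max 0 (- slack y j)) {..<m2} \<le> g"
      "(\<Sum>j<m2. c j * x j) - (\<Sum>i<m1. b i * y i) \<le> 8 * R * g"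
  shows "\<exists>xh yh. primal_sol xh \<and> dual_sol yh \<and> complementary xh ys \<and> complementary xs yh \<and>
    (\<Sum>j<m2. \<bar>x j - xh j\<bar>) \<le> 21 * real m1 * R * g \<and> (\<Sum>i<m1. \<bar>y i - yh i\<bar>) \<le> 11 * real m1 * R * g"
proof -
  have g0: "0 \<le> g" using res(1) L2_set_nonneg order_trans by blast
  have R0: "0 \<le> R" using R(1) L2_set_nonneg order_trans by blast
  define N where "N = {j \<in> {..<m2}. slack ys j \<noteq> 0}"
  define B where "B = {j \<in> {..<m2}. xs j \<noteq> 0}"
  have int1: "1 \<le> t" if "t \<in> \<int>" "0 \<le> t" "t \<noteq> 0" for t :: real
    using that by (auto elim!: Ints_cases)
  have "slack ys j \<in> \<int>" if "j < m2" for j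
  proof -
    have "A i j \<in> \<int>" if "i < m1" for i
      using tu_on_entry[OF tu, of i j] that \<open>j < m2\<close> by auto
    then show ?thesis unfolding slack_def using c ys(2) that by (intro Ints_diff Ints_sum Ints_mult) auto
  qed
  then have N1: "1 \<le> slack ys j" if "j \<in> N" for j
    using ys(1) that by (intro int1) (auto simp: N_def dual_sol_def)
  have B1: "1 \<le> xs j" if "j \<in> B" for j
    using xs that by (intro int1) (auto simp: B_def primal_sol_def)
  have CS: "(\<Sum>i\<in>S. f i * h i) \<le> L2_set f S * L2_set h S" for f h and S :: "nat set"
  proof -
    have "(\<Sum>i\<in>S. f i * h i) \<le> (\<Sum>i\<in>S. \<bar>f i\<bar> * \<bar>h i\<bar>)"
      by (intro sum_mono) (simp flip: abs_mult)
    then show ?thesis using L2_set_mult_ineq[of f h S] by linarith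
  qed
  define T1 T2 where "T1 = (\<Sum>j<m2. slack ys j * x j)" and "T2 = (\<Sum>j<m2. xs j * max 0 (slack y j))"
  have T: "0 \<le> T1" "0 \<le> T2"
    using x xs(1) ys(1) by (auto simp: T1_def T2_def primal_sol_def dual_sol_def intro!: sum_nonneg)
  \<comment> \<open>\<open>8 R g\<close> from the duality gap and \<open>R g\<close> from each of the two residuals\<close>
  have T12: "T1 + T2 \<le> 10 * R * g"
  proof -
    have e1: "(\<Sum>j<m2. c j * xs j) - (\<Sum>i<m1. b i * ys i) = 0"
      using lagrange_identity[of xs ys] xs(1) compl
      by (simp add: primal_sol_def complementary_def) (rule sum.neutral, auto)
    have e2: "(\<Sum>j<m2. c j * xs j) - (\<Sum>i<m1. b i * y i) = T2 - (\<Sum>j<m2. xs j * max 0 (- slack y j))"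
    proof -
      have "slack y j * xs j = xs j * max 0 (slack y j) - xs j * max 0 (- slack y j)" for j
        by (auto simp: max_def)
      then show ?thesis using lagrange_identity[of xs y] xs(1)
        by (simp add: primal_sol_def T2_def sum_subtractf)
    qed
    have e3: "(\<Sum>j<m2. c j * x j) - (\<Sum>i<m1. b i * ys i)
        = T1 - (\<Sum>i<m1. ys i * (b i - (\<Sum>j<m2. A i j * x j)))"
      using lagrange_identity[of x ys] by (simp add: T1_def)
    have "(\<Sum>i<m1. ys i * (b i - (\<Sum>j<m2. A i j * x j))) \<le> R * g"
      by (rule order_trans[OF CS]) (intro mult_mono R res R0 L2_set_nonneg)
    moreover have "(\<Sum>j<m2. xs j * max 0 (- slack y j)) \<le> R * g"
      by (rule order_trans[OF CS]) (intro mult_mono R res R0 L2_set_nonneg)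
    ultimately show ?thesis using e1 e2 e3 res(3) by linarith
  qed
  \<comment> \<open>the integral slacks and coordinates that weight \<open>T1\<close> and \<open>T2\<close> can be dropped, being at least \<open>1\<close>\<close>
  have xN: "(\<Sum>j\<in>N. x j) \<le> T1"
  proof -
    have "(\<Sum>j\<in>N. x j) \<le> (\<Sum>j\<in>N. slack ys j * x j)"
      using N1 x mult_right_mono[of 1 "slack ys _" "x _"] by (intro sum_mono) (fastforce simp: N_def)
    also have "\<dots> = T1" unfolding T1_def by (intro sum.mono_neutral_left) (auto simp: N_def)
    finally show ?thesis .
  qed
  have sB: "(\<Sum>j\<in>B. max 0 (slack y j)) \<le> T2"
  proof -
    have "(\<Sum>j\<in>B. max 0 (slack y j)) \<le> (\<Sum>j\<in>B. xs j * max 0 (slack y j))"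
      using B1 mult_right_mono[of 1 "xs _" "max 0 (slack y _)"] by (intro sum_mono) fastforce
    also have "\<dots> = T2" unfolding T2_def by (intro sum.mono_neutral_left) (auto simp: B_def)
    finally show ?thesis .
  qed
  have mR: "sqrt (real m1) * g \<le> R * g" using R(3) g0 by (rule mult_right_mono)
  have "(\<Sum>i<m1. \<bar>b i - (\<Sum>j<m2. A i j * x j)\<bar>) \<le> R * g"
  proof -
    have "(\<Sum>i<m1. \<bar>b i - (\<Sum>j<m2. A i j * x j)\<bar>)
        \<le> sqrt (real m1) * L2_set (\<lambda>i. b i - (\<Sum>j<m2. A i j * x j)) {..<m1}"
      using sum_abs_le_sqrt_card_L2_set[of "\<lambda>i. b i - (\<Sum>j<m2. A i j * x j)" "{..<m1}"] by simp
    also have "\<dots> \<le> R * g" using R(3) res(1) R0 by (intro mult_mono) auto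
    finally show ?thesis .
  qed
  then have E: "real m1 * ((\<Sum>i<m1. \<bar>b i - (\<Sum>j<m2. A i j * x j)\<bar>) + (\<Sum>j\<in>N. x j)) \<le> real m1 * (11 * R * g)"
    using xN T T12 by (intro mult_left_mono) auto
  have "10 * R * g \<le> real m1 * (10 * R * g)"
    using m1 R0 g0 mult_right_mono[of 1 "real m1" "10 * R * g"] by simp
  then have E': "(\<Sum>j\<in>N. x j) + real m1 * ((\<Sum>i<m1. \<bar>b i - (\<Sum>j<m2. A i j * x j)\<bar>) + (\<Sum>j\<in>N. x j))
      \<le> 21 * real m1 * R * g"
    using E xN T T12 by (simp add: algebra_simps)
  have xsN: "xs j = 0" if "j \<in> N" for j using that compl by (auto simp: N_def complementary_def)
  have "N \<subseteq> {..<m2}" by (auto simp: N_def)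
  from primal_error_bound[where x = x, OF xs(1) x this xsN] obtain xh where xh: "primal_sol xh"
      "\<forall>j\<in>N. xh j = 0" and xh': "(\<Sum>j<m2. \<bar>x j - xh j\<bar>) \<le> (\<Sum>j\<in>N. x j) +
        real m1 * ((\<Sum>i<m1. \<bar>b i - (\<Sum>j<m2. A i j * x j)\<bar>) + (\<Sum>j\<in>N. x j))"
    by blast
  from xh' E' have xh'': "(\<Sum>j<m2. \<bar>x j - xh j\<bar>) \<le> 21 * real m1 * R * g" by (rule order_trans)
  have ysB: "slack ys j = 0" if "j \<in> B" for j using that compl by (auto simp: B_def complementary_def)
  have "(\<Sum>j\<in>J. if j \<in> B then \<bar>slack y j\<bar> else max 0 (- slack y j)) \<le> 11 * R * g"
    if J: "J \<subseteq> {..<m2}" "card J \<le> m1" for J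
  proof -
    have fJ: "finite J" using J(1) by (rule finite_subset) simp
    have "(\<Sum>j\<in>J. if j \<in> B then \<bar>slack y j\<bar> else max 0 (- slack y j))
        \<le> (\<Sum>j\<in>J. (if j \<in> B then max 0 (slack y j) else 0) + max 0 (- slack y j))"
      by (intro sum_mono) auto
    also have "\<dots> = (\<Sum>j\<in>J \<inter> B. max 0 (slack y j)) + (\<Sum>j\<in>J. max 0 (- slack y j))"
      using fJ by (simp add: sum.distrib sum.inter_restrict)
    also have "(\<Sum>j\<in>J \<inter> B. max 0 (slack y j)) \<le> (\<Sum>j\<in>B. max 0 (slack y j))"
      by (intro sum_mono2) (auto simp: B_def)
    also have "(\<Sum>j\<in>J. max 0 (- slack y j)) \<le> sqrt (real (card J)) * L2_set (\<lambda>j. max 0 (- slack y j)) J"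
      using sum_abs_le_sqrt_card_L2_set[of "\<lambda>j. max 0 (- slack y j)" J] by simp
    also have "\<dots> \<le> R * g"
    proof (rule mult_mono)
      show "sqrt (real (card J)) \<le> R"
        by (rule order_trans[OF _ R(3)]) (use J(2) in simp)
      have "L2_set (\<lambda>j. max 0 (- slack y j)) J \<le> L2_set (\<lambda>j. max 0 (- slack y j)) {..<m2}"
        unfolding L2_set_def using J(1) by (intro real_sqrt_le_mono sum_mono2) auto
      then show "L2_set (\<lambda>j. max 0 (- slack y j)) J \<le> g" using res(2) by linarith
    qed (use R0 L2_set_nonneg in auto)
    finally show ?thesis using sB T T12 by linarith
  qed
  from dual_error_bound[OF ys(1) ysB this] obtain yh where yh: "dual_sol yh"
      "\<forall>j<m2. j \<in> B \<longrightarrow> slack yh j = 0" "(\<Sum>i<m1. \<bar>y i - yh i\<bar>) \<le> real m1 * (11 * R * g)"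
    by blast
  have "complementary xh ys" using xh(2) by (auto simp: complementary_def N_def)
  moreover have "complementary xs yh" using yh(2) by (auto simp: complementary_def B_def)
  ultimately show ?thesis using xh(1) xh'' yh(1,3) by (auto simp: mult_ac)
qed

end

section \<open>PDHG in inner product spaces\<close>

definition average :: "(nat \<Rightarrow> 'v::real_vector) \<Rightarrow> nat \<Rightarrow> 'v" where
  "average z t = (1 / real t) *\<^sub>R (\<Sum>i=1..t. z i)"

text \<open>The set \<open>K\<close> is the feasible set of the primal variable. A step is characterised through the
variational inequality of the projection onto \<open>K\<close>, which is all that the convergence argument
uses.\<close>

locale pdhg =
  fixes A :: "'a::real_inner \<Rightarrow> 'b::real_inner" and At :: "'b \<Rightarrow> 'a"
    and c :: 'a and b :: 'b and K :: "'a set" and \<eta> \<sigma> :: real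
  assumes lin: "linear A" and lin_t: "linear At"
    and adj: "inner (A x) y = inner x (At y)"
    and bound: "norm (A x) \<le> \<sigma> * norm x"
    and \<eta>: "0 < \<eta>" "\<eta> * \<sigma> \<le> 1 / 2"
begin

definition gap :: "'a \<times> 'b \<Rightarrow> 'a \<times> 'b \<Rightarrow> real" where
  "gap z w = (inner c (fst z) + inner b (snd w) - inner (snd w) (A (fst z)))
           - (inner c (fst w) + inner b (snd z) - inner (snd z) (A (fst w)))"

definition is_step :: "'a \<times> 'b \<Rightarrow> 'a \<times> 'b \<Rightarrow> bool" where
  "is_step z z' \<longleftrightarrow> fst z' \<in> K \<and>
     (\<forall>u\<in>K. 0 \<le> inner (fst z' - fst z + \<eta> *\<^sub>R (c - At (snd z))) (u - fst z')) \<and>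
     snd z' = snd z + \<eta> *\<^sub>R (b - A (2 *\<^sub>R fst z' - fst z))"

text \<open>PDHG is a proximal point method with respect to this self-adjoint operator instead of the
identity. It is the preconditioner for the sign convention \<open>- inner y (A x)\<close> of the coupling term,
multiplied by \<open>\<eta>\<close>.\<close>

definition prec :: "'a \<times> 'b \<Rightarrow> 'a \<times> 'b" where
  "prec z = (fst z + \<eta> *\<^sub>R At (snd z), snd z + \<eta> *\<^sub>R A (fst z))"

definition prec_sq :: "'a \<times> 'b \<Rightarrow> real" where
  "prec_sq z = inner z (prec z)"

lemmas A_simps = linear_add[OF lin] linear_diff[OF lin] linear_scale[OF lin] linear_neg[OF lin]
  linear_add[OF lin_t] linear_diff[OF lin_t] linear_scale[OF lin_t] linear_neg[OF lin_t]

lemma adj_left: "inner (At y) x = inner y (A x)"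
  by (metis adj inner_commute)

lemma adj_right: "inner x (At y) = inner y (A x)"
  by (metis adj inner_commute)

lemma prec_add: "prec (z + w) = prec z + prec w" and prec_diff: "prec (z - w) = prec z - prec w"
  by (auto simp: prec_def A_simps algebra_simps prod_eq_iff)

lemma prec_sym: "inner z (prec w) = inner w (prec z)"
  by (simp add: prec_def inner_prod_def inner_add_right adj[symmetric] inner_commute)

lemma prec_sq_add: "prec_sq (z + w) = prec_sq z + 2 * inner z (prec w) + prec_sq w"
  using prec_sym[of z w] by (simp add: prec_sq_def prec_add inner_add_left inner_add_right)

lemma prec_sq_minus: "prec_sq (z - w) = prec_sq (w - z)"
  by (simp add: prec_sq_def prec_diff algebra_simps)

lemma prec_sq_bounds: "(norm z)\<^sup>2 / 2 \<le> prec_sq z" "prec_sq z \<le> 3 / 2 * (norm z)\<^sup>2"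
proof -
  obtain x y where z: "z = (x, y)" by force
  have "prec_sq z = (norm z)\<^sup>2 + 2 * \<eta> * inner y (A x)"
    by (simp add: z prec_sq_def prec_def inner_prod_def inner_add_right adj[symmetric] inner_commute
        power2_norm_eq_inner algebra_simps)
  moreover have "\<bar>2 * \<eta> * inner y (A x)\<bar> \<le> (norm z)\<^sup>2 / 2"
  proof -
    have "\<bar>inner y (A x)\<bar> \<le> norm y * (\<sigma> * norm x)"
      using Cauchy_Schwarz_ineq2[of y "A x"] bound[of x]
      by (meson mult_left_mono norm_ge_zero order_trans)
    then have "\<eta> * \<bar>inner y (A x)\<bar> \<le> \<eta> * (norm y * (\<sigma> * norm x))"
      using \<eta>(1) by (intro mult_left_mono) auto
    also have "\<dots> = (\<eta> * \<sigma>) * (norm x * norm y)" by simp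
    also have "\<dots> \<le> 1 / 2 * (norm x * norm y)"
      using \<eta>(2) by (intro mult_right_mono) auto
    also have "norm x * norm y \<le> ((norm x)\<^sup>2 + (norm y)\<^sup>2) / 2"
      using sum_squares_bound[of "norm x" "norm y"] by simp
    also have "(norm x)\<^sup>2 + (norm y)\<^sup>2 = (norm z)\<^sup>2" by (simp add: z norm_Pair)
    finally show ?thesis using \<eta>(1) by (simp add: abs_mult)
  qed
  ultimately show "(norm z)\<^sup>2 / 2 \<le> prec_sq z" "prec_sq z \<le> 3 / 2 * (norm z)\<^sup>2" by linarith+
qed

lemma prec_sq_nonneg: "0 \<le> prec_sq z"
  using prec_sq_bounds(1)[of z] by (meson divide_nonneg_nonneg order_trans zero_le_numeral zero_le_power2)

lemma gap_eq_primal: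
  "gap z w = inner (c - At (snd z)) (fst z - fst w) + inner (b - A (fst z)) (snd w - snd z)"
  by (simp add: gap_def inner_diff_left inner_diff_right adj_left adj_right algebra_simps inner_commute)

lemma gap_eq_dual:
  "gap z w = inner (c - At (snd w)) (fst z) + inner b (snd w) - inner c (fst w) - inner (snd z) (b - A (fst w))"
  by (simp add: gap_def inner_diff_left inner_diff_right adj_left adj_right algebra_simps inner_commute)

text \<open>Adding the projection inequality and the definition of the dual update leaves exactly \<open>inner (z' -
z) (prec (w - z'))\<close> on the right-hand side; the three-point identity does the rest.\<close>

lemma step_gap:
  assumes "is_step z z'" "fst w \<in> K"
  shows "2 * \<eta> * gap z' w \<le> prec_sq (w - z) - prec_sq (w - z')"
proof -
  obtain x y where z: "z = (x, y)" by force
  obtain x' y' where z': "z' = (x', y')" by force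
  obtain u v where w: "w = (u, v)" by force
  have proj: "0 \<le> inner (x' - x + \<eta> *\<^sub>R (c - At y)) (u - x')"
    using assms by (auto simp: is_step_def z z' w)
  have y': "y' - y = \<eta> *\<^sub>R (b - A (2 *\<^sub>R x' - x))"
    using assms(1) by (auto simp: is_step_def z z')
  have "inner (y' - y) (v - y') = \<eta> * inner (b - A (2 *\<^sub>R x' - x)) (v - y')"
    unfolding y' by simp
  then have dual: "\<eta> * inner b (v - y') = inner (y' - y) (v - y') + \<eta> * inner (A (2 *\<^sub>R x' - x)) (v - y')"
    by (simp add: inner_diff_left algebra_simps)
  have primal: "\<eta> * inner c (x' - u) \<le> inner (x' - x) (u - x') - \<eta> * inner (A (u - x')) y"
    using proj by (simp add: inner_add_left inner_diff_left inner_diff_right adj_left adj_right A_simps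
        algebra_simps inner_commute)
  have gap: "\<eta> * gap z' w = \<eta> * inner c (x' - u) + \<eta> * inner b (v - y')
      - \<eta> * inner (A x') v + \<eta> * inner (A u) y'"
    by (simp add: gap_def z' w inner_diff_right algebra_simps inner_commute)
  have "\<eta> * gap z' w \<le> inner (z' - z) (prec (w - z'))"
    unfolding gap using primal dual
    by (simp add: z z' w prec_def inner_prod_def inner_add_right adj[symmetric] A_simps inner_diff_left
        inner_diff_right inner_add_left algebra_simps inner_commute)
  moreover have "prec_sq (w - z) = prec_sq (z' - z) + 2 * inner (z' - z) (prec (w - z')) + prec_sq (w - z')"
    using prec_sq_add[of "z' - z" "w - z'"] by simp
  ultimately show ?thesis using prec_sq_nonneg[of "z' - z"] by linarith
qed

context
  fixes z :: "nat \<Rightarrow> 'a \<times> 'b"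
  assumes steps: "\<And>i. is_step (z i) (z (Suc i))"
begin

text \<open>For a fixed comparison point the gap is an affine function, the bilinear terms in \<open>z\<close> having
cancelled.\<close>

lemma gap_sum: "(\<Sum>i=1..t. gap (z i) w) = real t * gap (average z t) w" if "1 \<le> t"
proof -
  let ?V = "(c - At (snd w), A (fst w) - b)"
  have g: "gap v w = inner v ?V + gap 0 w" for v
    by (simp add: gap_def inner_prod_def linear_0[OF lin] adj_right inner_diff_right algebra_simps
        inner_commute)
  have "(\<Sum>i=1..t. gap (z i) w) = (\<Sum>i=1..t. inner (z i) ?V + gap 0 w)"
    by (intro sum.cong refl g)
  also have "\<dots> = real t * (inner (average z t) ?V + gap 0 w)"
    using that by (simp add: average_def sum.distrib inner_sum_left distrib_left)
  finally show ?thesis by (simp only: g[of "average z t"])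
qed

lemma avg_gap:
  assumes "1 \<le> t" "fst w \<in> K"
  shows "2 * \<eta> * real t * gap (average z t) w \<le> prec_sq (w - z 0)"
proof -
  have "(\<Sum>i=1..t. 2 * \<eta> * gap (z i) w) \<le> prec_sq (w - z 0) - prec_sq (w - z t)" for t
  proof (induction t)
    case (Suc t)
    then show ?case using step_gap[OF steps assms(2), of t] by simp
  qed simp
  from this[of t] have "(\<Sum>i=1..t. 2 * \<eta> * gap (z i) w) \<le> prec_sq (w - z 0)"
    using prec_sq_nonneg[of "w - z t"] by linarith
  then show ?thesis using gap_sum[OF assms(1), of w] by (simp flip: sum_distrib_left add: mult.assoc)
qed

lemma fejer:
  assumes "fst w \<in> K" "\<And>i. 0 \<le> gap (z (Suc i)) w"
  shows "prec_sq (z i - w) \<le> prec_sq (z 0 - w)"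
proof (induction i)
  case (Suc i)
  have "0 \<le> 2 * \<eta> * gap (z (Suc i)) w" using assms(2)[of i] \<eta>(1) by simp
  then show ?case using step_gap[OF steps assms(1), of i] Suc
    by (simp add: prec_sq_minus[of _ w])
qed simp

text \<open>Convexity of the quadratic form, applied to the single iterates.\<close>

lemma fejer_avg:
  assumes "1 \<le> t" "fst w \<in> K" "\<And>i. 0 \<le> gap (z (Suc i)) w"
  shows "prec_sq (average z t - w) \<le> prec_sq (z 0 - w)"
proof -
  let ?q = "average z t - w"
  have "real t *\<^sub>R average z t = (\<Sum>i=1..t. z i)" using assms(1) by (simp add: average_def)
  then have zero: "(\<Sum>i=1..t. z i - average z t) = 0" by (simp add: sum_subtractf sum_constant_scaleR)
  have "real t * prec_sq ?q = (\<Sum>i=1..t. prec_sq ?q)" by simp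
  also have "\<dots> \<le> (\<Sum>i=1..t. prec_sq (z i - w) - 2 * inner (z i - average z t) (prec ?q))"
  proof (intro sum_mono)
    fix i
    show "prec_sq ?q \<le> prec_sq (z i - w) - 2 * inner (z i - average z t) (prec ?q)"
      using prec_sq_add[of "z i - average z t" ?q] prec_sq_nonneg[of "z i - average z t"] by simp
  qed
  also have "\<dots> = (\<Sum>i=1..t. prec_sq (z i - w)) - 2 * inner (\<Sum>i=1..t. z i - average z t) (prec ?q)"
    unfolding inner_sum_left sum_distrib_left by (rule sum_subtractf)
  also have "\<dots> \<le> (\<Sum>i=1..t. prec_sq (z 0 - w))"
    unfolding zero using sum_mono[of "{1..t}" "\<lambda>i. prec_sq (z i - w)" "\<lambda>_. prec_sq (z 0 - w)"]
      fejer[OF assms(2,3)] by simp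
  finally show ?thesis using assms(1) by simp
qed

lemma avg_gap_ball:
  assumes "1 \<le> t" "fst w \<in> K" "norm (w - average z t) \<le> r"
  shows "gap (average z t) w \<le> 3 * (norm (average z t - z 0) + r)\<^sup>2 / (4 * \<eta> * real t)"
proof -
  have "norm (w - z 0) \<le> norm (average z t - z 0) + r"
    using norm_triangle_ineq[of "w - average z t" "average z t - z 0"] assms(3) by simp
  then have "(norm (w - z 0))\<^sup>2 \<le> (norm (average z t - z 0) + r)\<^sup>2" by (intro power_mono) auto
  then have "2 * \<eta> * real t * gap (average z t) w \<le> 3 / 2 * (norm (average z t - z 0) + r)\<^sup>2"
    using avg_gap[OF assms(1,2)] prec_sq_bounds(2)[of "w - z 0"] by linarith
  then show ?thesis using \<eta>(1) assms(1) by (simp add: field_simps)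
qed

end

lemma norm_le_of_prec_sq_le:
  assumes "prec_sq z \<le> prec_sq w"
  shows "norm z \<le> 2 * norm w"
proof -
  have "(2 * norm w)\<^sup>2 = 4 * (norm w)\<^sup>2" by (simp add: power_mult_distrib)
  then have "(norm z)\<^sup>2 \<le> (2 * norm w)\<^sup>2"
    using assms prec_sq_bounds(1)[of z] prec_sq_bounds(2)[of w] zero_le_power2[of "norm w"] by linarith
  then show ?thesis by (rule power2_le_imp_le) simp
qed

end

section \<open>Vectors as points of one inner product space\<close>

text \<open>Finitely supported sequences contain the Euclidean spaces of all dimensions, so that vectors whose
dimension is a value become points of one inner product space.\<close>

typedef fvec = "{f :: nat \<Rightarrow> real. finite {i. f i \<noteq> 0}}"
  morphisms coord Abs_fvec
  by (rule exI[of _ "\<lambda>_. 0"]) simp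

setup_lifting type_definition_fvec

lemma finite_coord: "finite {i. coord v i \<noteq> 0}"
  using coord[of v] by simp

lemma fvec_eq_iff: "v = w \<longleftrightarrow> (\<forall>i. coord v i = coord w i)"
  by (auto simp: coord_inject[symmetric])

instantiation fvec :: real_inner
begin

lift_definition zero_fvec :: fvec is "\<lambda>_. 0" by simp

lift_definition plus_fvec :: "fvec \<Rightarrow> fvec \<Rightarrow> fvec" is "\<lambda>f g i. f i + g i"
proof -
  fix f g :: "nat \<Rightarrow> real"
  assume "finite {i. f i \<noteq> 0}" "finite {i. g i \<noteq> 0}"
  then show "finite {i. f i + g i \<noteq> 0}"
    by - (rule finite_subset[of _ "{i. f i \<noteq> 0} \<union> {i. g i \<noteq> 0}"], auto)
qed

lift_definition minus_fvec :: "fvec \<Rightarrow> fvec \<Rightarrow> fvec" is "\<lambda>f g i. f i - g i"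
proof -
  fix f g :: "nat \<Rightarrow> real"
  assume "finite {i. f i \<noteq> 0}" "finite {i. g i \<noteq> 0}"
  then show "finite {i. f i - g i \<noteq> 0}"
    by - (rule finite_subset[of _ "{i. f i \<noteq> 0} \<union> {i. g i \<noteq> 0}"], auto)
qed

lift_definition uminus_fvec :: "fvec \<Rightarrow> fvec" is "\<lambda>f i. - f i" by simp

lift_definition scaleR_fvec :: "real \<Rightarrow> fvec \<Rightarrow> fvec" is "\<lambda>r f i. r * f i"
  by (rule finite_subset[rotated]) auto

definition inner_fvec :: "fvec \<Rightarrow> fvec \<Rightarrow> real" where
  "inner_fvec v w = (\<Sum>i | coord v i \<noteq> 0. coord v i * coord w i)"

definition norm_fvec :: "fvec \<Rightarrow> real" where
  "norm_fvec v = sqrt (inner v v)"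

definition sgn_fvec :: "fvec \<Rightarrow> fvec" where
  "sgn_fvec v = inverse (norm v) *\<^sub>R v"

definition dist_fvec :: "fvec \<Rightarrow> fvec \<Rightarrow> real" where
  "dist_fvec v w = norm (v - w)"

definition uniformity_fvec :: "(fvec \<times> fvec) filter" where
  "uniformity_fvec = (INF e\<in>{0<..}. principal {(v, w). dist v w < e})"

definition open_fvec :: "fvec set \<Rightarrow> bool" where
  "open_fvec U \<longleftrightarrow> (\<forall>v\<in>U. eventually (\<lambda>(v', w). v' = v \<longrightarrow> w \<in> U) uniformity)"

lemma inner_fvec_eq:
  assumes "finite S" "\<And>i. i \<notin> S \<Longrightarrow> coord v i = 0"
  shows "inner v w = (\<Sum>i\<in>S. coord v i * coord w i)"
  unfolding inner_fvec_def using assms by (intro sum.mono_neutral_left) auto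

instance
proof
  fix u v w :: fvec and r s :: real
  show "u + v + w = u + (v + w)" "u + v = v + u" "0 + u = u" "- u + u = 0" "u - v = u + - v"
    "r *\<^sub>R (u + v) = r *\<^sub>R u + r *\<^sub>R v" "(r + s) *\<^sub>R u = r *\<^sub>R u + s *\<^sub>R u"
    "r *\<^sub>R s *\<^sub>R u = (r * s) *\<^sub>R u" "1 *\<^sub>R u = u"
    by (transfer; simp add: fun_eq_iff algebra_simps)+
  let ?S = "{i. coord u i \<noteq> 0} \<union> {i. coord v i \<noteq> 0}"
  have fin: "finite ?S" using finite_coord by simp
  show "inner u v = inner v u"
    using inner_fvec_eq[OF fin, of u v] inner_fvec_eq[OF fin, of v u] by (simp add: mult.commute)
  show "inner (u + v) w = inner u w + inner v w"
    using inner_fvec_eq[OF fin, of u w] inner_fvec_eq[OF fin, of v w] inner_fvec_eq[OF fin, of "u + v" w]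
    by (simp add: plus_fvec.rep_eq algebra_simps sum.distrib)
  show "inner (r *\<^sub>R u) w = r * inner u w"
    using inner_fvec_eq[OF fin, of u w] inner_fvec_eq[OF fin, of "r *\<^sub>R u" w]
    by (simp add: scaleR_fvec.rep_eq sum_distrib_left mult.assoc)
  show "0 \<le> inner u u" by (simp add: inner_fvec_def sum_nonneg)
  show "inner u u = 0 \<longleftrightarrow> u = 0"
    using finite_coord[of u]
    by (auto simp: inner_fvec_def sum_nonneg_eq_0_iff fvec_eq_iff zero_fvec.rep_eq)
qed (simp_all only: norm_fvec_def sgn_fvec_def dist_fvec_def uniformity_fvec_def open_fvec_def)

end

lift_definition emb :: "real vec \<Rightarrow> fvec" is "\<lambda>v i. if i < dim_vec v then v $ i else 0"
  by (rule finite_subset[of _ "{..<dim_vec _}"]) auto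

lemma emb_add: "dim_vec v = dim_vec w \<Longrightarrow> emb (v + w) = emb v + emb w"
  and emb_diff: "dim_vec v = dim_vec w \<Longrightarrow> emb (v - w) = emb v - emb w"
  and emb_smult: "emb (r \<cdot>\<^sub>v v) = r *\<^sub>R emb v"
  and emb_zero: "emb (0\<^sub>v n) = 0"
  by (transfer; simp add: fun_eq_iff)+

lemma inner_emb: "inner (emb v) f = (\<Sum>i<dim_vec v. v $ i * coord f i)"
  by (subst inner_fvec_eq[of "{..<dim_vec v}"]) (auto simp: emb.rep_eq)

lemma inner_emb_emb: "dim_vec v = dim_vec w \<Longrightarrow> inner (emb v) (emb w) = (\<Sum>i<dim_vec v. v $ i * w $ i)"
  by (simp add: inner_emb emb.rep_eq)

lemma inner_emb_scalar_prod: "dim_vec v = dim_vec w \<Longrightarrow> inner (emb v) (emb w) = scalar_prod v w"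
  by (simp add: inner_emb_emb scalar_prod_def atLeast0LessThan)

lemma norm_emb: "norm (emb v) = vec_norm2 v"
  by (simp add: norm_eq_sqrt_inner inner_emb_scalar_prod vec_norm2_def)

lemma norm_emb_L2: "norm (emb v) = L2_set (\<lambda>i. v $ i) {..<dim_vec v}"
  by (simp add: norm_eq_sqrt_inner inner_emb_emb L2_set_def power2_eq_square)

text \<open>Since operators are to act on the whole space, a matrix is applied to the leading coordinates
only.\<close>

definition trunc :: "nat \<Rightarrow> fvec \<Rightarrow> real vec" where
  "trunc n f = vec n (coord f)"

lemma norm_trunc: "norm (emb (trunc n f)) \<le> norm f"
proof -
  have "inner (emb (trunc n f)) (emb (trunc n f)) = inner (emb (trunc n f)) f"
    by (simp add: inner_emb trunc_def emb.rep_eq)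
  then have "norm (emb (trunc n f)) ^ 2 \<le> norm (emb (trunc n f)) * norm f"
    using norm_cauchy_schwarz[of "emb (trunc n f)" f] by (simp add: power2_norm_eq_inner)
  then show ?thesis
    by (cases "norm (emb (trunc n f)) = 0") (auto simp: power2_eq_square)
qed

lemma trunc_emb: "v \<in> carrier_vec n \<Longrightarrow> trunc n (emb v) = v"
  by (auto simp: trunc_def emb.rep_eq)

definition mat_op :: "real mat \<Rightarrow> fvec \<Rightarrow> fvec" where
  "mat_op A f = emb (A *\<^sub>v trunc (dim_col A) f)"

lemma coord_mat_op:
  "coord (mat_op A f) i = (if i < dim_row A then \<Sum>j<dim_col A. A $$ (i, j) * coord f j else 0)"
  by (simp add: mat_op_def emb.rep_eq trunc_def scalar_prod_def atLeast0LessThan)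

lemma mat_op_emb: "v \<in> carrier_vec (dim_col A) \<Longrightarrow> mat_op A (emb v) = emb (A *\<^sub>v v)"
  by (simp add: mat_op_def trunc_emb)

lemma linear_mat_op: "linear (mat_op A)"
  by (rule linearI)
    (auto simp: fvec_eq_iff coord_mat_op plus_fvec.rep_eq scaleR_fvec.rep_eq distrib_left sum.distrib
      sum_distrib_left mult.left_commute)

lemma mat_op_adjoint: "inner (mat_op A f) g = inner f (mat_op A\<^sup>T g)"
proof -
  have "inner (mat_op A f) g = (\<Sum>i<dim_row A. (\<Sum>j<dim_col A. A $$ (i, j) * coord f j) * coord g i)"
    unfolding mat_op_def by (simp add: inner_emb trunc_def scalar_prod_def atLeast0LessThan)
  also have "\<dots> = (\<Sum>j<dim_col A. (\<Sum>i<dim_row A. A $$ (i, j) * coord g i) * coord f j)"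
    unfolding sum_distrib_right by (subst sum.swap) (simp add: mult_ac)
  also have "\<dots> = inner (mat_op A\<^sup>T g) f"
    unfolding mat_op_def by (simp add: inner_emb trunc_def scalar_prod_def atLeast0LessThan)
  finally show ?thesis by (simp add: inner_commute)
qed

lemma vec_norm2_smult: "vec_norm2 (r \<cdot>\<^sub>v v) = \<bar>r\<bar> * vec_norm2 v"
  unfolding norm_emb[symmetric] emb_smult by simp

lemma vec_norm2_L2: "vec_norm2 v = L2_set (\<lambda>i. v $ i) {..<dim_vec v}"
  using norm_emb norm_emb_L2 by metis

lemma frobenius_bound:
  assumes v: "v \<in> carrier_vec (dim_col A)"
  shows "vec_norm2 (A *\<^sub>v v) \<le> sqrt (\<Sum>i<dim_row A. \<Sum>j<dim_col A. (A $$ (i, j))\<^sup>2) * vec_norm2 v"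
proof -
  let ?n = "L2_set (\<lambda>j. v $ j) {..<dim_col A}"
  \<comment> \<open>Cauchy-Schwarz in each row\<close>
  have row: "((A *\<^sub>v v) $ i)\<^sup>2 \<le> (\<Sum>j<dim_col A. (A $$ (i, j))\<^sup>2) * ?n\<^sup>2" if i: "i < dim_row A" for i
  proof -
    have "\<bar>(A *\<^sub>v v) $ i\<bar> = \<bar>\<Sum>j<dim_col A. A $$ (i, j) * v $ j\<bar>"
      using i v by (simp add: scalar_prod_def atLeast0LessThan)
    also have "\<dots> \<le> (\<Sum>j<dim_col A. \<bar>A $$ (i, j)\<bar> * \<bar>v $ j\<bar>)"
      using sum_abs[of "\<lambda>j. A $$ (i, j) * v $ j"] by (simp add: abs_mult)
    also have "\<dots> \<le> L2_set (\<lambda>j. A $$ (i, j)) {..<dim_col A} * ?n" by (rule L2_set_mult_ineq)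
    finally have "\<bar>(A *\<^sub>v v) $ i\<bar>\<^sup>2 \<le> (L2_set (\<lambda>j. A $$ (i, j)) {..<dim_col A} * ?n)\<^sup>2"
      by (intro power_mono) auto
    then show ?thesis by (simp add: power_mult_distrib L2_set_def sum_nonneg)
  qed
  have "(\<Sum>i<dim_row A. ((A *\<^sub>v v) $ i)\<^sup>2) \<le> (\<Sum>i<dim_row A. \<Sum>j<dim_col A. (A $$ (i, j))\<^sup>2) * ?n\<^sup>2"
    unfolding sum_distrib_right by (intro sum_mono) (use row in \<open>simp add: sum_distrib_right\<close>)
  then have "sqrt (\<Sum>i<dim_row A. ((A *\<^sub>v v) $ i)\<^sup>2)
      \<le> sqrt ((\<Sum>i<dim_row A. \<Sum>j<dim_col A. (A $$ (i, j))\<^sup>2) * ?n\<^sup>2)"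
    by (rule real_sqrt_le_mono)
  then show ?thesis using v unfolding vec_norm2_L2 by (simp add: L2_set_def real_sqrt_mult sum_nonneg)
qed

text \<open>The entries are \<open>0\<close> or \<open>1\<close> up to sign, so the squared Frobenius norm counts the nonzero entries.
The Frobenius bound also shows that the supremum defining the spectral norm is taken over a
bounded set.\<close>

lemma spectral_norm_bounds:
  assumes tu: "totally_unimodular A"
  shows "spectral_norm A \<le> sqrt (real (nnz A))"
    and "v \<in> carrier_vec (dim_col A) \<Longrightarrow> vec_norm2 (A *\<^sub>v v) \<le> spectral_norm A * vec_norm2 v"
    and "\<lbrakk>i < dim_row A; j < dim_col A; A $$ (i, j) \<noteq> 0\<rbrakk> \<Longrightarrow> 1 \<le> spectral_norm A"
proof -
  let ?V = "{v \<in> carrier_vec (dim_col A). vec_norm2 v \<le> 1}"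
  note tu' = tu_on_entry[OF totally_unimodular_imp_tu_on[OF tu]]
  have "(\<Sum>i<dim_row A. \<Sum>j<dim_col A. (A $$ (i, j))\<^sup>2)
      = (\<Sum>i<dim_row A. \<Sum>j<dim_col A. if A $$ (i, j) \<noteq> 0 then 1 else 0)"
    using tu' by (intro sum.cong refl) fastforce
  also have "\<dots> = (\<Sum>p\<in>{..<dim_row A} \<times> {..<dim_col A}. if A $$ p \<noteq> 0 then 1 else 0)"
    by (simp add: sum.cartesian_product case_prod_beta)
  also have "\<dots> = real (card {p \<in> {..<dim_row A} \<times> {..<dim_col A}. A $$ p \<noteq> 0})"
    by (simp add: sum.If_cases Int_def)
  also have "{p \<in> {..<dim_row A} \<times> {..<dim_col A}. A $$ p \<noteq> 0}
      = {(i, j). i < dim_row A \<and> j < dim_col A \<and> A $$ (i, j) \<noteq> 0}" by auto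
  finally have F: "(\<Sum>i<dim_row A. \<Sum>j<dim_col A. (A $$ (i, j))\<^sup>2) = real (nnz A)"
    by (simp add: nnz_def)
  have V: "vec_norm2 (A *\<^sub>v v) \<le> sqrt (real (nnz A))" if "v \<in> ?V" for v
    using frobenius_bound[of v A] that mult_left_le[of "vec_norm2 v" "sqrt (real (nnz A))"] F
    by fastforce
  have zero: "0\<^sub>v (dim_col A) \<in> ?V" by (simp add: vec_norm2_def)
  show "spectral_norm A \<le> sqrt (real (nnz A))"
    unfolding spectral_norm_def using zero V by (intro cSUP_least) blast+
  have sup: "vec_norm2 (A *\<^sub>v v) \<le> spectral_norm A" if "v \<in> ?V" for v
    unfolding spectral_norm_def using V that by (intro cSUP_upper bdd_aboveI2) auto
  show "vec_norm2 (A *\<^sub>v v) \<le> spectral_norm A * vec_norm2 v" if v: "v \<in> carrier_vec (dim_col A)" for v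
  proof (cases "vec_norm2 v = 0")
    case True
    then show ?thesis using frobenius_bound[OF v] by simp
  next
    case False
    then have pos: "0 < vec_norm2 v"
      using norm_ge_zero[of "emb v"] by (simp add: norm_emb)
    have "(1 / vec_norm2 v) \<cdot>\<^sub>v v \<in> ?V" using v pos by (simp add: vec_norm2_smult)
    from sup[OF this] have "vec_norm2 ((1 / vec_norm2 v) \<cdot>\<^sub>v (A *\<^sub>v v)) \<le> spectral_norm A"
      using v by (simp add: mult_mat_vec[of A "dim_row A" "dim_col A"])
    then show ?thesis using pos by (simp add: vec_norm2_smult field_simps)
  qed
  show "1 \<le> spectral_norm A" if ij: "i < dim_row A" "j < dim_col A" "A $$ (i, j) \<noteq> 0"
  proof -
    let ?e = "unit_vec (dim_col A) j :: real vec"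
    have "vec_norm2 ?e = 1" using ij by (simp add: vec_norm2_def)
    then have "vec_norm2 (A *\<^sub>v ?e) \<le> spectral_norm A" by (intro sup) simp
    moreover have "\<bar>(A *\<^sub>v ?e) $ i\<bar> \<le> vec_norm2 (A *\<^sub>v ?e)"
      using member_le_L2_set[of "{..<dim_row A}" i "\<lambda>i. \<bar>(A *\<^sub>v ?e) $ i\<bar>"] ij(1)
      by (simp add: vec_norm2_L2 L2_set_def)
    moreover have "(A *\<^sub>v ?e) $ i = A $$ (i, j)" using ij by simp
    moreover have "\<bar>A $$ (i, j)\<bar> = 1" using tu'[of i j] ij by auto
    ultimately show ?thesis by simp
  qed
qed

section \<open>Instantiation for a totally unimodular linear program\<close>

lemma L2_set_sparse_bound:
  assumes "finite S" "\<And>i. i \<in> S \<Longrightarrow> \<bar>f i\<bar> \<le> B" "card {i \<in> S. f i \<noteq> 0} \<le> k" "0 \<le> B"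
  shows "L2_set f S \<le> sqrt (real k) * B"
proof -
  have "(\<Sum>i\<in>S. (f i)\<^sup>2) = (\<Sum>i\<in>{i \<in> S. f i \<noteq> 0}. (f i)\<^sup>2)"
    using assms(1) by (intro sum.mono_neutral_right) auto
  also have "\<dots> \<le> (\<Sum>i\<in>{i \<in> S. f i \<noteq> 0}. B\<^sup>2)"
    using assms(2) by (intro sum_mono) (simp add: abs_le_square_iff[symmetric] assms(4))
  also have "\<dots> \<le> real k * B\<^sup>2" using assms(3) by (simp add: mult_right_mono)
  finally have "L2_set f S \<le> sqrt (real k * B\<^sup>2)" unfolding L2_set_def by (rule real_sqrt_le_mono)
  then show ?thesis using assms(4) by (simp add: real_sqrt_mult)
qed

lemma coord_sum: "coord (\<Sum>i\<in>S. f i) j = (\<Sum>i\<in>S. coord (f i) j)"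
  by (induction S rule: infinite_finite_induct) (simp_all add: zero_fvec.rep_eq plus_fvec.rep_eq)

definition embz :: "pd_point \<Rightarrow> fvec \<times> fvec" where
  "embz z = (emb (fst z), emb (snd z))"

text \<open>With \<open>H \<ge> 1\<close> all the quantities in the estimates are at least \<open>1\<close>; a smaller \<open>H\<close> leaves only \<open>b =
c = 0\<close> by integrality.\<close>

locale tu_lp =
  fixes m1 m2 :: nat and A :: "real mat" and b c :: "real vec" and H \<eta> :: real
  assumes m1_pos: "0 < m1" and A_carrier: "A \<in> carrier_mat m1 m2" and A_nonzero: "A \<noteq> 0\<^sub>m m1 m2"
    and b_carrier: "b \<in> carrier_vec m1" and c_carrier: "c \<in> carrier_vec m2"
    and b_bound: "\<And>i. i < m1 \<Longrightarrow> \<bar>b $ i\<bar> \<le> H" and c_bound: "\<And>j. j < m2 \<Longrightarrow> \<bar>c $ j\<bar> \<le> H"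
    and tu_lp: "totally_unimodular_lp A b c" and solvable: "primal_optimal A b c \<noteq> {}"
    and eta_lower: "1 / (4 * spectral_norm A) \<le> \<eta>" and eta_upper: "\<eta> \<le> 1 / (2 * spectral_norm A)"
    and H_ge_1: "1 \<le> H"
begin

lemma dims: "dim_row A = m1" "dim_col A = m2" "dim_vec b = m1" "dim_vec c = m2"
  using A_carrier b_carrier c_carrier by auto

lemma totally_unimodular_A: "totally_unimodular A"
  and integral_b: "i < m1 \<Longrightarrow> b $ i \<in> \<int>" and integral_c: "j < m2 \<Longrightarrow> c $ j \<in> \<int>"
  using tu_lp dims by (auto simp: totally_unimodular_lp_def)

lemma sigma_ge_1: "1 \<le> spectral_norm A"
proof -
  have "\<exists>i<m1. \<exists>j<m2. A $$ (i, j) \<noteq> 0"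
    using A_nonzero A_carrier by (metis carrier_matD eq_matI index_zero_mat)
  then show ?thesis using spectral_norm_bounds(3)[OF totally_unimodular_A] dims by blast
qed

lemma eta_pos: "0 < \<eta>" and eta_sigma: "\<eta> * spectral_norm A \<le> 1 / 2"
  and inverse_eta: "1 / \<eta> \<le> 4 * spectral_norm A"
proof -
  have "0 < 1 / (4 * spectral_norm A)" using sigma_ge_1 by simp
  then show "0 < \<eta>" using eta_lower by linarith
  then show "1 / \<eta> \<le> 4 * spectral_norm A" using eta_lower sigma_ge_1 by (simp add: field_simps)
  show "\<eta> * spectral_norm A \<le> 1 / 2" using eta_upper sigma_ge_1 by (simp add: field_simps)
qed

sublocale S: tu_system m1 m2 "\<lambda>i j. A $$ (i, j)" "\<lambda>i. b $ i" "\<lambda>j. c $ j"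
  using totally_unimodular_imp_tu_on[OF totally_unimodular_A] by unfold_locales (simp add: dims)

definition nonneg_cone :: "fvec set" where
  "nonneg_cone = emb ` {x \<in> carrier_vec m2. \<forall>j<m2. 0 \<le> x $ j}"

sublocale D: pdhg "mat_op A" "mat_op A\<^sup>T" "emb c" "emb b" nonneg_cone \<eta> "spectral_norm A"
proof (rule pdhg.intro)
  show "linear (mat_op A)" "linear (mat_op A\<^sup>T)" by (rule linear_mat_op)+
  show "inner (mat_op A x) y = inner x (mat_op A\<^sup>T y)" for x y by (rule mat_op_adjoint)
  show "norm (mat_op A x) \<le> spectral_norm A * norm x" for x
  proof -
    have "norm (mat_op A x) \<le> spectral_norm A * vec_norm2 (trunc (dim_col A) x)"
      unfolding mat_op_def norm_emb
      by (rule spectral_norm_bounds(2)[OF totally_unimodular_A]) (simp add: trunc_def)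
    also have "\<dots> \<le> spectral_norm A * norm x"
      using norm_trunc sigma_ge_1 by (intro mult_left_mono) (auto simp flip: norm_emb)
    finally show ?thesis .
  qed
qed (rule eta_pos eta_sigma)+

lemma domain_iff: "z \<in> pd_domain A \<longleftrightarrow>
    fst z \<in> carrier_vec m2 \<and> (\<forall>j<m2. 0 \<le> fst z $ j) \<and> snd z \<in> carrier_vec m1"
  by (cases z) (auto simp: pd_domain_def dims less_eq_vec_def)

lemma domain_dims:
  assumes "z \<in> pd_domain A"
  shows "dim_vec (fst z) = m2" "dim_vec (snd z) = m1"
  using assms by (auto simp: domain_iff)

lemma domain_nonneg_cone: "z \<in> pd_domain A \<Longrightarrow> fst (embz z) \<in> nonneg_cone"
  by (auto simp: domain_iff embz_def nonneg_cone_def)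

lemma pd_dist_embz:
  assumes "z \<in> pd_domain A" "w \<in> pd_domain A"
  shows "pd_dist z w = norm (embz z - embz w)"
proof -
  have "embz z - embz w = (emb (fst z - fst w), emb (snd z - snd w))"
    using domain_dims[OF assms(1)] domain_dims[OF assms(2)] by (simp add: embz_def emb_diff)
  then show ?thesis by (simp add: pd_dist_def norm_Pair norm_emb)
qed

lemma mat_op_emb': "x \<in> carrier_vec m2 \<Longrightarrow> mat_op A (emb x) = emb (A *\<^sub>v x)"
  "y \<in> carrier_vec m1 \<Longrightarrow> mat_op A\<^sup>T (emb y) = emb (A\<^sup>T *\<^sub>v y)"
  by (simp_all add: mat_op_emb dims)

lemma lagrangian_gap:
  assumes "z \<in> pd_domain A" "w \<in> pd_domain A"
  shows "lagrangian A b c (fst z) (snd w) - lagrangian A b c (fst w) (snd z) = D.gap (embz z) (embz w)"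
proof -
  note dz = domain_dims[OF assms(1)] and dw = domain_dims[OF assms(2)]
  have "inner (emb c) (emb (fst z)) = scalar_prod c (fst z)"
    "inner (emb c) (emb (fst w)) = scalar_prod c (fst w)"
    "inner (emb b) (emb (snd z)) = scalar_prod b (snd z)"
    "inner (emb b) (emb (snd w)) = scalar_prod b (snd w)"
    by (rule inner_emb_scalar_prod, simp only: dims dz dw)+
  moreover have "inner (emb (snd w)) (mat_op A (emb (fst z))) = scalar_prod (snd w) (A *\<^sub>v fst z)"
    "inner (emb (snd z)) (mat_op A (emb (fst w))) = scalar_prod (snd z) (A *\<^sub>v fst w)"
    using assms by (simp_all add: domain_iff mat_op_emb' inner_emb_scalar_prod dims dz dw)
  ultimately show ?thesis unfolding lagrangian_def D.gap_def embz_def by simp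
qed

lemma slack_emb:
  assumes "y \<in> carrier_vec m1"
  shows "emb c - mat_op A\<^sup>T (emb y) = emb (vec m2 (S.slack (\<lambda>i. y $ i)))"
  using assms by (auto simp: fvec_eq_iff minus_fvec.rep_eq coord_mat_op emb.rep_eq dims S.slack_def)

lemma residual_emb:
  assumes "x \<in> carrier_vec m2"
  shows "emb b - mat_op A (emb x) = emb (vec m1 (\<lambda>i. b $ i - (\<Sum>j<m2. A $$ (i, j) * x $ j)))"
  using assms by (auto simp: fvec_eq_iff minus_fvec.rep_eq coord_mat_op emb.rep_eq dims)

lemma pdhg_step_is_step:
  assumes z: "z \<in> pd_domain A"
  shows "pdhg_step A b c \<eta> z \<in> pd_domain A" "D.is_step (embz z) (embz (pdhg_step A b c \<eta> z))"
proof -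
  obtain x y where zxy: "z = (x, y)" by force
  have x: "x \<in> carrier_vec m2" and y: "y \<in> carrier_vec m1" using z by (auto simp: domain_iff zxy)
  define p where "p = x - \<eta> \<cdot>\<^sub>v (c - A\<^sup>T *\<^sub>v y)"
  define x' where "x' = map_vec (\<lambda>s. max s 0) p"
  define y' where "y' = y + \<eta> \<cdot>\<^sub>v (b - A *\<^sub>v (2 \<cdot>\<^sub>v x' - x))"
  have step: "pdhg_step A b c \<eta> z = (x', y')"
    by (simp add: pdhg_step_def zxy x'_def y'_def p_def Let_def)
  have p: "p \<in> carrier_vec m2" using x y A_carrier c_carrier by (simp add: p_def)
  then have x': "x' \<in> carrier_vec m2" by (simp add: x'_def)
  have y': "y' \<in> carrier_vec m1" using x x' y A_carrier b_carrier by (simp add: y'_def)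
  have "\<forall>j<m2. 0 \<le> x' $ j" using p by (simp add: x'_def)
  then show dom: "pdhg_step A b c \<eta> z \<in> pd_domain A"
    using x' y' by (simp add: domain_iff step)
  have ep: "emb x' - emb x + \<eta> *\<^sub>R (emb c - mat_op A\<^sup>T (emb y)) = emb (x' - p)"
  proof -
    have "emb p = emb x - \<eta> *\<^sub>R (emb c - mat_op A\<^sup>T (emb y))"
      using x y unfolding p_def by (simp add: emb_diff emb_smult mat_op_emb' dims)
    then show ?thesis using x' p by (simp add: emb_diff)
  qed
  have "0 \<le> inner (emb x' - emb x + \<eta> *\<^sub>R (emb c - mat_op A\<^sup>T (emb y))) (u - emb x')" if "u \<in> nonneg_cone" for u
  proof -
    obtain v where v: "u = emb v" "v \<in> carrier_vec m2" "\<forall>j<m2. 0 \<le> v $ j" using \<open>u \<in> nonneg_cone\<close> by (auto simp: nonneg_cone_def)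
    have "inner (emb (x' - p)) (u - emb x') = (\<Sum>j<m2. (x' - p) $ j * (v - x') $ j)"
      unfolding v(1) using v x' p by (subst emb_diff[symmetric]) (simp_all add: inner_emb_emb)
    also have "\<dots> \<ge> 0"
      using v p by (intro sum_nonneg) (auto simp: x'_def max_def mult_nonneg_nonneg mult_nonpos_nonneg)
    finally show ?thesis unfolding ep .
  qed
  moreover have "emb y' = emb y + \<eta> *\<^sub>R (emb b - mat_op A (2 *\<^sub>R emb x' - emb x))"
  proof -
    have "2 *\<^sub>R emb x' - emb x = emb (2 \<cdot>\<^sub>v x' - x)" using x x' by (simp add: emb_diff emb_smult)
    then have "mat_op A (2 *\<^sub>R emb x' - emb x) = emb (A *\<^sub>v (2 \<cdot>\<^sub>v x' - x))"
      using x x' by (simp add: mat_op_emb' dims)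
    then show ?thesis using y unfolding y'_def by (simp add: emb_add emb_smult emb_diff dims)
  qed
  moreover have "emb x' \<in> nonneg_cone" using domain_nonneg_cone[OF dom] by (simp add: embz_def step)
  ultimately show "D.is_step (embz z) (embz (pdhg_step A b c \<eta> z))"
    unfolding D.is_step_def step by (simp add: embz_def zxy)
qed

lemma iterates:
  assumes z: "z \<in> pd_domain A"
  shows "pdhg_iterate A b c \<eta> z i \<in> pd_domain A"
    "D.is_step (embz (pdhg_iterate A b c \<eta> z i)) (embz (pdhg_iterate A b c \<eta> z (Suc i)))"
proof -
  show dom: "pdhg_iterate A b c \<eta> z i \<in> pd_domain A"
    by (induction i) (simp_all add: pdhg_iterate_def z pdhg_step_is_step)
  show "D.is_step (embz (pdhg_iterate A b c \<eta> z i)) (embz (pdhg_iterate A b c \<eta> z (Suc i)))"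
    using pdhg_step_is_step(2)[OF dom] by (simp add: pdhg_iterate_def)
qed

lemma average_embz:
  assumes z: "z \<in> pd_domain A"
  shows "pdhg_average A b c \<eta> z t \<in> pd_domain A"
    "embz (pdhg_average A b c \<eta> z t) = average (\<lambda>i. embz (pdhg_iterate A b c \<eta> z i)) t"
proof -
  note dom = iterates(1)[OF z, unfolded domain_iff]
  show "pdhg_average A b c \<eta> z t \<in> pd_domain A"
    using dom by (auto simp: domain_iff pdhg_average_def dims intro!: divide_nonneg_nonneg sum_nonneg)
  show "embz (pdhg_average A b c \<eta> z t) = average (\<lambda>i. embz (pdhg_iterate A b c \<eta> z i)) t"
    using domain_dims[OF iterates(1)[OF z]]
    by (auto simp: embz_def average_def pdhg_average_def prod_eq_iff fst_sum snd_sum fvec_eq_iff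
        coord_sum scaleR_fvec.rep_eq emb.rep_eq dims)
qed

text \<open>Feasible pairs with equal objective values: by weak duality optimal, and by the gap inequality
below saddle points of the Lagrangian.\<close>

definition saddle :: "pd_point \<Rightarrow> bool" where
  "saddle w \<longleftrightarrow> fst w \<in> carrier_vec m2 \<and> snd w \<in> carrier_vec m1 \<and>
     S.primal_sol (\<lambda>j. fst w $ j) \<and> S.dual_sol (\<lambda>i. snd w $ i) \<and>
     (\<Sum>j<m2. c $ j * fst w $ j) = (\<Sum>i<m1. b $ i * snd w $ i)"

lemma weak_duality:
  assumes "S.primal_sol x" "S.dual_sol y"
  shows "(\<Sum>i<m1. b $ i * y i) \<le> (\<Sum>j<m2. c $ j * x j)"
proof -
  have "0 \<le> (\<Sum>j<m2. S.slack y j * x j)"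
    using assms by (auto simp: S.primal_sol_def S.dual_sol_def intro!: sum_nonneg)
  then show ?thesis using S.lagrange_identity[of x y] assms(1) by (simp add: S.primal_sol_def)
qed

lemma complementary_value:
  assumes "S.primal_sol x" "S.complementary x y"
  shows "(\<Sum>j<m2. c $ j * x j) = (\<Sum>i<m1. b $ i * y i)"
proof -
  have "(\<Sum>j<m2. S.slack y j * x j) = 0"
    using assms(2) by (intro sum.neutral) (auto simp: S.complementary_def)
  then show ?thesis using S.lagrange_identity[of x y] assms(1) by (simp add: S.primal_sol_def)
qed

lemma primal_feasible_iff: "x \<in> primal_feasible A b \<longleftrightarrow> x \<in> carrier_vec m2 \<and> S.primal_sol (\<lambda>j. x $ j)"
proof -
  have "A *\<^sub>v x = b \<longleftrightarrow> (\<forall>i<m1. (\<Sum>j<m2. A $$ (i, j) * x $ j) = b $ i)" if "x \<in> carrier_vec m2"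
    using that by (auto simp: vec_eq_iff dims scalar_prod_def atLeast0LessThan)
  moreover have "0\<^sub>v m2 \<le> x \<longleftrightarrow> (\<forall>j<m2. 0 \<le> x $ j)" if "x \<in> carrier_vec m2"
    using that by (simp add: less_eq_vec_def)
  ultimately show ?thesis
    unfolding primal_feasible_def S.primal_sol_def dims by blast
qed

lemma dual_feasible_iff: "y \<in> dual_feasible A c \<longleftrightarrow> y \<in> carrier_vec m1 \<and> S.dual_sol (\<lambda>i. y $ i)"
  by (auto simp: dual_feasible_def S.dual_sol_def S.slack_def dims less_eq_vec_def scalar_prod_def atLeast0LessThan)

lemma scalar_prod_sum:
  "x \<in> carrier_vec m2 \<Longrightarrow> scalar_prod c x = (\<Sum>j<m2. c $ j * x $ j)"
  "y \<in> carrier_vec m1 \<Longrightarrow> scalar_prod b y = (\<Sum>i<m1. b $ i * y $ i)"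
  by (auto simp: scalar_prod_def atLeast0LessThan)

lemma saddle_optimal:
  assumes "saddle w"
  shows "w \<in> pd_optimal A b c"
proof -
  obtain x y where w: "w = (x, y)" by force
  have *: "x \<in> carrier_vec m2" "y \<in> carrier_vec m1" "S.primal_sol (\<lambda>j. x $ j)" "S.dual_sol (\<lambda>i. y $ i)"
      "(\<Sum>j<m2. c $ j * x $ j) = (\<Sum>i<m1. b $ i * y $ i)"
    using assms by (auto simp: saddle_def w)
  have "x \<in> primal_optimal A b c"
    using * weak_duality by (auto simp: primal_optimal_def primal_feasible_iff scalar_prod_sum)
  moreover have "y \<in> dual_optimal A b c"
    using * weak_duality[OF *(3)] by (auto simp: dual_optimal_def dual_feasible_iff scalar_prod_sum)
  ultimately show ?thesis by (simp add: pd_optimal_def w)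
qed

lemma saddle_domain: "saddle w \<Longrightarrow> w \<in> pd_domain A"
  by (auto simp: saddle_def domain_iff S.primal_sol_def)

lemma saddle_gap:
  assumes w: "saddle w" and z: "z \<in> pd_domain A"
  shows "0 \<le> D.gap (embz z) (embz w)"
proof -
  have cw: "fst w \<in> carrier_vec m2" "snd w \<in> carrier_vec m1" using w by (auto simp: saddle_def)
  have cz: "fst z \<in> carrier_vec m2" "\<forall>j<m2. 0 \<le> fst z $ j" using z by (auto simp: domain_iff)
  have "emb (vec m1 (\<lambda>i. b $ i - (\<Sum>j<m2. A $$ (i, j) * fst w $ j))) = 0"
    using w by (auto simp: saddle_def S.primal_sol_def fvec_eq_iff emb.rep_eq zero_fvec.rep_eq)
  moreover have "0 \<le> inner (emb (vec m2 (S.slack (\<lambda>i. snd w $ i)))) (emb (fst z))"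
    using w cz by (auto simp: inner_emb_emb saddle_def S.dual_sol_def intro!: sum_nonneg)
  moreover have "inner (emb b) (emb (snd w)) = inner (emb c) (emb (fst w))"
    using w cw by (simp add: inner_emb_emb saddle_def dims)
  ultimately show ?thesis
    unfolding D.gap_eq_dual embz_def fst_conv snd_conv slack_emb[OF cw(2)] residual_emb[OF cw(1)] by simp
qed

text \<open>The norm bound \<open>m\<^sub>1\<^bsup>1.5\<^esup> H\<close> for basic solutions: at most \<open>m1\<close> nonzero coordinates, each of them a
signed sum of at most \<open>m1\<close> entries of \<open>b\<close> or \<open>c\<close>.\<close>

definition R :: real where "R = sqrt (real m1) * (real m1 * H)"

lemma R_bounds: "sqrt (real m1) \<le> R" "1 \<le> R"
proof -
  have "1 \<le> real m1 * H" using m1_pos H_ge_1 mult_mono[of 1 "real m1" 1 H] by simp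
  then show "sqrt (real m1) \<le> R" unfolding R_def using mult_left_mono[of 1 "real m1 * H" "sqrt (real m1)"] by simp
  moreover have "1 \<le> sqrt (real m1)" using m1_pos by simp
  ultimately show "1 \<le> R" by linarith
qed

lemma integral_optimal_pair:
  "\<exists>xs ys. S.primal_sol xs \<and> S.dual_sol ys \<and> S.complementary xs ys \<and>
     (\<forall>j<m2. xs j \<in> \<int>) \<and> (\<forall>i<m1. ys i \<in> \<int>) \<and> L2_set xs {..<m2} \<le> R \<and> L2_set ys {..<m1} \<le> R"
proof -
  obtain x where x: "x \<in> primal_optimal A b c" using solvable by blast
  then have px: "S.primal_sol (\<lambda>j. x $ j)" and cx: "x \<in> carrier_vec m2"
    by (auto simp: primal_optimal_def primal_feasible_iff)
  have opt: "(\<Sum>j<m2. c $ j * x $ j) \<le> (\<Sum>j<m2. c $ j * x' j)" if "S.primal_sol x'" for x'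
  proof -
    have "vec m2 x' \<in> primal_feasible A b"
      using that by (simp add: primal_feasible_iff S.primal_sol_def)
    then have "scalar_prod c x \<le> scalar_prod c (vec m2 x')" using x by (simp add: primal_optimal_def)
    then show ?thesis using cx by (simp add: scalar_prod_sum)
  qed
  obtain y where y: "S.dual_sol y" "S.complementary (\<lambda>j. x $ j) y"
    using S.dual_certificate[OF px opt] by blast
  obtain xs where xs: "S.primal_sol xs" "\<forall>j. x $ j = 0 \<longrightarrow> xs j = 0"
      "\<forall>j<m2. xs j \<in> \<int> \<and> \<bar>xs j\<bar> \<le> (\<Sum>i<m1. \<bar>b $ i\<bar>)" "card {j \<in> {..<m2}. xs j \<noteq> 0} \<le> m1"
    using S.integral_primal_sol[OF px integral_b] by blast
  obtain ys where ys: "S.dual_sol ys" "\<forall>j<m2. S.slack y j = 0 \<longrightarrow> S.slack ys j = 0"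
      "\<forall>i<m1. ys i \<in> \<int> \<and> \<bar>ys i\<bar> \<le> real m1 * H"
    using S.integral_dual_sol[OF y(1) integral_c c_bound] H_ge_1 by auto
  have H0: "0 \<le> real m1 * H" using H_ge_1 by simp
  have "(\<Sum>i<m1. \<bar>b $ i\<bar>) \<le> real m1 * H"
    using sum_bounded_above[of "{..<m1}" "\<lambda>i. \<bar>b $ i\<bar>" H] b_bound by simp
  then have "\<bar>xs j\<bar> \<le> real m1 * H" if "j < m2" for j using xs(3) that by force
  then have "L2_set xs {..<m2} \<le> R"
    unfolding R_def using xs(4) H0 by (intro L2_set_sparse_bound) auto
  moreover have "card {i \<in> {..<m1}. ys i \<noteq> 0} \<le> m1"
    using card_mono[of "{..<m1}" "{i \<in> {..<m1}. ys i \<noteq> 0}"] by auto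
  then have "L2_set ys {..<m1} \<le> R"
    unfolding R_def using ys(3) H0 by (intro L2_set_sparse_bound) auto
  moreover have "S.complementary xs ys"
    using y(2) xs(2) ys(2) by (auto simp: S.complementary_def)
  ultimately show ?thesis using xs ys by blast
qed

end

section \<open>Sharpness of the normalized duality gap\<close>

context tu_lp
begin

lemma gap_pos_D:
  assumes z: "z \<in> pd_domain A" and w: "w \<in> pd_domain A" and r: "0 < r"
    and le: "gap_pos A b c r z \<le> ereal g" and d: "norm (embz z - embz w) \<le> r"
  shows "D.gap (embz z) (embz w) \<le> r * g"
proof -
  let ?f = "\<lambda>w. lagrangian A b c (fst z) (snd w) - lagrangian A b c (fst w) (snd z)"
  have "w \<in> gap_ball A r z" using w d pd_dist_embz[OF z w] by (simp add: gap_ball_def)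
  then have "ereal (?f w) \<le> (SUP w\<in>gap_ball A r z. ereal (?f w))" by (rule SUP_upper)
  then have "ereal (1 / r) * ereal (?f w) \<le> gap_pos A b c r z"
    unfolding gap_pos_def using r by (intro ereal_mult_left_mono) auto
  then have "ereal (1 / r) * ereal (?f w) \<le> ereal g" using le by (rule order_trans)
  then show ?thesis using r by (simp add: lagrangian_gap[OF z w] field_simps)
qed

text \<open>The duality gap is scaled by \<open>8 R\<close>, a bound on the norms of all restart points and on the
distances between consecutive ones.\<close>

definition kkt_error :: "pd_point \<Rightarrow> real" where
  "kkt_error z = max (max
     (L2_set (\<lambda>i. b $ i - (\<Sum>j<m2. A $$ (i, j) * fst z $ j)) {..<m1})
     (L2_set (\<lambda>j. max 0 (- S.slack (\<lambda>i. snd z $ i) j)) {..<m2}))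
     (((\<Sum>j<m2. c $ j * fst z $ j) - (\<Sum>i<m1. b $ i * snd z $ i)) / (8 * R))"

text \<open>The maximum over the ball is tested with three points: a step of length \<open>r\<close> along the primal
residual \<open>d\<close> in the dual variable, a step of length \<open>r\<close> along the dual residual \<open>q\<close> in the primal
variable, and the point \<open>(1 - \<theta>) z\<close>, which lies in the ball for \<open>\<theta> = r / (8 R)\<close> and sees the
duality gap itself.\<close>

lemma kkt_error_le_gap_pos:
  assumes z: "z \<in> pd_domain A" and nz: "norm (embz z) \<le> 8 * R" and r: "0 < r" "r \<le> 8 * R"
    and le: "gap_pos A b c r z \<le> ereal g"
  shows "kkt_error z \<le> g"
proof -
  obtain x y where zxy: "z = (x, y)" by force
  have x: "x \<in> carrier_vec m2" "\<forall>j<m2. 0 \<le> x $ j" and y: "y \<in> carrier_vec m1"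
    using z by (auto simp: domain_iff zxy)
  define d where "d = vec m1 (\<lambda>i. b $ i - (\<Sum>j<m2. A $$ (i, j) * x $ j))"
  define s where "s = vec m2 (S.slack (\<lambda>i. y $ i))"
  define q where "q = vec m2 (\<lambda>j. max 0 (- s $ j))"
  have ed: "emb b - mat_op A (emb x) = emb d" and es: "emb c - mat_op A\<^sup>T (emb y) = emb s"
    unfolding d_def s_def by (simp_all add: residual_emb slack_emb x y)
  have gap: "D.gap (embz z) w = inner (emb s) (emb x - fst w) + inner (emb d) (snd w - emb y)" for w
    unfolding D.gap_eq_primal by (simp add: embz_def zxy ed es)
  note core = gap_pos_D[OF z _ r(1) le]
  have "0 \<le> r * g" using core[OF z] r by (simp add: D.gap_def)
  then have g0: "0 \<le> g" using r(1) by (simp add: zero_le_mult_iff)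
  have "norm (emb d) \<le> g"
  proof (cases "norm (emb d) = 0")
    case False
    define w where "w = (x, y + (r / norm (emb d)) \<cdot>\<^sub>v d)"
    have ew: "embz w = (emb x, emb y + (r / norm (emb d)) *\<^sub>R emb d)"
      using y by (simp add: embz_def w_def d_def emb_add emb_smult)
    have "w \<in> pd_domain A" using x y by (simp add: domain_iff w_def d_def)
    moreover have "norm (embz z - embz w) \<le> r"
      using False r(1) unfolding ew by (simp add: embz_def zxy norm_Pair)
    ultimately have "D.gap (embz z) (embz w) \<le> r * g" by (rule core)
    then have "r * norm (emb d) \<le> r * g"
      using False unfolding gap ew by (simp add: power2_norm_eq_inner[symmetric] power2_eq_square)
    then show ?thesis using r(1) by simp
  qed (use g0 in simp)
  moreover have "norm (emb q) \<le> g"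
  proof (cases "norm (emb q) = 0")
    case False
    define w where "w = (x + (r / norm (emb q)) \<cdot>\<^sub>v q, y)"
    have ew: "embz w = (emb x + (r / norm (emb q)) *\<^sub>R emb q, emb y)"
      using x by (simp add: embz_def w_def q_def emb_add emb_smult)
    have "w \<in> pd_domain A" using x y r(1) by (simp add: domain_iff w_def q_def)
    moreover have "norm (embz z - embz w) \<le> r"
      using False r(1) unfolding ew by (simp add: embz_def zxy norm_Pair)
    ultimately have "D.gap (embz z) (embz w) \<le> r * g" by (rule core)
    moreover have "inner (emb s) (emb q) = - (norm (emb q))\<^sup>2"
      by (auto simp: power2_norm_eq_inner inner_emb_emb q_def s_def max_def sum_negf[symmetric] intro!: sum.cong)
    ultimately have "r * norm (emb q) \<le> r * g"
      using False unfolding gap ew by (simp add: power2_eq_square)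
    then show ?thesis using r(1) by simp
  qed (use g0 in simp)
  moreover have "((\<Sum>j<m2. c $ j * x $ j) - (\<Sum>i<m1. b $ i * y $ i)) / (8 * R) \<le> g"
  proof -
    define \<theta> where "\<theta> = r / (8 * R)"
    have R0: "0 < R" using R_bounds(2) by simp
    have \<theta>: "0 < \<theta>" "\<theta> \<le> 1" using r R0 by (auto simp: \<theta>_def)
    define w where "w = ((1 - \<theta>) \<cdot>\<^sub>v x, (1 - \<theta>) \<cdot>\<^sub>v y)"
    have ew: "embz w = ((1 - \<theta>) *\<^sub>R emb x, (1 - \<theta>) *\<^sub>R emb y)"
      by (simp add: embz_def w_def emb_smult)
    have diff: "embz z - embz w = \<theta> *\<^sub>R embz z" unfolding ew by (simp add: embz_def zxy algebra_simps)
    have "w \<in> pd_domain A" using x y \<theta> by (simp add: domain_iff w_def)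
    moreover have "norm (embz z - embz w) \<le> r"
    proof -
      have "norm (embz z - embz w) = \<theta> * norm (embz z)" unfolding diff using \<theta> by simp
      also have "\<dots> \<le> \<theta> * (8 * R)" using nz \<theta> by (intro mult_left_mono) auto
      finally show ?thesis using R0 by (simp add: \<theta>_def)
    qed
    ultimately have "D.gap (embz z) (embz w) \<le> r * g" by (rule core)
    moreover have "D.gap (embz z) (embz w) = \<theta> * (inner (emb s) (emb x) - inner (emb d) (emb y))"
      unfolding gap ew by (simp add: algebra_simps inner_diff_right inner_add_right)
    moreover have "inner (emb s) (emb x) - inner (emb d) (emb y)
        = (\<Sum>j<m2. c $ j * x $ j) - (\<Sum>i<m1. b $ i * y $ i)"
      using S.lagrange_identity[of "\<lambda>j. x $ j" "\<lambda>i. y $ i"] x y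
      by (simp add: inner_emb_emb s_def d_def mult.commute)
    ultimately have "\<theta> * ((\<Sum>j<m2. c $ j * x $ j) - (\<Sum>i<m1. b $ i * y $ i)) \<le> r * g" by simp
    then have "r * (((\<Sum>j<m2. c $ j * x $ j) - (\<Sum>i<m1. b $ i * y $ i)) / (8 * R)) \<le> r * g"
      by (simp add: \<theta>_def)
    then show ?thesis using r(1) by (rule mult_left_le_imp_le)
  qed
  ultimately show ?thesis
    by (simp add: kkt_error_def zxy norm_emb_L2 d_def q_def s_def cong: L2_set_cong_simp)
qed

text \<open>For \<open>r = 0\<close> the gap is an upper limit of gaps with small positive radius, each of which bounds the
error.\<close>

lemma kkt_error_le_normalized_gap:
  assumes z: "z \<in> pd_domain A" and nz: "norm (embz z) \<le> 8 * R" and r: "0 \<le> r" "r \<le> 8 * R"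
    and le: "normalized_gap A b c r z \<le> ereal g"
  shows "kkt_error z \<le> g"
proof (cases "r = 0")
  case False
  then show ?thesis
    using kkt_error_le_gap_pos[OF z nz _ r(2)] r(1) le by (simp add: normalized_gap_def)
next
  case True
  show ?thesis
  proof (rule dense_ge)
    fix g' assume "g < g'"
    then have "Limsup (at_right 0) (\<lambda>s. gap_pos A b c s z) < ereal g'"
      using le True by (simp add: normalized_gap_def le_less_trans)
    then have "eventually (\<lambda>s. gap_pos A b c s z < ereal g') (at_right 0)" by (rule Limsup_lessD)
    moreover have "eventually (\<lambda>s. s \<in> {0<..<8 * R}) (at_right (0 :: real))"
      using R_bounds(2) by (intro eventually_at_right_real) simp
    ultimately have "eventually (\<lambda>s. gap_pos A b c s z < ereal g' \<and> s \<in> {0<..<8 * R}) (at_right 0)"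
      by (rule eventually_conj)
    then obtain s where "gap_pos A b c s z < ereal g'" "0 < s" "s < 8 * R"
      using eventually_happens[of _ "at_right (0 :: real)"] by force
    then show "kkt_error z \<le> g'" using kkt_error_le_gap_pos[OF z nz, of s g'] by simp
  qed
qed

text \<open>The constant is \<open>21 + 11\<close>, the sum of the primal and the dual part.\<close>

lemma sharpness:
  assumes z: "z \<in> pd_domain A" and nz: "norm (embz z) \<le> 8 * R" and r: "0 \<le> r" "r \<le> 8 * R"
    and le: "normalized_gap A b c r z \<le> ereal g"
  shows "\<exists>w. saddle w \<and> pd_dist z w \<le> 32 * real m1 * R * g"
proof -
  have R0: "0 < R" using R_bounds(2) by simp
  have err: "kkt_error z \<le> g" by (rule kkt_error_le_normalized_gap[OF assms])
  obtain xs ys where opt: "S.primal_sol xs" "\<forall>j<m2. xs j \<in> \<int>" "S.dual_sol ys" "\<forall>i<m1. ys i \<in> \<int>"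
      "S.complementary xs ys" "L2_set xs {..<m2} \<le> R" "L2_set ys {..<m1} \<le> R"
    using integral_optimal_pair by blast
  let ?x = "\<lambda>j. fst z $ j" and ?y = "\<lambda>i. snd z $ i"
  have "\<exists>xh yh. S.primal_sol xh \<and> S.dual_sol yh \<and> S.complementary xh ys \<and> S.complementary xs yh \<and>
      (\<Sum>j<m2. \<bar>?x j - xh j\<bar>) \<le> 21 * real m1 * R * g \<and> (\<Sum>i<m1. \<bar>?y i - yh i\<bar>) \<le> 11 * real m1 * R * g"
  proof (rule S.kkt_error_bound)
    show "(\<Sum>j<m2. c $ j * ?x j) - (\<Sum>i<m1. b $ i * ?y i) \<le> 8 * R * g"
      using err R0 by (simp add: kkt_error_def field_simps)
  qed (use opt err z R_bounds m1_pos integral_c in \<open>auto simp: kkt_error_def domain_iff\<close>)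
  then obtain xh yh where h: "S.primal_sol xh" "S.dual_sol yh" "S.complementary xh ys" "S.complementary xs yh"
      "(\<Sum>j<m2. \<bar>?x j - xh j\<bar>) \<le> 21 * real m1 * R * g" "(\<Sum>i<m1. \<bar>?y i - yh i\<bar>) \<le> 11 * real m1 * R * g"
    by blast
  define w where "w = (vec m2 xh, vec m1 yh)"
  have "(\<Sum>j<m2. c $ j * xh j) = (\<Sum>i<m1. b $ i * yh i)"
    using complementary_value[OF h(1,3)] complementary_value[OF opt(1,5)] complementary_value[OF opt(1) h(4)]
    by simp
  then have sad: "saddle w"
    using h(1,2) by (simp add: saddle_def w_def S.primal_sol_def S.dual_sol_def S.slack_def)
  have "pd_dist z w \<le> vec_norm2 (fst z - fst w) + vec_norm2 (snd z - snd w)"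
    unfolding pd_dist_def by (rule sqrt_sum_squares_le_sum) (simp_all flip: norm_emb)
  also have "vec_norm2 (fst z - fst w) \<le> (\<Sum>j<m2. \<bar>?x j - xh j\<bar>)"
    using L2_set_le_sum_abs[of "\<lambda>j. ?x j - xh j" "{..<m2}"] z
    by (simp add: vec_norm2_L2 w_def domain_iff cong: L2_set_cong_simp)
  also have "vec_norm2 (snd z - snd w) \<le> (\<Sum>i<m1. \<bar>?y i - yh i\<bar>)"
    using L2_set_le_sum_abs[of "\<lambda>i. ?y i - yh i" "{..<m1}"] z
    by (simp add: vec_norm2_L2 w_def domain_iff cong: L2_set_cong_simp)
  finally have "pd_dist z w \<le> 32 * real m1 * R * g" using h(5,6) by simp
  then show ?thesis using sad by blast
qed

lemma average_closer_to_saddle: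
  assumes w: "saddle w" and z: "z \<in> pd_domain A" and t: "1 \<le> t"
  shows "D.prec_sq (embz (pdhg_average A b c \<eta> z t) - embz w) \<le> D.prec_sq (embz z - embz w)"
proof -
  have "D.prec_sq (average (\<lambda>i. embz (pdhg_iterate A b c \<eta> z i)) t - embz w)
      \<le> D.prec_sq (embz (pdhg_iterate A b c \<eta> z 0) - embz w)"
    by (rule D.fejer_avg[where z = "\<lambda>i. embz (pdhg_iterate A b c \<eta> z i)", OF iterates(2)[OF z] t domain_nonneg_cone[OF saddle_domain[OF w]]
        saddle_gap[OF w iterates(1)[OF z]]])
  then show ?thesis by (simp add: average_embz[OF z] pdhg_iterate_def)
qed

lemma gap_pos_average_le:
  assumes z: "z \<in> pd_domain A" and t: "1 \<le> t" and s: "0 < s"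
  defines "v \<equiv> pdhg_average A b c \<eta> z t"
  shows "gap_pos A b c s v \<le> ereal (3 * (pd_dist v z + s)\<^sup>2 / (4 * \<eta> * real t) / s)"
proof -
  have v: "v \<in> pd_domain A" and ev: "embz v = average (\<lambda>i. embz (pdhg_iterate A b c \<eta> z i)) t"
    unfolding v_def using average_embz[OF z] by auto
  have e0: "embz (pdhg_iterate A b c \<eta> z 0) = embz z" by (simp add: pdhg_iterate_def)
  have "(SUP w\<in>gap_ball A s v. ereal (lagrangian A b c (fst v) (snd w) - lagrangian A b c (fst w) (snd v)))
      \<le> ereal (3 * (pd_dist v z + s)\<^sup>2 / (4 * \<eta> * real t))"
  proof (rule SUP_least)
    fix w assume "w \<in> gap_ball A s v"
    then have w: "w \<in> pd_domain A" "norm (embz w - embz v) \<le> s"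
      using pd_dist_embz[OF v, of w] by (auto simp: gap_ball_def norm_minus_commute)
    have "D.gap (embz v) (embz w) \<le> 3 * (norm (embz v - embz z) + s)\<^sup>2 / (4 * \<eta> * real t)"
      using D.avg_gap_ball[where z = "\<lambda>i. embz (pdhg_iterate A b c \<eta> z i)", OF iterates(2)[OF z] t domain_nonneg_cone[OF w(1)], where r = s] w(2) by (simp add: ev e0)
    then show "ereal (lagrangian A b c (fst v) (snd w) - lagrangian A b c (fst w) (snd v))
        \<le> ereal (3 * (pd_dist v z + s)\<^sup>2 / (4 * \<eta> * real t))"
      by (simp add: lagrangian_gap[OF v w(1)] pd_dist_embz[OF v z])
  qed
  then have "gap_pos A b c s v \<le> ereal (1 / s) * ereal (3 * (pd_dist v z + s)\<^sup>2 / (4 * \<eta> * real t))"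
    unfolding gap_pos_def using s by (intro ereal_mult_left_mono) auto
  then show ?thesis by (simp add: mult.commute[of s])
qed

text \<open>Every point of the ball of radius \<open>r\<close> around the average has distance at most \<open>2 r\<close> from the
starting point. If the average is the starting point itself, the gap with radius \<open>s\<close> is \<open>O(s)\<close> and
the upper limit is at most zero.\<close>

lemma normalized_gap_average_le:
  assumes z: "z \<in> pd_domain A" and t: "1 \<le> t"
  defines "v \<equiv> pdhg_average A b c \<eta> z t"
  shows "normalized_gap A b c (pd_dist v z) v \<le> ereal (3 * pd_dist v z / (\<eta> * real t))"
proof -
  let ?r = "pd_dist v z"
  have r0: "0 \<le> ?r" by (simp add: pd_dist_def)
  note bd = gap_pos_average_le[OF z t, folded v_def]
  show ?thesis
  proof (cases "?r = 0")
    case False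
    then have "3 * (?r + ?r)\<^sup>2 / (4 * \<eta> * real t) / ?r = 3 * ?r / (\<eta> * real t)"
      by (simp add: power2_eq_square field_simps)
    then show ?thesis using False r0 bd[of ?r] by (simp add: normalized_gap_def)
  next
    case True
    let ?C = "3 / (4 * \<eta> * real t)"
    have "eventually (\<lambda>s. gap_pos A b c s v \<le> ereal (?C * s)) (at_right 0)"
      unfolding eventually_at_right_field
    proof (intro exI[of _ 1] conjI allI impI)
      fix s :: real assume s: "0 < s" "s < 1"
      have "3 * (?r + s)\<^sup>2 / (4 * \<eta> * real t) / s = ?C * s"
        using s True by (simp add: power2_eq_square)
      then show "gap_pos A b c s v \<le> ereal (?C * s)" using bd[OF s(1)] by simp
    qed simp
    then have "Limsup (at_right 0) (\<lambda>s. gap_pos A b c s v) \<le> Limsup (at_right 0) (\<lambda>s. ereal (?C * s))"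
      by (rule Limsup_mono)
    also have "((\<lambda>s. ereal (?C * s)) \<longlongrightarrow> ereal (?C * 0)) (at_right 0)"
      by (intro tendsto_intros)
    then have "Limsup (at_right 0) (\<lambda>s. ereal (?C * s)) = ereal (?C * 0)"
      by (intro lim_imp_Limsup) simp_all
    finally show ?thesis using True by (simp add: normalized_gap_def)
  qed
qed

end

section \<open>Restarts\<close>

lemma restart_condition_cong:
  assumes "zs k = zs' k" "zs (k - 1) = zs' (k - 1)"
  shows "restart_condition A b c \<tau>0 \<beta> \<eta> zs k t = restart_condition A b c \<tau>0 \<beta> \<eta> zs' k t"
  unfolding restart_condition_def assms ..

context tu_lp
begin

text \<open>With \<open>\<kappa> = 32 m\<^sub>1 R\<close>, sharpness at the start of the round gives an optimal point at distance at most
\<open>\<kappa> h\<close>, where \<open>h\<close> is the gap there. The average stays within \<open>3 \<kappa> h\<close> of the start, and so has gap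
at most \<open>9 \<kappa> h / (\<eta> t)\<close>.\<close>

lemma restart_soon:
  assumes z: "z \<in> pd_domain A" and nz: "norm (embz z) \<le> 8 * R" and r: "0 \<le> r" "r \<le> 8 * R"
    and fin: "normalized_gap A b c r z \<le> ereal g" and \<beta>: "0 < \<beta>"
    and t: "1 \<le> t" "9 * (32 * real m1 * R) / (\<eta> * \<beta>) \<le> real t"
  defines "v \<equiv> pdhg_average A b c \<eta> z t"
  shows "normalized_gap A b c (pd_dist v z) v \<le> ereal \<beta> * normalized_gap A b c r z"
proof -
  let ?K = "32 * real m1 * R"
  have K0: "0 < ?K" using m1_pos R_bounds(2) by simp
  have dist0: "0 \<le> pd_dist z w" for w by (simp add: pd_dist_def)
  show ?thesis
  proof (cases "normalized_gap A b c r z")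
    case (real h)
    then obtain w where w: "saddle w" "pd_dist z w \<le> ?K * h"
      using sharpness[OF z nz r, of h] by auto
    have h0: "0 \<le> h" using dist0[of w] w(2) K0 by (meson order_trans zero_le_mult_iff not_less order_less_imp_le)
    have v: "v \<in> pd_domain A" unfolding v_def by (rule average_embz(1)[OF z])
    have "pd_dist v z = norm (embz v - embz z)" by (rule pd_dist_embz[OF v z])
    also have "\<dots> \<le> norm (embz v - embz w) + norm (embz z - embz w)"
      using norm_triangle_ineq4[of "embz v - embz w" "embz z - embz w"] by simp
    also have "norm (embz v - embz w) \<le> 2 * norm (embz z - embz w)"
      unfolding v_def by (rule D.norm_le_of_prec_sq_le[OF average_closer_to_saddle[OF w(1) z t(1)]])
    also have "norm (embz z - embz w) = pd_dist z w"
      by (rule pd_dist_embz[OF z saddle_domain[OF w(1)], symmetric])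
    finally have d: "pd_dist v z \<le> 3 * (?K * h)" using w(2) by simp
    have pos: "0 < \<eta> * real t" using eta_pos t(1) by simp
    have "9 * ?K \<le> \<beta> * (\<eta> * real t)"
      using t(2) eta_pos \<beta> by (simp add: divide_le_eq mult_ac)
    then have "9 * ?K * h \<le> \<beta> * (\<eta> * real t) * h" using h0 by (rule mult_right_mono)
    then have "3 * pd_dist v z \<le> \<beta> * h * (\<eta> * real t)" using d by (simp add: mult_ac)
    then have "3 * pd_dist v z / (\<eta> * real t) \<le> \<beta> * h" using pos by (simp add: divide_le_eq)
    then have "ereal (3 * pd_dist v z / (\<eta> * real t)) \<le> ereal \<beta> * normalized_gap A b c r z"
      by (simp add: real)
    with normalized_gap_average_le[OF z t(1)] show ?thesis unfolding v_def by (rule order_trans)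
  next
    case PInf
    then show ?thesis using fin by simp
  next
    \<comment> \<open>impossible: sharpness with a negative bound would produce a negative distance\<close>
    case MInf
    then obtain w where "pd_dist z w \<le> ?K * (- 1)"
      using sharpness[OF z nz r, of "- 1"] by auto
    then show ?thesis using dist0[of w] K0 by linarith
  qed
qed

text \<open>The algorithm starts at the origin and no restart increases the preconditioned distance from \<open>w\<close>;
so the bounds hold for all restart points \<open>u\<close>.\<close>

lemma near_saddle_bounds:
  assumes w: "norm w \<le> 2 * R" and u: "D.prec_sq (u - w) \<le> D.prec_sq (0 - w)"
  shows "norm (u - w) \<le> 4 * R" "norm u \<le> 6 * R"
proof -
  show *: "norm (u - w) \<le> 4 * R" using D.norm_le_of_prec_sq_le[OF u] w by simp
  show "norm u \<le> 6 * R" using norm_triangle_ineq[of "u - w" w] * w by simp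
qed

lemma bounded_saddle: "\<exists>w. saddle w \<and> norm (embz w) \<le> 2 * R"
proof -
  obtain xs ys where opt: "S.primal_sol xs" "S.dual_sol ys" "S.complementary xs ys"
      "L2_set xs {..<m2} \<le> R" "L2_set ys {..<m1} \<le> R"
    using integral_optimal_pair by blast
  define w where "w = (vec m2 xs, vec m1 ys)"
  have "saddle w" using opt(1,2) complementary_value[OF opt(1,3)]
    by (simp add: saddle_def w_def S.primal_sol_def S.dual_sol_def S.slack_def)
  moreover have "norm (embz w) \<le> norm (emb (vec m2 xs)) + norm (emb (vec m1 ys))"
    unfolding embz_def w_def fst_conv snd_conv by (rule norm_Pair_le)
  moreover have "norm (emb (vec m2 xs)) \<le> R" "norm (emb (vec m1 ys)) \<le> R"
    using opt(4,5) by (simp_all add: norm_emb_L2 cong: L2_set_cong_simp)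
  ultimately show ?thesis by fastforce
qed

text \<open>Every round stops after at most \<open>T\<close> steps, and each restart multiplies the gap by at most \<open>\<beta>\<close>. The
first round has a single step, and the average after it lies within \<open>6 R\<close> of the origin, whence
the initial gap \<open>18 R / \<eta>\<close>.\<close>

lemma run_exists:
  assumes \<beta>: "0 < \<beta>" and T: "1 \<le> T" "9 * (32 * real m1 * R) / (\<eta> * \<beta>) \<le> real T"
    and w: "saddle w" "norm (embz w) \<le> 2 * R"
  shows "\<exists>zs \<tau>. restarted_pdhg_run A b c (0\<^sub>v m2, 0\<^sub>v m1) 1 \<beta> \<eta> n zs \<tau> \<and>
    (\<forall>k\<le>n. zs k \<in> pd_domain A \<and> D.prec_sq (embz (zs k) - embz w) \<le> D.prec_sq (0 - embz w)) \<and>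
    (\<forall>k<n. \<tau> k \<le> T \<and>
       normalized_gap A b c (pd_dist (zs (Suc k)) (zs k)) (zs (Suc k)) \<le> ereal (\<beta> ^ k * (18 * R / \<eta>)))"
proof (induction n)
  case 0
  have "embz (0\<^sub>v m2, 0\<^sub>v m1) = 0" by (simp add: embz_def emb_zero zero_prod_def)
  then show ?case
    by (intro exI[of _ "\<lambda>_. (0\<^sub>v m2, 0\<^sub>v m1)"] exI[of _ "\<lambda>_. 0"])
      (simp add: restarted_pdhg_run_def domain_iff)
next
  case (Suc n)
  let ?cond = "restart_condition A b c 1 \<beta> \<eta>"
  obtain zs \<tau> where run: "restarted_pdhg_run A b c (0\<^sub>v m2, 0\<^sub>v m1) 1 \<beta> \<eta> n zs \<tau>"
    and dom: "\<And>k. k \<le> n \<Longrightarrow> zs k \<in> pd_domain A"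
    and Q: "\<And>k. k \<le> n \<Longrightarrow> D.prec_sq (embz (zs k) - embz w) \<le> D.prec_sq (0 - embz w)"
    and \<tau>: "\<And>k. k < n \<Longrightarrow> \<tau> k \<le> T"
    and gap: "\<And>k. k < n \<Longrightarrow> normalized_gap A b c (pd_dist (zs (Suc k)) (zs k)) (zs (Suc k))
        \<le> ereal (\<beta> ^ k * (18 * R / \<eta>))"
    using Suc.IH by blast
  note near = near_saddle_bounds[OF w(2) Q]
  have R0: "0 < R" using R_bounds(2) by simp
  have "?cond zs n T"
  proof (cases n)
    case 0
    then show ?thesis using T(1) by (simp add: restart_condition_def)
  next
    case (Suc m)
    have "pd_dist (zs (Suc m)) (zs m) \<le> norm (embz (zs (Suc m)) - embz w) + norm (embz (zs m) - embz w)"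
      using norm_triangle_ineq4[of "embz (zs (Suc m)) - embz w" "embz (zs m) - embz w"]
      by (simp add: pd_dist_embz dom Suc)
    also have "\<dots> \<le> 4 * R + 4 * R" by (intro add_mono near) (simp_all add: Suc)
    finally have r: "pd_dist (zs (Suc m)) (zs m) \<le> 8 * R" by simp
    have nz: "norm (embz (zs (Suc m))) \<le> 8 * R" using near(2)[of "Suc m"] R0 by (simp add: Suc)
    have dom': "zs (Suc m) \<in> pd_domain A" by (simp add: dom Suc)
    have r0: "0 \<le> pd_dist (zs (Suc m)) (zs m)" by (simp add: pd_dist_def)
    have g: "normalized_gap A b c (pd_dist (zs (Suc m)) (zs m)) (zs (Suc m)) \<le> ereal (\<beta> ^ m * (18 * R / \<eta>))"
      by (rule gap) (simp add: Suc)
    show ?thesis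
      using restart_soon[OF dom' nz r0 r g \<beta> T] by (simp add: restart_condition_def Suc Let_def)
  qed
  then have ex: "1 \<le> T \<and> ?cond zs n T" using T(1) by blast
  define t where "t = (LEAST t. 1 \<le> t \<and> ?cond zs n t)"
  have t: "1 \<le> t" "?cond zs n t"
    using LeastI[of "\<lambda>t. 1 \<le> t \<and> ?cond zs n t", OF ex] by (simp_all add: t_def)
  have tT: "t \<le> T"
    unfolding t_def by (rule Least_le[of "\<lambda>t. 1 \<le> t \<and> ?cond zs n t", OF ex])
  have first: "\<not> ?cond zs n t'" if "1 \<le> t'" "t' < t" for t'
    using not_less_Least[of t' "\<lambda>t. 1 \<le> t \<and> ?cond zs n t"] that by (auto simp: t_def)
  define v where "v = pdhg_average A b c \<eta> (zs n) t"
  have dz: "zs n \<in> pd_domain A" by (simp add: dom)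
  have dv: "v \<in> pd_domain A" unfolding v_def by (rule average_embz(1)[OF dz])
  have Qv: "D.prec_sq (embz v - embz w) \<le> D.prec_sq (0 - embz w)"
    unfolding v_def by (rule order_trans[OF average_closer_to_saddle[OF w(1) dz t(1)] Q]) simp
  have gv: "normalized_gap A b c (pd_dist v (zs n)) v \<le> ereal (\<beta> ^ n * (18 * R / \<eta>))"
  proof (cases n)
    case 0
    have "zs 0 = (0\<^sub>v m2, 0\<^sub>v m1)" using run by (simp add: restarted_pdhg_run_def)
    then have "embz (zs n) = 0" by (simp add: 0 embz_def emb_zero zero_prod_def)
    then have "pd_dist v (zs n) \<le> 6 * R"
      using near_saddle_bounds(2)[OF w(2) Qv] by (simp add: pd_dist_embz[OF dv dz])
    moreover have "\<eta> \<le> \<eta> * real t" using t(1) eta_pos by simp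
    ultimately have "3 * pd_dist v (zs n) / (\<eta> * real t) \<le> 3 * (6 * R) / \<eta>"
      using eta_pos R0 by (intro frac_le) auto
    then have "ereal (3 * pd_dist v (zs n) / (\<eta> * real t)) \<le> ereal (\<beta> ^ n * (18 * R / \<eta>))"
      by (simp add: 0)
    with normalized_gap_average_le[OF dz t(1)] show ?thesis unfolding v_def by (rule order_trans)
  next
    case (Suc m)
    have "normalized_gap A b c (pd_dist v (zs n)) v
        \<le> ereal \<beta> * normalized_gap A b c (pd_dist (zs (Suc m)) (zs m)) (zs (Suc m))"
      using t(2) by (simp add: restart_condition_def Suc Let_def v_def)
    also have "\<dots> \<le> ereal \<beta> * ereal (\<beta> ^ m * (18 * R / \<eta>))"
      using \<beta> gap[of m] by (intro ereal_mult_left_mono) (simp_all add: Suc)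
    finally show ?thesis by (simp add: Suc mult.assoc)
  qed
  let ?zs = "zs(Suc n := v)" and ?\<tau> = "\<tau>(n := t)"
  have cong: "?cond (zs(Suc n := u)) k = ?cond zs k" if "k \<le> n" for k u
    using that by (intro ext restart_condition_cong) auto
  have "restarted_pdhg_run A b c (0\<^sub>v m2, 0\<^sub>v m1) 1 \<beta> \<eta> (Suc n) ?zs ?\<tau>"
    using run t first unfolding restarted_pdhg_run_def
    by (auto simp: less_Suc_eq cong v_def simp del: One_nat_def)
  moreover have "?zs k \<in> pd_domain A \<and> D.prec_sq (embz (?zs k) - embz w) \<le> D.prec_sq (0 - embz w)" if "k \<le> Suc n" for k
    using that dom Q dv Qv by (cases "k = Suc n") auto
  moreover have "?\<tau> k \<le> T \<and> normalized_gap A b c (pd_dist (?zs (Suc k)) (?zs k)) (?zs (Suc k))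
      \<le> ereal (\<beta> ^ k * (18 * R / \<eta>))" if "k < Suc n" for k
    using that \<tau> gap tT gv by (cases "k = n") auto
  ultimately show ?case by blast
qed

lemma nnz_le: "nnz A \<le> m1 * m2"
proof -
  have "nnz A \<le> card ({..<m1} \<times> {..<m2})"
    unfolding nnz_def dims by (intro card_mono) auto
  then show ?thesis by simp
qed

lemma m1_R: "real m1 * R = H * real m1 powr 2.5"
proof -
  have "real m1 powr 2.5 = real m1 powr 2 * real m1 powr (1 / 2)"
    by (subst powr_add[symmetric]) simp
  also have "\<dots> = (real m1)\<^sup>2 * sqrt (real m1)" using m1_pos by (simp add: powr_half_sqrt)
  finally show ?thesis by (simp add: R_def power2_eq_square)
qed

text \<open>With \<open>X = m\<^sub>2 H / min \<epsilon> (1 / 2) \<ge> 2\<close> the initial gap times the sharpness constant is at most \<open>2304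
(m\<^sub>2 H)\<^sup>5 \<le> X\<^sup>1\<^sup>7 \<epsilon>\<close>, because \<open>2304 \<le> 2\<^sup>1\<^sup>2\<close>. So \<open>17 ln X / ln (1 / \<beta>)\<close> restarts suffice. The other
constant is \<open>1152 = 9 \<cdot> 32 \<cdot> 4\<close>, with the \<open>4\<close> from \<open>1 / \<eta> \<le> 4 \<sigma>\<close>; the summands \<open>1\<close> and \<open>2 / ln 2\<close>
pay for rounding up.\<close>

lemma iteration_bound:
  assumes \<beta>: "0 < \<beta>" "\<beta> < 1" and m12: "m1 \<le> m2" and \<epsilon>: "0 < \<epsilon>"
  defines "L \<equiv> ln (real m2 * H / min \<epsilon> (1 / 2))"
  shows "0 < L"
    and "\<exists>n zs \<tau>. restarted_pdhg_run A b c (0\<^sub>v m2, 0\<^sub>v m1) 1 \<beta> \<eta> n zs \<tau> \<and>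
      dist_to_set (zs n) (pd_optimal A b c) \<le> ereal \<epsilon> \<and>
      real (\<Sum>k<n. \<tau> k) \<le> (1152 / \<beta> + 1) * (17 / ln (1 / \<beta>) + 2 / ln 2) *
        (H * real m1 powr 2.5 * sqrt (real (nnz A)) * L)"
proof -
  define \<delta> where "\<delta> = min \<epsilon> (1 / 2)"
  define X where "X = real m2 * H / \<delta>"
  define a where "a = ln (1 / \<beta>)"
  define W where "W = real m1 * R * sqrt (real (nnz A))"
  let ?K = "32 * real m1 * R"
  have \<delta>: "0 < \<delta>" "\<delta> \<le> \<epsilon>" "\<delta> \<le> 1 / 2" using \<epsilon> by (auto simp: \<delta>_def)
  have m2H: "1 \<le> real m2 * H"
    using mult_mono[of 1 "real m2" 1 H] m1_pos m12 H_ge_1 by simp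
  have X2: "2 \<le> X" using \<delta> m2H by (simp add: X_def le_divide_eq)
  have L: "L = ln X" by (simp add: L_def X_def \<delta>_def)
  have L2: "ln 2 \<le> L" using X2 by (simp add: L)
  have l2: "(0 :: real) < ln 2" by simp
  show "0 < L" using L2 l2 by linarith
  then have Lpos: "0 < L" .
  have apos: "0 < a" using \<beta> by (simp add: a_def)
  have R0: "0 < R" using R_bounds(2) by simp
  have K0: "0 < ?K" using m1_pos R0 by simp
  have \<sigma>: "1 \<le> spectral_norm A" "spectral_norm A \<le> sqrt (real (nnz A))"
    using sigma_ge_1 spectral_norm_bounds(1)[OF totally_unimodular_A] .
  have W1: "1 \<le> W"
  proof -
    have "1 \<le> sqrt (real (nnz A))" using \<sigma> by linarith
    then have "1 * 1 * 1 \<le> real m1 * R * sqrt (real (nnz A))"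
      using m1_pos R_bounds(2) by (intro mult_mono) auto
    then show ?thesis by (simp add: W_def)
  qed
  define T where "T = nat \<lceil>9 * ?K / (\<eta> * \<beta>)\<rceil>"
  define N where "N = nat \<lceil>17 * L / a\<rceil>"
  have q0: "0 < 9 * ?K / (\<eta> * \<beta>)" using K0 eta_pos \<beta> by simp
  have T: "1 \<le> T" "9 * ?K / (\<eta> * \<beta>) \<le> real T"
    using q0 by (simp_all add: T_def) linarith
  have "real T \<le> 9 * ?K / (\<eta> * \<beta>) + 1" using q0 unfolding T_def by linarith
  also have "9 * ?K / (\<eta> * \<beta>) = 288 / \<beta> * (real m1 * R) * (1 / \<eta>)" by simp
  also have "\<dots> \<le> 288 / \<beta> * (real m1 * R) * (4 * sqrt (real (nnz A)))"
    using inverse_eta \<sigma> \<beta> R0 by (intro mult_left_mono) auto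
  also have "\<dots> = 1152 / \<beta> * W" by (simp add: W_def)
  finally have TW: "real T \<le> (1152 / \<beta> + 1) * W" using W1 by (simp add: algebra_simps)
  have "real (Suc N) \<le> 17 * L / a + 2" using Lpos apos unfolding N_def by (simp add: le_nat_iff) linarith
  also have "2 \<le> 2 / ln 2 * L" using L2 l2 by (simp add: field_simps)
  finally have NL: "real (Suc N) \<le> (17 / a + 2 / ln 2) * L" by (simp add: algebra_simps)
  obtain w where w: "saddle w" "norm (embz w) \<le> 2 * R" using bounded_saddle by blast
  obtain zs \<tau> where run: "restarted_pdhg_run A b c (0\<^sub>v m2, 0\<^sub>v m1) 1 \<beta> \<eta> (Suc N) zs \<tau>"
    and dom: "\<And>k. k \<le> Suc N \<Longrightarrow> zs k \<in> pd_domain A"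
    and Q: "\<And>k. k \<le> Suc N \<Longrightarrow> D.prec_sq (embz (zs k) - embz w) \<le> D.prec_sq (0 - embz w)"
    and \<tau>: "\<And>k. k < Suc N \<Longrightarrow> \<tau> k \<le> T"
    and gap: "\<And>k. k < Suc N \<Longrightarrow> normalized_gap A b c (pd_dist (zs (Suc k)) (zs k)) (zs (Suc k))
        \<le> ereal (\<beta> ^ k * (18 * R / \<eta>))"
    using run_exists[OF \<beta>(1) T w, of "Suc N"] by blast
  note near = near_saddle_bounds[OF w(2) Q]
  have dz: "zs (Suc N) \<in> pd_domain A" "zs N \<in> pd_domain A" by (simp_all add: dom)
  have "pd_dist (zs (Suc N)) (zs N) \<le> norm (embz (zs (Suc N)) - embz w) + norm (embz (zs N) - embz w)"
    using norm_triangle_ineq4[of "embz (zs (Suc N)) - embz w" "embz (zs N) - embz w"]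
    by (simp add: pd_dist_embz[OF dz])
  also have "\<dots> \<le> 4 * R + 4 * R" by (intro add_mono near) simp_all
  finally have r: "pd_dist (zs (Suc N)) (zs N) \<le> 8 * R" by simp
  have r0: "0 \<le> pd_dist (zs (Suc N)) (zs N)" by (simp add: pd_dist_def)
  have nz: "norm (embz (zs (Suc N))) \<le> 8 * R" using near(2)[of "Suc N"] R0 by simp
  obtain v where v: "saddle v" "pd_dist (zs (Suc N)) v \<le> ?K * (\<beta> ^ N * (18 * R / \<eta>))"
    using sharpness[OF dz(1) nz r0 r gap[of N]] by auto
  have "?K * (\<beta> ^ N * (18 * R / \<eta>)) \<le> \<epsilon>"
  proof -
    have m: "1 \<le> real m1" "real m1 \<le> real m2" using m1_pos m12 by auto
    have "sqrt (real (nnz A)) \<le> sqrt (real m2 * real m2)"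
      using order_trans[OF nnz_le mult_le_mono1[OF m12]] by (intro real_sqrt_le_mono) (simp flip: of_nat_mult)
    then have \<sigma>2: "spectral_norm A \<le> real m2" using \<sigma>(2) by simp
    have R2: "R * R = real m1 ^ 3 * H\<^sup>2"
      by (simp add: R_def power2_eq_square power3_eq_cube mult_ac)
    have "?K * (18 * R / \<eta>) = 576 * (real m1 * (R * R)) * (1 / \<eta>)" by simp
    also have "\<dots> \<le> 576 * (real m1 * (R * R)) * (4 * real m2)"
      using inverse_eta \<sigma>2 by (intro mult_left_mono) auto
    also have "\<dots> = 2304 * (real m1 ^ 4 * real m2 * H\<^sup>2)"
      unfolding R2 by (simp add: power2_eq_square power3_eq_cube power4_eq_xxxx mult_ac)
    also have "\<dots> \<le> 2304 * (real m2 ^ 4 * real m2 * H ^ 5)"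
      using m H_ge_1 by (intro mult_left_mono mult_mono power_mono power_increasing) auto
    also have "\<dots> = 2304 * (X * \<delta>) ^ 5"
      using \<delta> by (simp add: X_def power_mult_distrib numeral_eq_Suc)
    also have "\<dots> \<le> X ^ 12 * (X ^ 5 * \<epsilon>)"
    proof (rule mult_mono)
      have "(2304 :: real) \<le> 2 ^ 12" by simp
      also have "(2 :: real) ^ 12 \<le> X ^ 12" using X2 by (intro power_mono) auto
      finally show "2304 \<le> X ^ 12" .
      have "\<delta> ^ 5 \<le> \<delta> ^ 1" using \<delta> by (intro power_decreasing) auto
      then have "\<delta> ^ 5 \<le> \<epsilon>" using \<delta> by simp
      then show "(X * \<delta>) ^ 5 \<le> X ^ 5 * \<epsilon>" using X2 by (simp add: power_mult_distrib)
    qed (use X2 \<delta> in auto)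
    also have "\<dots> = X ^ 17 * \<epsilon>" by (simp flip: power_add mult.assoc)
    finally have KX: "?K * (18 * R / \<eta>) \<le> X ^ 17 * \<epsilon>" .
    have "17 * L \<le> a * real N" using Lpos apos unfolding N_def
      by (metis (no_types) divide_le_eq mult.commute real_nat_ceiling_ge)
    then have "exp (17 * L) \<le> exp (a * real N)" by simp
    also have "exp (17 * L) = X ^ 17"
      using X2 exp_of_nat_mult[of 17 L] by (simp add: L)
    also have "exp (a * real N) = (1 / \<beta>) ^ N"
      using \<beta> exp_of_nat_mult[of N a] by (simp add: a_def mult.commute)
    finally have XN: "X ^ 17 * \<beta> ^ N \<le> 1" using \<beta> by (simp add: power_one_over field_simps)
    have "?K * (\<beta> ^ N * (18 * R / \<eta>)) = ?K * (18 * R / \<eta>) * \<beta> ^ N" by simp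
    also have "\<dots> \<le> X ^ 17 * \<epsilon> * \<beta> ^ N" using KX \<beta> by (intro mult_right_mono) auto
    also have "\<dots> = X ^ 17 * \<beta> ^ N * \<epsilon>" by simp
    also have "\<dots> \<le> \<epsilon>" using mult_right_mono[OF XN, of \<epsilon>] \<epsilon> by simp
    finally show ?thesis .
  qed
  then have "pd_dist (zs (Suc N)) v \<le> \<epsilon>" using v(2) by linarith
  then have dist: "dist_to_set (zs (Suc N)) (pd_optimal A b c) \<le> ereal \<epsilon>"
    unfolding dist_to_set_def using saddle_optimal[OF v(1)] by (intro INF_lower2[of v]) auto
  have "real (\<Sum>k<Suc N. \<tau> k) \<le> (\<Sum>k<Suc N. real T)"
    unfolding of_nat_sum using \<tau> by (intro sum_mono) auto
  also have "\<dots> = real (Suc N) * real T" by simp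
  also have "\<dots> \<le> ((17 / a + 2 / ln 2) * L) * ((1152 / \<beta> + 1) * W)"
    using NL TW Lpos apos l2 by (intro mult_mono) auto
  also have "\<dots> = (1152 / \<beta> + 1) * (17 / ln (1 / \<beta>) + 2 / ln 2) *
        (H * real m1 powr 2.5 * sqrt (real (nnz A)) * L)"
    unfolding W_def m1_R a_def by (simp only: mult_ac)
  finally show "\<exists>n zs \<tau>. restarted_pdhg_run A b c (0\<^sub>v m2, 0\<^sub>v m1) 1 \<beta> \<eta> n zs \<tau> \<and>
      dist_to_set (zs n) (pd_optimal A b c) \<le> ereal \<epsilon> \<and>
      real (\<Sum>k<n. \<tau> k) \<le> (1152 / \<beta> + 1) * (17 / ln (1 / \<beta>) + 2 / ln 2) *
        (H * real m1 powr 2.5 * sqrt (real (nnz A)) * L)"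
    using run dist by blast
qed

end

lemma zero_optimal:
  assumes "A \<in> carrier_mat m1 m2" "b = 0\<^sub>v m1" "c = 0\<^sub>v m2"
  shows "(0\<^sub>v m2, 0\<^sub>v m1) \<in> pd_optimal A b c"
  using assms unfolding pd_optimal_def primal_optimal_def dual_optimal_def primal_feasible_def dual_feasible_def
  by (auto simp: less_eq_vec_def)

theorem theorem2:
  fixes \<beta> :: real
  assumes "0 < \<beta>" and "\<beta> < 1"
  shows "\<exists>C::real. 0 < C \<and>
    (\<forall>(m1::nat) (m2::nat) (A::real mat) (b::real vec) (c::real vec) (H::real) (\<eta>::real) (\<epsilon>::real).
       0 < m1 \<and> m1 \<le> m2 \<and>
       A \<in> carrier_mat m1 m2 \<and> A \<noteq> 0\<^sub>m m1 m2 \<and> b \<in> carrier_vec m1 \<and> c \<in> carrier_vec m2 \<and>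
       (\<forall>i<m1. \<bar>b $ i\<bar> \<le> H) \<and> (\<forall>j<m2. \<bar>c $ j\<bar> \<le> H) \<and>
       totally_unimodular_lp A b c \<and> primal_optimal A b c \<noteq> {} \<and>
       1 / (4 * spectral_norm A) \<le> \<eta> \<and> \<eta> \<le> 1 / (2 * spectral_norm A) \<and>
       0 < \<epsilon> \<longrightarrow>
       (\<exists>n zs \<tau>.
          restarted_pdhg_run A b c (0\<^sub>v m2, 0\<^sub>v m1) 1 \<beta> \<eta> n zs \<tau> \<and>
          dist_to_set (zs n) (pd_optimal A b c) \<le> ereal \<epsilon> \<and>
          real (\<Sum>k<n. \<tau> k)
            \<le> C * \<bar>H * real m1 powr 2.5 * sqrt (real (nnz A))
                     * ln (real m2 * H / min \<epsilon> (1 / 2))\<bar>))"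
proof (rule exI, intro conjI allI impI)
  let ?C = "(1152 / \<beta> + 1) * (17 / ln (1 / \<beta>) + 2 / ln 2)"
  show C0: "0 < ?C" using assms by (intro mult_pos_pos add_pos_pos divide_pos_pos) auto
  fix m1 m2 :: nat and A :: "real mat" and b c :: "real vec" and H \<eta> \<epsilon> :: real
  assume *: "0 < m1 \<and> m1 \<le> m2 \<and>
       A \<in> carrier_mat m1 m2 \<and> A \<noteq> 0\<^sub>m m1 m2 \<and> b \<in> carrier_vec m1 \<and> c \<in> carrier_vec m2 \<and>
       (\<forall>i<m1. \<bar>b $ i\<bar> \<le> H) \<and> (\<forall>j<m2. \<bar>c $ j\<bar> \<le> H) \<and>
       totally_unimodular_lp A b c \<and> primal_optimal A b c \<noteq> {} \<and>
       1 / (4 * spectral_norm A) \<le> \<eta> \<and> \<eta> \<le> 1 / (2 * spectral_norm A) \<and>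
       0 < \<epsilon>"
  let ?z = "(0\<^sub>v m2, 0\<^sub>v m1) :: pd_point"
  let ?B = "H * real m1 powr 2.5 * sqrt (real (nnz A)) * ln (real m2 * H / min \<epsilon> (1 / 2))"
  show "\<exists>n zs \<tau>. restarted_pdhg_run A b c ?z 1 \<beta> \<eta> n zs \<tau> \<and>
          dist_to_set (zs n) (pd_optimal A b c) \<le> ereal \<epsilon> \<and> real (\<Sum>k<n. \<tau> k) \<le> ?C * \<bar>?B\<bar>"
  proof (cases "1 \<le> H")
    case True
    interpret tu_lp m1 m2 A b c H \<eta>
      using * True by unfold_locales auto
    have "?C * ?B \<le> ?C * \<bar>?B\<bar>" using C0 by (intro mult_left_mono) auto
    then show ?thesis
      using iteration_bound(2)[OF assms, of \<epsilon>] * by (meson order_trans)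
  next
    case False
    have zero: "t = 0" if "t \<in> \<int>" "\<bar>t\<bar> \<le> H" for t :: real
      using that False by (auto elim!: Ints_cases)
    have "b = 0\<^sub>v m1" "c = 0\<^sub>v m2"
      using * by (auto simp: totally_unimodular_lp_def intro!: eq_vecI zero)
    then have "?z \<in> pd_optimal A b c" using * by (intro zero_optimal) auto
    moreover have "pd_dist ?z ?z = 0" by (simp add: pd_dist_def vec_norm2_def)
    ultimately have "dist_to_set ?z (pd_optimal A b c) \<le> ereal \<epsilon>"
      unfolding dist_to_set_def using * by (intro INF_lower2[of ?z]) auto
    then show ?thesis using C0
      by (intro exI[of _ 0] exI[of _ "\<lambda>_. ?z"] exI[of _ "\<lambda>_. 0"]) (simp add: restarted_pdhg_run_def)
  qed
qed

end
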